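(* Let $K$ be an imaginary quadratic field of class number one, $\mathfrak{f}\subset\mathcal{O}_K$ a nonzero ideal, $E$ an elliptic curve and $\omega$ an invariant differential defined over $K$, and $\Omega\in\mathbb{C}^\times$ such that $\Gamma:=\Omega\mathfrak{f}$ is the period lattice of $\omega$, giving $\mathbb{C}/\Gamma\cong E(\mathbb{C})$. Suppose $z_0,w_0\in\Gamma\otimes\mathbb{Q}$. Then the Laurent expansion of $\Theta_{z_0,w_0}(z,w)$ at the origin has coefficients in $\overline{K}$ (the algebraic closure of $K$ in $\mathbb{C}$).
   Context: $A$ is the area of a fundamental domain of $\Gamma$ divided by $\pi$. Let $\theta(z)$ be the entire function with simple zeros exactly at $\Gamma$, satisfying $\theta(z+\gamma)=\alpha(\gamma)\exp\big(\frac{z\overline{\gamma}}{A}+\frac{\gamma\overline{\gamma}}{2A}\big)\theta(z)$ for $\gamma\in\Gamma$, where $\alpha(\gamma)=1$ if $\gamma\in2\Gamma$ and $-1$ otherwise, normalized by $\theta'(0)=1$. Set $\Theta(z,w):=\theta(z+w)/(\theta(z)\theta(w))$ and $\Theta_{z_0,w_0}(z,w):=\exp\big(-\frac{z_0\overline{w_0}}{A}\big)\exp\big(-\frac{z\overline{w_0}+w\overline{z_0}}{A}\big)\Theta(z+z_0,w+w_0)$. *)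

theory Defs
  imports "HOL-Complex_Analysis.Complex_Analysis"
begin

subsection \<open>Imaginary quadratic fields\<close>

definition complex_subfield :: "complex set \<Rightarrow> bool" where
  "complex_subfield K \<longleftrightarrow> 0 \<in> K \<and> 1 \<in> K
     \<and> (\<forall>x\<in>K. \<forall>y\<in>K. x + y \<in> K \<and> x * y \<in> K)
     \<and> (\<forall>x\<in>K. - x \<in> K \<and> inverse x \<in> K)"

text \<open>The pair \<open>(1, \<alpha>)\<close> is a \<open>\<rat>\<close>-basis of \<open>K\<close>, so \<open>[K : \<rat>] = 2\<close>; fields are taken inside \<open>\<complex>\<close>.\<close>

definition imaginary_quadratic_field :: "complex set \<Rightarrow> bool" where
  "imaginary_quadratic_field K \<longleftrightarrow> complex_subfield K
     \<and> (\<exists>\<alpha>. \<alpha> \<notin> \<rat> \<and> K = {of_rat a + of_rat b * \<alpha> | a b. True})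
     \<and> \<not> K \<subseteq> \<real>"

definition ring_of_integers :: "complex set \<Rightarrow> complex set" where
  "ring_of_integers K = {x \<in> K. algebraic_int x}"

definition nonzero_ideal :: "complex set \<Rightarrow> complex set \<Rightarrow> bool" where
  "nonzero_ideal R I \<longleftrightarrow> I \<subseteq> R \<and> 0 \<in> I \<and> I \<noteq> {0}
     \<and> (\<forall>x\<in>I. \<forall>y\<in>I. x + y \<in> I) \<and> (\<forall>r\<in>R. \<forall>x\<in>I. r * x \<in> I)"

definition ideal_class_rel :: "complex set \<Rightarrow> (complex set \<times> complex set) set" where
  "ideal_class_rel R = {(I, J). nonzero_ideal R I \<and> nonzero_ideal R J
     \<and> (\<exists>a\<in>R - {0}. \<exists>b\<in>R - {0}. (\<lambda>x. a * x) ` I = (\<lambda>x. b * x) ` J)}"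

definition class_number :: "complex set \<Rightarrow> nat" where
  "class_number K = card ({I. nonzero_ideal (ring_of_integers K) I}
                            // ideal_class_rel (ring_of_integers K))"

definition algebraic_closure_in_complex :: "complex set \<Rightarrow> complex set" where
  "algebraic_closure_in_complex K =
     {z. \<exists>p :: complex poly. p \<noteq> 0 \<and> (\<forall>i. coeff p i \<in> K) \<and> poly p z = 0}"


subsection \<open>Elliptic curves, invariant differentials and their periods\<close>

text \<open>The curve \<open>y\<^sup>2 + a\<^sub>1 x y + a\<^sub>3 y = x\<^sup>3 + a\<^sub>2 x\<^sup>2 + a\<^sub>4 x + a\<^sub>6\<close>.\<close>

record weierstrass_curve =
  coeff_a1 :: complex
  coeff_a2 :: complex
  coeff_a3 :: complex
  coeff_a4 :: complex
  coeff_a6 :: complex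

definition discriminant :: "weierstrass_curve \<Rightarrow> complex" where
  "discriminant E =
     (let a1 = coeff_a1 E; a2 = coeff_a2 E; a3 = coeff_a3 E; a4 = coeff_a4 E; a6 = coeff_a6 E;
          b2 = a1\<^sup>2 + 4 * a2;
          b4 = 2 * a4 + a1 * a3;
          b6 = a3\<^sup>2 + 4 * a6;
          b8 = a1\<^sup>2 * a6 + 4 * a2 * a6 - a1 * a3 * a4 + a2 * a3\<^sup>2 - a4\<^sup>2
      in - (b2\<^sup>2 * b8) - 8 * b4 ^ 3 - 27 * b6\<^sup>2 + 9 * b2 * b4 * b6)"

definition elliptic_curve_over :: "complex set \<Rightarrow> weierstrass_curve \<Rightarrow> bool" where
  "elliptic_curve_over K E \<longleftrightarrow>
     {coeff_a1 E, coeff_a2 E, coeff_a3 E, coeff_a4 E, coeff_a6 E} \<subseteq> K \<and> discriminant E \<noteq> 0"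

definition curve_eqn :: "weierstrass_curve \<Rightarrow> complex \<Rightarrow> complex \<Rightarrow> complex" where
  "curve_eqn E x y = y\<^sup>2 + coeff_a1 E * x * y + coeff_a3 E * y
     - (x ^ 3 + coeff_a2 E * x\<^sup>2 + coeff_a4 E * x + coeff_a6 E)"

definition curve_eqn_dx :: "weierstrass_curve \<Rightarrow> complex \<Rightarrow> complex \<Rightarrow> complex" where
  "curve_eqn_dx E x y = coeff_a1 E * y - (3 * x\<^sup>2 + 2 * coeff_a2 E * x + coeff_a4 E)"

definition curve_eqn_dy :: "weierstrass_curve \<Rightarrow> complex \<Rightarrow> complex \<Rightarrow> complex" where
  "curve_eqn_dy E x y = 2 * y + coeff_a1 E * x + coeff_a3 E"

text \<open>
  The invariant differentials of \<open>E\<close> defined over \<open>K\<close> are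
  \<open>\<omega> = c dx / (2 y + a\<^sub>1 x + a\<^sub>3)\<close> with \<open>c \<in> K\<close>, \<open>c \<noteq> 0\<close>, and such an \<open>\<omega>\<close> is represented by
  its scalar \<open>c\<close>.  With \<open>F\<close> the function \<^const>\<open>curve_eqn\<close>, one has
  \<open>\<omega> = c dx / F\<^sub>y = - c dy / F\<^sub>x\<close>; the second form is needed where \<open>F\<^sub>y\<close> vanishes, and
  \<open>F\<^sub>x\<close>, \<open>F\<^sub>y\<close> have no common zero on a curve with nonzero discriminant.
\<close>

definition invariant_differential_over :: "complex set \<Rightarrow> complex \<Rightarrow> bool" where
  "invariant_differential_over K c \<longleftrightarrow> c \<in> K \<and> c \<noteq> 0"

definition differential_pullback ::
    "weierstrass_curve \<Rightarrow> complex \<Rightarrow> (real \<Rightarrow> complex) \<Rightarrow> (real \<Rightarrow> complex) \<Rightarrow> real \<Rightarrow> complex" where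
  "differential_pullback E c x y t =
     (if curve_eqn_dy E (x t) (y t) \<noteq> 0
      then c * vector_derivative x (at t) / curve_eqn_dy E (x t) (y t)
      else - (c * vector_derivative y (at t) / curve_eqn_dx E (x t) (y t)))"

definition closed_path_on :: "weierstrass_curve \<Rightarrow> (real \<Rightarrow> complex) \<Rightarrow> (real \<Rightarrow> complex) \<Rightarrow> bool" where
  "closed_path_on E x y \<longleftrightarrow> valid_path x \<and> valid_path y
     \<and> pathfinish x = pathstart x \<and> pathfinish y = pathstart y
     \<and> (\<forall>t\<in>{0..1}. curve_eqn E (x t) (y t) = 0)"

text \<open>
  The period lattice \<open>{\<integral>\<^sub>\<gamma> \<omega> | \<gamma> \<in> H\<^sub>1(E(\<complex>), \<int>)}\<close>.  Every homology class of the connected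
  surface \<open>E(\<complex>)\<close> is represented by a single closed path avoiding the point at infinity, so
  closed paths in the affine part give all periods.
\<close>

definition period_lattice :: "weierstrass_curve \<Rightarrow> complex \<Rightarrow> complex set" where
  "period_lattice E c =
     {integral {0..1} (differential_pullback E c x y) | x y. closed_path_on E x y}"


subsection \<open>Lattices and theta functions\<close>

definition lattice_basis :: "complex set \<Rightarrow> complex \<Rightarrow> complex \<Rightarrow> bool" where
  "lattice_basis \<Gamma> \<omega>1 \<omega>2 \<longleftrightarrow> \<omega>1 * cnj \<omega>2 \<notin> \<real>
     \<and> \<Gamma> = {of_int m * \<omega>1 + of_int n * \<omega>2 | m n. True}"

definition fundamental_parallelogram :: "complex \<Rightarrow> complex \<Rightarrow> complex set" where
  "fundamental_parallelogram \<omega>1 \<omega>2 =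
     {of_real s * \<omega>1 + of_real t * \<omega>2 | s t. s \<in> {0..<1} \<and> t \<in> {0..<1}}"

definition fundamental_area :: "complex set \<Rightarrow> real" where
  "fundamental_area \<Gamma> = (THE a. \<exists>\<omega>1 \<omega>2. lattice_basis \<Gamma> \<omega>1 \<omega>2
     \<and> a = measure lebesgue (fundamental_parallelogram \<omega>1 \<omega>2))"

definition lattice_A :: "complex set \<Rightarrow> complex" where
  "lattice_A \<Gamma> = of_real (fundamental_area \<Gamma> / pi)"

text \<open>The image of \<open>\<Gamma> \<otimes> \<rat>\<close> in \<open>\<complex>\<close>.\<close>

definition lattice_tensor_rat :: "complex set \<Rightarrow> complex set" where
  "lattice_tensor_rat \<Gamma> = {of_rat q * \<gamma> | q \<gamma>. \<gamma> \<in> \<Gamma>}"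

definition theta_sign :: "complex set \<Rightarrow> complex \<Rightarrow> complex" where
  "theta_sign \<Gamma> \<gamma> = (if \<gamma> \<in> (\<lambda>x. 2 * x) ` \<Gamma> then 1 else - 1)"

text \<open>These conditions determine \<open>\<theta>\<close> uniquely.\<close>

definition is_theta :: "complex set \<Rightarrow> (complex \<Rightarrow> complex) \<Rightarrow> bool" where
  "is_theta \<Gamma> \<theta> \<longleftrightarrow> \<theta> holomorphic_on UNIV
     \<and> (\<forall>z. \<theta> z = 0 \<longleftrightarrow> z \<in> \<Gamma>)
     \<and> (\<forall>\<gamma>\<in>\<Gamma>. deriv \<theta> \<gamma> \<noteq> 0)
     \<and> (\<forall>\<gamma>\<in>\<Gamma>. \<forall>z. \<theta> (z + \<gamma>) = theta_sign \<Gamma> \<gamma>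
          * exp (z * cnj \<gamma> / lattice_A \<Gamma> + \<gamma> * cnj \<gamma> / (2 * lattice_A \<Gamma>)) * \<theta> z)
     \<and> deriv \<theta> 0 = 1"

definition kronecker_theta :: "(complex \<Rightarrow> complex) \<Rightarrow> complex \<Rightarrow> complex \<Rightarrow> complex" where
  "kronecker_theta \<theta> z w = \<theta> (z + w) / (\<theta> z * \<theta> w)"

definition kronecker_theta_translate ::
    "complex set \<Rightarrow> (complex \<Rightarrow> complex) \<Rightarrow> complex \<Rightarrow> complex \<Rightarrow> complex \<Rightarrow> complex \<Rightarrow> complex" where
  "kronecker_theta_translate \<Gamma> \<theta> z0 w0 z w =
     exp (- (z0 * cnj w0 / lattice_A \<Gamma>))
     * exp (- ((z * cnj w0 + w * cnj z0) / lattice_A \<Gamma>))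
     * kronecker_theta \<theta> (z + z0) (w + w0)"

text \<open>
  The two-variable Laurent expansion at the origin, with poles of finite order at most along
  \<open>z = 0\<close> and \<open>w = 0\<close>, absolutely convergent on a punctured polydisc.  The coefficients are
  uniquely determined by the function.
\<close>

definition has_laurent_expansion_at_origin ::
    "(complex \<Rightarrow> complex \<Rightarrow> complex) \<Rightarrow> (int \<Rightarrow> int \<Rightarrow> complex) \<Rightarrow> bool" where
  "has_laurent_expansion_at_origin f c \<longleftrightarrow>
     (\<exists>N. \<forall>m n. m < N \<or> n < N \<longrightarrow> c m n = 0)
     \<and> (\<exists>r>0. \<forall>z w. 0 < norm z \<and> norm z < r \<and> 0 < norm w \<and> norm w < r \<longrightarrow>
          ((\<lambda>(m, n). c m n * z powi m * w powi n) has_sum f z w) UNIV)"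

end

theory Submission
  imports "HOL-Algebra.Finite_Extensions" Defs
begin

text \<open>
  Put \<open>L = K\<^sup>a\<^sup>l\<^sup>g\<close> and \<open>P = - (\<theta>'/\<theta>)'\<close>.

  \<^emph>\<open>Uniformization.\<close> With \<open>g\<^sub>2, g\<^sub>3 \<in> K\<close> the invariants of \<open>(E, \<omega>)\<close>, a local solution of
  \<open>u'\<^sup>2 = 4 u\<^sup>3 - g\<^sub>2 u - g\<^sub>3\<close> with a double pole at \<open>0\<close> is continued to \<open>\<complex>\<close> by the duplication formula.
  The poles of \<open>u\<close> are its periods, and lifting closed paths of \<open>E\<close> along \<open>(u, u')\<close> identifies them
  with the period lattice \<open>\<Gamma>\<close>.  Hence \<open>P = u + p\<^sub>0\<close> by Liouville.

  \<^emph>\<open>Torsion values.\<close> A torsion point \<open>t\<close> satisfies \<open>2\<^sup>i t \<equiv> 2\<^sup>j t\<close> with \<open>i < j\<close>; iterating duplication turns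
  this into a nonzero polynomial equation over \<open>K\<close> for \<open>1/u(t)\<close>, so \<open>u(t) \<in> L\<close>.

  \<^emph>\<open>Theta values.\<close> For an endomorphism \<open>\<beta>\<close> of \<open>\<Gamma>\<close>, \<open>\<theta>(\<beta>z)\<^sup>2\<close> is \<open>\<beta>\<^sup>2 \<theta>(z)\<^sup>2\<close> times a product of
  factors \<open>\<theta>(z)\<^sup>2 (P(z) - P(\<tau>))\<close> over the nonzero \<open>\<tau> \<in> \<beta>\<^sup>-\<^sup>1\<Gamma>/\<Gamma>\<close>.
  Its second logarithmic derivative for a nonreal \<open>\<beta>\<close> gives \<open>p\<^sub>0 \<in> L\<close>, which is where complex
  multiplication enters; for integers \<open>\<beta> = n\<close> with \<open>n \<equiv> 1\<close> modulo the order of \<open>a\<close> it gives the algebraicity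
  of the value and logarithmic derivative at \<open>0\<close> of \<open>f\<^sub>a(z) = exp (- |a|\<^sup>2/2A - z a\<^sup>c/A) \<theta>(z + a)\<close>, where
  \<open>a\<^sup>c\<close> is the complex conjugate of \<open>a\<close>.
  The differential equation propagates this to all Taylor coefficients of \<open>f\<^sub>a\<close>, and \<open>\<Theta>\<^sub>z\<^sub>0\<^sub>,\<^sub>w\<^sub>0\<close> is a root of unity
  times \<open>f\<^sub>z\<^sub>0\<^sub>+\<^sub>w\<^sub>0(z + w) / (f\<^sub>z\<^sub>0(z) f\<^sub>w\<^sub>0(w))\<close>.
\<close>

section \<open>The algebraic closure of a subfield of the complex numbers\<close>

text \<open>Torsion values of \<theta> mix algebraic numbers with exponentials involving 1/A. The
  exponential in f_a is chosen so that moving a by a lattice point costs only a constant, a root of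
  unity when a is torsion; with n a \<equiv> a the multiplication formula then becomes an equation
  in the single unknown f_a(0). Squares of \<theta> appear because pairing \<tau> with -\<tau>
  cancels the \<tau>-dependence of the automorphy factors, and squaring removes the sign
  \<alpha>(\<gamma>). For an integer \<beta> the constant p_0 drops out of the multiplication
  formula, where its coefficient is 2(|\<beta>|^2 - \<beta>^2); hence the nonreal endomorphism.
  Lattice points a are an obstacle: there f_a is \<theta> up to sign, it vanishes at 0 and its
  logarithmic derivative has a pole, so the recursion for Taylor coefficients cannot start. Instead
  \<theta>^2 is recovered from two nonlattice torsion points and a square root of power series is
  taken. The continuation of u works with pairs (numerator, denominator) of holomorphic functions on
  balls of radius 2^k r, so that no identity has to be divided at a pole.\<close>

definition complex_ring :: "complex ring" where
  "complex_ring = \<lparr>carrier = UNIV, monoid.mult = (*), one = 1, ring.zero = 0, add = (+)\<rparr>"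

lemma complex_ring_simps [simp]:
  "carrier complex_ring = UNIV" "mult complex_ring x y = x * y" "one complex_ring = 1"
  "ring.zero complex_ring = 0" "add complex_ring x y = x + y"
  by (simp_all add: complex_ring_def)

lemma complex_ring_field: "field complex_ring"
proof -
  have "\<exists>y. x + y = 0" for x :: complex
    by (metis add.right_inverse)
  moreover have "x \<noteq> 0 \<Longrightarrow> \<exists>y. x * y = 1" for x :: complex
    by (metis right_inverse)
  ultimately show ?thesis
    unfolding complex_ring_def
    by unfold_locales (auto simp: algebra_simps Units_def)
qed

interpretation CR: domain complex_ring
  using complex_ring_field by (rule field.axioms(1))

lemma complex_ring_a_inv [simp]: "a_inv complex_ring x = - x"
proof -
  have "add complex_ring x (- x) = ring.zero complex_ring" by simp
  then show ?thesis
    by (metis CR.minus_equality CR.add.m_comm complex_ring_simps(1) UNIV_I)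
qed

lemma complex_ring_pow [simp]: "x [^]\<^bsub>complex_ring\<^esub> (n::nat) = x ^ n"
  by (induction n) (simp_all add: CR.nat_pow_Suc mult.commute)

lemma complex_ring_m_inv: "x \<noteq> 0 \<Longrightarrow> m_inv complex_ring x = inverse x"
  by (rule CR.inv_unique'[symmetric]) auto

lemma complex_subfield_subfield:
  assumes "complex_subfield K" shows "subfield K complex_ring"
proof (rule field.subfieldI'[OF complex_ring_field])
  show "subring K complex_ring"
    using assms by (intro CR.subringI) (auto simp: complex_subfield_def)
  show "inv\<^bsub>complex_ring\<^esub> k \<in> K" if "k \<in> K - {\<zero>\<^bsub>complex_ring\<^esub>}" for k
    using that assms by (auto simp: complex_ring_m_inv complex_subfield_def)
qed

text \<open>Coefficient lists in HOL-Algebra start with the leading coefficient, while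
  \<open>Poly\<close> expects the constant term in front; hence \<open>rev\<close>.\<close>

lemma complex_ring_eval: "CR.eval p x = poly (Poly (rev p)) x"
proof (induction p)
  case (Cons a p)
  then show ?case
    by (simp add: Poly_append poly_monom mult.commute)
qed simp

text \<open>A bridge to HOL-Algebra, where the algebraic elements over a subfield are known to form
  a subfield.\<close>

lemma algebraic_closure_in_complex_altdef:
  assumes "complex_subfield K"
  shows "algebraic_closure_in_complex K = {x \<in> carrier complex_ring. (CR.algebraic over K) x}"
proof -
  have K: "subring K complex_ring"
    using complex_subfield_subfield[OF assms] subfieldE(1) by blast
  have "x \<in> algebraic_closure_in_complex K" if alg: "(CR.algebraic over K) x" for x
  proof -
    obtain p where p: "p \<in> carrier (K[X]\<^bsub>complex_ring\<^esub>)" "p \<noteq> []" "CR.eval p x = \<zero>\<^bsub>complex_ring\<^esub>"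
      using CR.algebraicE[OF K _ alg] by auto
    then have sub: "set p \<subseteq> K" and hd: "hd p \<noteq> 0"
      by (auto simp: univ_poly_def polynomial_def)
    have "coeff (Poly (rev p)) i \<in> K" for i
      using sub assms by (auto simp: nth_default_def complex_subfield_def nth_mem subset_iff)
         (metis length_rev nth_mem set_rev)
    moreover have "coeff (Poly (rev p)) (length p - 1) \<noteq> 0"
      using hd p(2) by (simp add: nth_default_def rev_nth hd_conv_nth)
    then have "Poly (rev p) \<noteq> 0" by force
    moreover have "poly (Poly (rev p)) x = 0"
      using p(3) by (simp add: complex_ring_eval)
    ultimately show ?thesis
      unfolding algebraic_closure_in_complex_def by blast
  qed
  moreover have "(CR.algebraic over K) x" if x: "x \<in> algebraic_closure_in_complex K" for x
  proof -
    obtain q where q: "q \<noteq> 0" "\<And>i. coeff q i \<in> K" "poly q x = 0"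
      using x by (auto simp: algebraic_closure_in_complex_def)
    define p where "p = rev (coeffs q)"
    have ne: "p \<noteq> []" using q(1) by (simp add: p_def)
    have "set p \<subseteq> K"
      using q(2) range_coeff[of q] unfolding p_def set_rev by (metis image_subset_iff insert_subset rangeI subsetI)
    moreover have "hd p \<noteq> 0"
      using q(1) by (simp add: p_def hd_rev last_coeffs_eq_coeff_degree)
    ultimately have "p \<in> carrier (K[X]\<^bsub>complex_ring\<^esub>)"
      by (auto simp: univ_poly_def polynomial_def)
    moreover have "CR.eval p x = \<zero>\<^bsub>complex_ring\<^esub>"
      using q(3) by (simp add: complex_ring_eval p_def)
    ultimately show ?thesis using ne CR.algebraicI by blast
  qed
  ultimately show ?thesis by auto
qed

lemma complex_subfield_algebraic_closure:
  assumes "complex_subfield K"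
  shows "complex_subfield (algebraic_closure_in_complex K)"
proof -
  let ?L = "algebraic_closure_in_complex K"
  have L: "subfield ?L complex_ring"
    using field.subfield_of_algebraics[OF complex_ring_field complex_subfield_subfield[OF assms]]
    by (simp add: algebraic_closure_in_complex_altdef[OF assms])
  then have R: "subring ?L complex_ring" using subfieldE(1) by blast
  have inv: "inverse x \<in> ?L" if "x \<in> ?L" for x
  proof (cases "x = 0")
    case False
    then show ?thesis
      using CR.subfield_m_inv(1)[OF L, of x] that by (simp add: complex_ring_m_inv)
  qed (use that in simp)
  show ?thesis
    unfolding complex_subfield_def
    using inv subringE[OF R] by auto
qed

lemma subset_algebraic_closure:
  assumes "complex_subfield K"
  shows "K \<subseteq> algebraic_closure_in_complex K"
proof
  fix x assume "x \<in> K"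
  then show "x \<in> algebraic_closure_in_complex K"
    using assms unfolding algebraic_closure_in_complex_def mem_Collect_eq
    by (intro exI[of _ "[:-x, 1:]"]) (auto simp: complex_subfield_def coeff_pCons split: nat.splits)
qed

text \<open>If p annihilates x^n, then p(X^n) annihilates x. Square roots, roots of unity and f_a(0)
  enter the closure this way.\<close>

lemma algebraic_closure_root:
  assumes K: "complex_subfield K" and "x ^ n \<in> algebraic_closure_in_complex K" "n > 0"
  shows "x \<in> algebraic_closure_in_complex K"
proof -
  obtain p where p: "p \<noteq> 0" "\<And>i. coeff p i \<in> K" "poly p (x ^ n) = 0"
    using assms(2) by (auto simp: algebraic_closure_in_complex_def)
  have "coeff (p \<circ>\<^sub>p monom 1 n) i \<in> K" for i
    using K p(2) by (intro coeff_pcompose_semiring_closed) (auto simp: complex_subfield_def)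
  moreover have "p \<circ>\<^sub>p monom 1 n \<noteq> 0"
    using p(1) assms(3) by (simp add: pcompose_eq_0_iff degree_monom_eq)
  moreover have "poly (p \<circ>\<^sub>p monom 1 n) x = 0"
    using p(3) by (simp add: poly_pcompose poly_monom)
  ultimately show ?thesis
    unfolding algebraic_closure_in_complex_def by blast
qed

section \<open>Lattices and entire functions\<close>

no_notation var (\<open>X\<index>\<close>)

section \<open>Division of entire functions\<close>

lemma eventually_nhds_neq_of_continuous:
  fixes g :: "complex \<Rightarrow> complex"
  assumes "g a \<noteq> c" "continuous_on UNIV g"
  shows "\<forall>\<^sub>F z in nhds a. g z \<noteq> c"
proof -
  have "open (g -` (- {c}))" using assms(2) by (intro open_vimage) auto
  moreover have "a \<in> g -` (- {c})" using assms(1) by auto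
  ultimately show ?thesis
    using eventually_nhds_in_open by fastforce
qed

lemma field_differentiable_eventually_cong:
  fixes f g :: "complex \<Rightarrow> complex"
  assumes "\<forall>\<^sub>F z in nhds a. f z = g z" "f field_differentiable at a"
  shows "g field_differentiable at a"
proof -
  obtain D where "(f has_field_derivative D) (at a)"
    using assms(2) unfolding field_differentiable_def by blast
  then have "(g has_field_derivative D) (at a)"
    using DERIV_cong_ev[OF refl assms(1) refl] by simp
  then show ?thesis unfolding field_differentiable_def by blast
qed

text \<open>At a zero a of g the difference quotients \<open>f1\<close> and \<open>g1\<close> at a
  are entire and g1(a) = g'(a) is nonzero, so the quotient is f1/g1 near a.\<close>

lemma entire_divide_simple_zeros:
  fixes f g :: "complex \<Rightarrow> complex"
  assumes f: "f holomorphic_on UNIV" and g: "g holomorphic_on UNIV"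
    and zeros: "\<And>z. g z = 0 \<Longrightarrow> f z = 0" and simple: "\<And>z. g z = 0 \<Longrightarrow> deriv g z \<noteq> 0"
  obtains h where "h holomorphic_on UNIV" "\<And>z. f z = g z * h z"
proof -
  define h where "h = (\<lambda>z. if g z = 0 then deriv f z / deriv g z else f z / g z)"
  have "h field_differentiable at a" for a
  proof -
    define f1 where "f1 = (\<lambda>z. if z = a then deriv f a else (f z - f a) / (z - a))"
    define g1 where "g1 = (\<lambda>z. if z = a then deriv g a else (g z - g a) / (z - a))"
    have hol: "f1 holomorphic_on UNIV" "g1 holomorphic_on UNIV"
      unfolding f1_def g1_def using f g by (auto intro!: pole_lemma_open)
    show ?thesis
    proof (cases "g a = 0")
      case True
      then have "g1 a \<noteq> 0" "f a = 0" by (simp_all add: g1_def simple zeros)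
      moreover have "continuous_on UNIV g1" using hol holomorphic_on_imp_continuous_on by blast
      ultimately have ev: "\<forall>\<^sub>F z in nhds a. g1 z \<noteq> 0"
        by (intro eventually_nhds_neq_of_continuous)
      have "\<forall>\<^sub>F z in nhds a. f1 z / g1 z = h z"
        using ev
      proof eventually_elim
        case (elim z)
        show ?case
          using elim True \<open>f a = 0\<close> by (cases "z = a") (auto simp: h_def f1_def g1_def)
      qed
      moreover have "(\<lambda>z. f1 z / g1 z) field_differentiable at a"
        using hol \<open>g1 a \<noteq> 0\<close> holomorphic_on_imp_differentiable_at[of _ UNIV a]
        by (intro field_differentiable_divide) auto
      ultimately show ?thesis
        by (rule field_differentiable_eventually_cong)
    next
      case False
      have "continuous_on UNIV g" using g holomorphic_on_imp_continuous_on by blast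
      with False have "\<forall>\<^sub>F z in nhds a. g z \<noteq> 0"
        by (intro eventually_nhds_neq_of_continuous)
      then have "\<forall>\<^sub>F z in nhds a. f z / g z = h z"
        by eventually_elim (simp add: h_def)
      moreover have "(\<lambda>z. f z / g z) field_differentiable at a"
        using f g False holomorphic_on_imp_differentiable_at[of _ UNIV a]
        by (intro field_differentiable_divide) auto
      ultimately show ?thesis
        by (rule field_differentiable_eventually_cong)
    qed
  qed
  then have "h holomorphic_on UNIV"
    by (simp add: holomorphic_on_def)
  moreover have "f z = g z * h z" for z
    using zeros by (simp add: h_def)
  ultimately show ?thesis using that by blast
qed

text \<open>Entire functions form an integral domain: g has no zero on some ball, h and k agree
  there, and the identity theorem does the rest.\<close>

lemma entire_mult_left_cancel:
  fixes g h k :: "complex \<Rightarrow> complex"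
  assumes hol: "g holomorphic_on UNIV" "h holomorphic_on UNIV" "k holomorphic_on UNIV"
    and eq: "\<And>z. g z * h z = g z * k z" and nz: "g a \<noteq> 0"
  shows "h z = k z"
proof -
  have "continuous_on UNIV g" using hol holomorphic_on_imp_continuous_on by blast
  then have "open (g -` (- {0}))"
    by (intro open_vimage) auto
  then obtain e where e: "e > 0" "ball a e \<subseteq> g -` (- {0})"
    using nz by (metis ComplI open_contains_ball singletonD vimageI)
  have "h z - k z = 0"
  proof (rule analytic_continuation_open[of "ball a e" UNIV "\<lambda>z. h z - k z" "\<lambda>_. 0"])
    fix x assume "x \<in> ball a e"
    with e have "g x \<noteq> 0" by auto
    with eq[of x] show "h x - k x = 0" by simp
  qed (use e hol in \<open>auto intro!: holomorphic_intros\<close>)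
  then show ?thesis by simp
qed

section \<open>Lattices in the complex plane\<close>

locale complex_lattice =
  fixes \<Gamma> :: "complex set" and w1 w2 :: complex
  assumes indep: "Im (w2 / w1) \<noteq> 0"
    and basis: "\<Gamma> = {of_int m * w1 + of_int n * w2 | m n. True}"
begin

lemma w_nz: "w1 \<noteq> 0" "w2 \<noteq> 0" using indep by auto

lemma lattice_0 [simp]: "0 \<in> \<Gamma>"
  unfolding basis by (auto intro!: exI[of _ 0])

lemma lattice_add: "x \<in> \<Gamma> \<Longrightarrow> y \<in> \<Gamma> \<Longrightarrow> x + y \<in> \<Gamma>"
  unfolding basis
proof clarify
  fix m n m' n' :: int
  show "\<exists>k l. of_int m * w1 + of_int n * w2 + (of_int m' * w1 + of_int n' * w2) = of_int k * w1 + of_int l * w2 \<and> True"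
    by (rule exI[of _ "m + m'"], rule exI[of _ "n + n'"]) (simp add: algebra_simps)
qed

lemma lattice_minus: "x \<in> \<Gamma> \<Longrightarrow> - x \<in> \<Gamma>"
  unfolding basis
proof clarify
  fix m n :: int
  show "\<exists>k l. - (of_int m * w1 + of_int n * w2) = of_int k * w1 + of_int l * w2 \<and> True"
    by (rule exI[of _ "- m"], rule exI[of _ "- n"]) (simp add: algebra_simps)
qed

lemma lattice_minus_iff [simp]: "- x \<in> \<Gamma> \<longleftrightarrow> x \<in> \<Gamma>"
  using lattice_minus[of x] lattice_minus[of "- x"] by auto

lemma lattice_diff: "x \<in> \<Gamma> \<Longrightarrow> y \<in> \<Gamma> \<Longrightarrow> x - y \<in> \<Gamma>"
  using lattice_add[of x "- y"] by simp

lemma lattice_add_iff: "y \<in> \<Gamma> \<Longrightarrow> x + y \<in> \<Gamma> \<longleftrightarrow> x \<in> \<Gamma>"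
  using lattice_add lattice_diff[of "x + y" y] by auto

lemma lattice_of_int: "x \<in> \<Gamma> \<Longrightarrow> of_int k * x \<in> \<Gamma>"
  unfolding basis
proof clarify
  fix m n :: int
  show "\<exists>i l. of_int k * (of_int m * w1 + of_int n * w2) = of_int i * w1 + of_int l * w2 \<and> True"
    by (rule exI[of _ "k * m"], rule exI[of _ "k * n"]) (simp add: algebra_simps)
qed

lemma coordinates:
  obtains s t :: real where "z = of_real s * w1 + of_real t * w2"
proof -
  define q where "q = w2 / w1"
  define t where "t = Im (z / w1) / Im q"
  define s where "s = Re (z / w1) - t * Re q"
  have "Im q \<noteq> 0" using indep by (simp add: q_def)
  then have "z / w1 = of_real s + of_real t * q"
    by (simp add: complex_eq_iff s_def t_def)
  then have "z / w1 = of_real s + of_real t * (w2 / w1)"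
    unfolding q_def .
  then have "z = of_real s * w1 + of_real t * w2"
    using w_nz by (simp add: field_simps)
  then show ?thesis using that by blast
qed

lemma coordinates_unique:
  fixes s t s' t' :: real
  assumes "of_real s * w1 + of_real t * w2 = of_real s' * w1 + of_real t' * w2"
  shows "s = s'" "t = t'"
proof -
  define q where "q = w2 / w1"
  have nz: "Im q \<noteq> 0" using indep by (simp add: q_def)
  have "of_real (s - s') + of_real (t - t') * q = 0"
    using assms w_nz by (simp add: field_simps q_def)
  from arg_cong[OF this, of Im] arg_cong[OF this, of Re] nz
  show "t = t'" "s = s'" by auto
qed

lemma reduce_mod_lattice:
  obtains \<gamma> where "\<gamma> \<in> \<Gamma>" "z - \<gamma> \<in> cball 0 (norm w1 + norm w2)"
proof -
  obtain s t where st: "z = of_real s * w1 + of_real t * w2" by (rule coordinates)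
  define \<gamma> where "\<gamma> = of_int \<lfloor>s\<rfloor> * w1 + of_int \<lfloor>t\<rfloor> * w2"
  have "\<gamma> \<in> \<Gamma>" unfolding basis \<gamma>_def by auto
  moreover have "z - \<gamma> = of_real (frac s) * w1 + of_real (frac t) * w2"
    by (simp add: st \<gamma>_def frac_def algebra_simps)
  then have "norm (z - \<gamma>) \<le> frac s * norm w1 + frac t * norm w2"
    by (metis (no_types, lifting) norm_triangle_ineq norm_mult norm_of_real abs_of_nonneg frac_ge_0)
  then have "norm (z - \<gamma>) \<le> norm w1 + norm w2"
    using mult_right_mono[of "frac s" 1 "norm w1"] mult_right_mono[of "frac t" 1 "norm w2"]
      frac_lt_1[of s] frac_lt_1[of t] by simp
  ultimately show ?thesis using that by auto
qed

lemma periodic_entire_constant: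
  assumes h: "h holomorphic_on UNIV" and per: "\<And>z \<gamma>. \<gamma> \<in> \<Gamma> \<Longrightarrow> h (z + \<gamma>) = h z"
  obtains c where "\<And>z. h z = c"
proof -
  have "compact (h ` cball 0 (norm w1 + norm w2))"
    using h holomorphic_on_imp_continuous_on continuous_on_subset compact_continuous_image compact_cball
    by (metis subset_UNIV)
  moreover have "range h \<subseteq> h ` cball 0 (norm w1 + norm w2)"
  proof clarify
    fix z
    obtain \<gamma> where \<gamma>: "\<gamma> \<in> \<Gamma>" "z - \<gamma> \<in> cball 0 (norm w1 + norm w2)" by (rule reduce_mod_lattice)
    then show "h z \<in> h ` cball 0 (norm w1 + norm w2)"
      using per[OF \<gamma>(1), of "z - \<gamma>"] by (metis diff_add_cancel imageI)
  qed
  ultimately have "bounded (range h)"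
    using bounded_subset compact_imp_bounded by blast
  then have "h constant_on UNIV" using Liouville_theorem h by blast
  then show ?thesis using that unfolding constant_on_def by blast
qed

end

lemma entire_shift:
  fixes h :: "complex \<Rightarrow> complex"
  assumes "h holomorphic_on UNIV"
  shows "(\<lambda>z. h (z + a)) holomorphic_on S"
proof -
  have "(\<lambda>z. z + a) holomorphic_on S" by (intro holomorphic_intros)
  from holomorphic_on_compose_gen[OF this assms] show ?thesis by (simp add: o_def)
qed

section \<open>Theta functions of a lattice\<close>

text \<open>Here \<open>B\<close> stands for 1/A and \<open>s\<close> for the character
  \<open>theta_sign\<close>. Two properties of \<open>s\<close> are recorded: its square is 1, which
  removes it from squared formulas, and it is even, which makes \<theta> odd.\<close>

locale theta_lattice = complex_lattice +
  fixes \<theta> :: "complex \<Rightarrow> complex" and B :: complex and s :: "complex \<Rightarrow> complex"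
  assumes theta_hol: "\<theta> holomorphic_on UNIV"
    and theta_0_iff: "\<And>z. \<theta> z = 0 \<longleftrightarrow> z \<in> \<Gamma>"
    and theta_simple: "\<And>\<gamma>. \<gamma> \<in> \<Gamma> \<Longrightarrow> deriv \<theta> \<gamma> \<noteq> 0"
    and theta_shift: "\<And>\<gamma> z. \<gamma> \<in> \<Gamma> \<Longrightarrow>
          \<theta> (z + \<gamma>) = s \<gamma> * exp (B * (z * cnj \<gamma> + \<gamma> * cnj \<gamma> / 2)) * \<theta> z"
    and deriv_theta_0: "deriv \<theta> 0 = 1"
    and sign_sq: "\<And>\<gamma>. s \<gamma> * s \<gamma> = 1"
    and sign_minus: "\<And>\<gamma>. s (- \<gamma>) = s \<gamma>"
begin

definition mul :: "complex \<Rightarrow> complex \<Rightarrow> complex" where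
  "mul \<gamma> z = s \<gamma> * exp (B * (z * cnj \<gamma> + \<gamma> * cnj \<gamma> / 2))"

lemma mul_nz [simp]: "mul \<gamma> z \<noteq> 0"
  using sign_sq[of \<gamma>] by (auto simp: mul_def)

lemma theta_mul: "\<gamma> \<in> \<Gamma> \<Longrightarrow> \<theta> (z + \<gamma>) = mul \<gamma> z * \<theta> z"
  by (simp add: theta_shift mul_def)

text \<open>The shifts by t and -t cancel in the exponent. The product formulas below therefore pair
  \<theta>(z + t) with \<theta>(z - t).\<close>

lemma mul_mul: "mul \<gamma> (z + t) * mul \<gamma> (z - t) = (mul \<gamma> z)\<^sup>2"
proof -
  have "mul \<gamma> (z + t) * mul \<gamma> (z - t) = (s \<gamma> * s \<gamma>) * exp (B * ((z + t) * cnj \<gamma> + \<gamma> * cnj \<gamma> / 2)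
     + B * ((z - t) * cnj \<gamma> + \<gamma> * cnj \<gamma> / 2))"
    unfolding mul_def exp_add by (simp only: mult_ac)
  also have "B * ((z + t) * cnj \<gamma> + \<gamma> * cnj \<gamma> / 2) + B * ((z - t) * cnj \<gamma> + \<gamma> * cnj \<gamma> / 2)
     = B * (z * cnj \<gamma> + \<gamma> * cnj \<gamma> / 2) + B * (z * cnj \<gamma> + \<gamma> * cnj \<gamma> / 2)"
    by (simp add: algebra_simps)
  also have "(s \<gamma> * s \<gamma>) * exp \<dots> = (mul \<gamma> z)\<^sup>2"
    unfolding mul_def exp_add power2_eq_square by (simp only: mult_ac)
  finally show ?thesis .
qed

lemma mul_sq: "(mul \<gamma> z)\<^sup>2 = exp (2 * (B * (z * cnj \<gamma> + \<gamma> * cnj \<gamma> / 2)))"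
proof -
  have "(mul \<gamma> z)\<^sup>2 = (s \<gamma> * s \<gamma>) * (exp (B * (z * cnj \<gamma> + \<gamma> * cnj \<gamma> / 2)))\<^sup>2"
    by (simp add: mul_def power2_eq_square)
  then show ?thesis
    unfolding sign_sq by (simp only: exp_double mult_1)
qed

text \<open>Multiplication by \<beta> raises the squared automorphy factor to the power |\<beta>|^2,
  the index of \<beta>\<Gamma> in \<Gamma>; a product over that many pairs of translates has the
  same factor.\<close>

lemma mul_scale:
  "(mul (\<beta> * \<gamma>) (\<beta> * z))\<^sup>2 = exp ((\<beta> * cnj \<beta>) * (2 * (B * (z * cnj \<gamma> + \<gamma> * cnj \<gamma> / 2))))"
  unfolding mul_sq by (rule arg_cong[of _ _ exp]) (simp add: algebra_simps)

lemma mul_hol [holomorphic_intros]: "f holomorphic_on S \<Longrightarrow> (\<lambda>z. mul \<gamma> (f z)) holomorphic_on S"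
  unfolding mul_def by (intro holomorphic_intros)

definition "\<theta>1 = deriv \<theta>"
definition "\<theta>2 = deriv \<theta>1"

lemma theta1_hol: "\<theta>1 holomorphic_on UNIV"
  unfolding \<theta>1_def using theta_hol by (intro holomorphic_deriv) auto
lemma theta2_hol: "\<theta>2 holomorphic_on UNIV"
  unfolding \<theta>2_def using theta1_hol by (intro holomorphic_deriv) auto

lemma D_theta [derivative_intros]:
  "(f has_field_derivative f') (at z within S) \<Longrightarrow>
   ((\<lambda>z. \<theta> (f z)) has_field_derivative \<theta>1 (f z) * f') (at z within S)"
  using holomorphic_derivI[OF theta_hol open_UNIV UNIV_I] unfolding \<theta>1_def
  by (rule DERIV_chain2)

lemma D_theta1 [derivative_intros]:
  "(f has_field_derivative f') (at z within S) \<Longrightarrow>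
   ((\<lambda>z. \<theta>1 (f z)) has_field_derivative \<theta>2 (f z) * f') (at z within S)"
  using holomorphic_derivI[OF theta1_hol open_UNIV UNIV_I] unfolding \<theta>2_def
  by (rule DERIV_chain2)

lemma D_theta2 [derivative_intros]:
  "(f has_field_derivative f') (at z within S) \<Longrightarrow>
   ((\<lambda>z. \<theta>2 (f z)) has_field_derivative deriv \<theta>2 (f z) * f') (at z within S)"
  using holomorphic_derivI[OF theta2_hol open_UNIV UNIV_I]
  by (rule DERIV_chain2)

lemma theta_hol' [holomorphic_intros]: "f holomorphic_on S \<Longrightarrow> (\<lambda>z. \<theta> (f z)) holomorphic_on S"
  using holomorphic_on_compose_gen[OF _ theta_hol, of f S] by (simp add: o_def)
lemma theta1_hol' [holomorphic_intros]: "f holomorphic_on S \<Longrightarrow> (\<lambda>z. \<theta>1 (f z)) holomorphic_on S"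
  using holomorphic_on_compose_gen[OF _ theta1_hol, of f S] by (simp add: o_def)
lemma theta2_hol' [holomorphic_intros]: "f holomorphic_on S \<Longrightarrow> (\<lambda>z. \<theta>2 (f z)) holomorphic_on S"
  using holomorphic_on_compose_gen[OF _ theta2_hol, of f S] by (simp add: o_def)

lemma mul_deriv [derivative_intros]:
  "(f has_field_derivative f') (at z within S) \<Longrightarrow>
    ((\<lambda>z. mul \<gamma> (f z)) has_field_derivative mul \<gamma> (f z) * (B * cnj \<gamma>) * f') (at z within S)"
  unfolding mul_def by (auto intro!: derivative_eq_intros simp: field_simps)

lemma theta1_mul:
  assumes "\<gamma> \<in> \<Gamma>"
  shows "\<theta>1 (z + \<gamma>) = mul \<gamma> z * (\<theta>1 z + B * cnj \<gamma> * \<theta> z)"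
proof -
  have "((\<lambda>z. \<theta> (z + \<gamma>)) has_field_derivative \<theta>1 (z + \<gamma>)) (at z)"
    by (auto intro!: derivative_eq_intros)
  moreover have "((\<lambda>z. mul \<gamma> z * \<theta> z) has_field_derivative mul \<gamma> z * (\<theta>1 z + B * cnj \<gamma> * \<theta> z)) (at z)"
    by (rule derivative_eq_intros refl | simp add: algebra_simps)+
  ultimately show ?thesis
    using DERIV_unique theta_mul[OF assms] by simp
qed

lemma theta2_mul:
  assumes "\<gamma> \<in> \<Gamma>"
  shows "\<theta>2 (z + \<gamma>) = mul \<gamma> z * (\<theta>2 z + 2 * (B * cnj \<gamma>) * \<theta>1 z + (B * cnj \<gamma>)\<^sup>2 * \<theta> z)"
proof -
  have "((\<lambda>z. \<theta>1 (z + \<gamma>)) has_field_derivative \<theta>2 (z + \<gamma>)) (at z)"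
    by (auto intro!: derivative_eq_intros)
  moreover have "((\<lambda>z. mul \<gamma> z * (\<theta>1 z + B * cnj \<gamma> * \<theta> z)) has_field_derivative
     mul \<gamma> z * (\<theta>2 z + 2 * (B * cnj \<gamma>) * \<theta>1 z + (B * cnj \<gamma>)\<^sup>2 * \<theta> z)) (at z)"
    by (rule derivative_eq_intros refl | simp add: algebra_simps power2_eq_square)+
  ultimately show ?thesis
    using DERIV_unique theta1_mul[OF assms] by simp
qed

text \<open>The numerator of P over \<theta>^2. It is entire and transforms like \<theta>^2, so
  identities for P can be proved between entire functions.\<close>

definition Q :: "complex \<Rightarrow> complex" where "Q z = (\<theta>1 z)\<^sup>2 - \<theta> z * \<theta>2 z"
definition P :: "complex \<Rightarrow> complex" where "P z = Q z / (\<theta> z)\<^sup>2"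

lemma Q_hol: "Q holomorphic_on UNIV"
  unfolding Q_def by (intro holomorphic_intros)

lemma Q_mul: "\<gamma> \<in> \<Gamma> \<Longrightarrow> Q (z + \<gamma>) = (mul \<gamma> z)\<^sup>2 * Q z"
  unfolding Q_def theta_mul theta1_mul theta2_mul by (simp add: power2_eq_square algebra_simps)

lemma P_periodic: "\<gamma> \<in> \<Gamma> \<Longrightarrow> P (z + \<gamma>) = P z"
  by (simp add: P_def Q_mul theta_mul power_mult_distrib)

section \<open>Parity and addition formula of the theta function\<close>

lemma theta_nz: "z \<notin> \<Gamma> \<Longrightarrow> \<theta> z \<noteq> 0" by (simp add: theta_0_iff)
lemma theta_at_0 [simp]: "\<theta> 0 = 0" by (simp add: theta_0_iff)
lemma theta1_at_0 [simp]: "\<theta>1 0 = 1" by (simp add: \<theta>1_def deriv_theta_0)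

lemma ex_nonlattice: obtains a where "a \<notin> \<Gamma>"
proof -
  have "w1 / 2 \<notin> \<Gamma>"
  proof
    assume "w1 / 2 \<in> \<Gamma>"
    then obtain m n :: int where "w1 / 2 = of_int m * w1 + of_int n * w2"
      unfolding basis by auto
    then have "of_real (1/2) * w1 + of_real 0 * w2 = of_real (of_int m) * w1 + of_real (of_int n) * w2" by simp
    from coordinates_unique(1)[OF this] have "(1::real) = 2 * of_int m" by simp
    then have "(1::int) = 2 * m" by linarith
    then show False by presburger
  qed
  then show ?thesis using that by blast
qed

lemma mul_minus: "mul (- \<gamma>) (- z) = mul \<gamma> z"
  by (simp add: mul_def sign_minus)

text \<open>Dividing functions with automorphy factors divides the factors. Applied twice, with
  \<open>n\<close> = \<open>mul\<close> and then \<open>n\<close> = 1, this strips two zeros per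
  lattice point from a function that transforms like \<theta>^2.\<close>

lemma quasi_periodic_divide:
  assumes f: "f holomorphic_on UNIV" and g: "g holomorphic_on UNIV"
    and zeros: "\<And>z. g z = 0 \<Longrightarrow> f z = 0" and simple: "\<And>z. g z = 0 \<Longrightarrow> deriv g z \<noteq> 0"
    and nz: "g a \<noteq> 0"
    and qf: "\<And>z \<gamma>. \<gamma> \<in> \<Gamma> \<Longrightarrow> f (z + \<gamma>) = m \<gamma> z * n \<gamma> z * f z"
    and qg: "\<And>z \<gamma>. \<gamma> \<in> \<Gamma> \<Longrightarrow> g (z + \<gamma>) = m \<gamma> z * g z"
    and mn: "\<And>z \<gamma>. m \<gamma> z \<noteq> 0" "\<And>\<gamma>. (n \<gamma>) holomorphic_on UNIV"
  obtains h where "h holomorphic_on UNIV" "\<And>z. f z = g z * h z"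
    "\<And>z \<gamma>. \<gamma> \<in> \<Gamma> \<Longrightarrow> h (z + \<gamma>) = n \<gamma> z * h z"
proof -
  obtain h where h: "h holomorphic_on UNIV" "\<And>z. f z = g z * h z"
    using entire_divide_simple_zeros[OF f g zeros simple] by blast
  moreover have "h (z + \<gamma>) = n \<gamma> z * h z" if \<gamma>: "\<gamma> \<in> \<Gamma>" for z \<gamma>
  proof (rule entire_mult_left_cancel[OF g, of "\<lambda>z. h (z + \<gamma>)" "\<lambda>z. n \<gamma> z * h z"])
    show "(\<lambda>z. h (z + \<gamma>)) holomorphic_on UNIV"
      by (rule entire_shift[OF h(1)])
    show "(\<lambda>z. n \<gamma> z * h z) holomorphic_on UNIV"
      using h(1) mn(2) by (intro holomorphic_intros)
    show "g z * h (z + \<gamma>) = g z * (n \<gamma> z * h z)" for z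
      using h(2)[of "z + \<gamma>"] qf[OF \<gamma>, of z] qg[OF \<gamma>, of z] mn(1)[of \<gamma> z] h(2)[of z] by auto
  qed (rule nz)
  ultimately show ?thesis using that by blast
qed

text \<open>The function \<theta>(-z) has the zeros and, as \<open>s\<close> is even, the automorphy
  factors of \<theta>. The quotient is constant, and the derivatives at 0 give -1.\<close>

lemma theta_odd: "\<theta> (- z) = - \<theta> z"
proof -
  obtain a where a: "a \<notin> \<Gamma>" by (rule ex_nonlattice)
  have hol: "(\<lambda>z. \<theta> (- z)) holomorphic_on UNIV" by (intro holomorphic_intros)
  have qp: "\<theta> (- (z + \<gamma>)) = mul \<gamma> z * 1 * \<theta> (- z)" if "\<gamma> \<in> \<Gamma>" for z \<gamma>
    using theta_mul[of "- \<gamma>" "- z"] that by (simp add: mul_minus)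
  obtain h where h: "h holomorphic_on UNIV" "\<And>z. \<theta> (- z) = \<theta> z * h z"
      "\<And>z \<gamma>. \<gamma> \<in> \<Gamma> \<Longrightarrow> h (z + \<gamma>) = 1 * h z"
    by (rule quasi_periodic_divide[OF hol theta_hol, of a mul "\<lambda>_ _. 1"])
       (use a theta_mul qp theta_simple in \<open>auto simp: theta_0_iff\<close>)
  obtain c where c: "\<And>z. h z = c"
    using periodic_entire_constant[OF h(1)] h(3) by auto
  have "((\<lambda>z. \<theta> (- z)) has_field_derivative - 1) (at 0)"
    by (auto intro!: derivative_eq_intros)
  moreover have "((\<lambda>z. \<theta> z * c) has_field_derivative c) (at 0)"
    by (auto intro!: derivative_eq_intros)
  ultimately have "c = - 1"
    using h(2) c DERIV_unique by simp
  then show ?thesis using h(2) c by simp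
qed

lemma theta1_even: "\<theta>1 (- z) = \<theta>1 z"
proof -
  have "((\<lambda>z. - \<theta> (- z)) has_field_derivative \<theta>1 (- z)) (at z)"
    by (auto intro!: derivative_eq_intros)
  moreover have "((\<lambda>z. - \<theta> (- z)) has_field_derivative \<theta>1 z) (at z)"
    by (auto intro!: derivative_eq_intros simp: theta_odd)
  ultimately show ?thesis using DERIV_unique by blast
qed

lemma theta2_odd: "\<theta>2 (- z) = - \<theta>2 z"
proof -
  have "((\<lambda>z. \<theta>1 (- z)) has_field_derivative - \<theta>2 (- z)) (at z)"
    by (auto intro!: derivative_eq_intros)
  moreover have "((\<lambda>z. \<theta>1 (- z)) has_field_derivative \<theta>2 z) (at z)"
    by (auto intro!: derivative_eq_intros simp: theta1_even)
  ultimately have "- \<theta>2 (- z) = \<theta>2 z" using DERIV_unique by blast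
  then show ?thesis by (metis minus_minus)
qed

text \<open>The analogue of the classical formula for \<sigma>(z + t) \<sigma>(z - t). Both terms of
  \<open>M\<close> transform like \<theta>^2, and \<open>M\<close> has a zero of order at least two
  at 0, hence at every lattice point; so M/\<theta>^2 is constant, and z = t identifies it as
  Q(t).\<close>

lemma theta_add_diff:
  assumes t: "t \<notin> \<Gamma>"
  shows "\<theta> (z + t) * \<theta> (z - t) = (\<theta> z)\<^sup>2 * Q t - (\<theta> t)\<^sup>2 * Q z"
proof -
  \<comment> \<open>Since Q(0) = 1, the coefficient \<theta>(t)^2 is the one that makes
    \<open>M\<close> vanish at 0.\<close>
  define M where "M = (\<lambda>z. \<theta> (z + t) * \<theta> (z - t) + (\<theta> t)\<^sup>2 * Q z)"
  have hol: "M holomorphic_on UNIV"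
    unfolding M_def Q_def by (intro holomorphic_intros)
  have qM: "M (z + \<gamma>) = mul \<gamma> z * mul \<gamma> z * M z" if "\<gamma> \<in> \<Gamma>" for z \<gamma>
  proof -
    have "\<theta> (z + \<gamma> + t) * \<theta> (z + \<gamma> - t) = (mul \<gamma> (z + t) * mul \<gamma> (z - t)) * (\<theta> (z + t) * \<theta> (z - t))"
      using theta_mul[OF that, of "z + t"] theta_mul[OF that, of "z - t"] by (simp add: algebra_simps)
    then show ?thesis
      unfolding M_def Q_mul[OF that] mul_mul by (simp add: algebra_simps power2_eq_square)
  qed
  have M0: "M 0 = 0" by (simp add: M_def Q_def theta_odd power2_eq_square)
  have M_lat: "M \<gamma> = 0" if "\<gamma> \<in> \<Gamma>" for \<gamma>
    using qM[OF that, of 0] M0 by simp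
  obtain h where h: "h holomorphic_on UNIV" "\<And>z. M z = \<theta> z * h z"
      "\<And>z \<gamma>. \<gamma> \<in> \<Gamma> \<Longrightarrow> h (z + \<gamma>) = mul \<gamma> z * h z"
    by (rule quasi_periodic_divide[OF hol theta_hol, of t mul mul])
       (use t theta_mul qM theta_simple M_lat in \<open>auto simp: theta_0_iff intro!: holomorphic_intros\<close>)
  have "h 0 = 0"
  proof -
    have "\<theta>2 0 = 0" using theta2_odd[of 0] by simp
    then have "(M has_field_derivative 0) (at 0)"
      unfolding M_def Q_def
      by (auto intro!: derivative_eq_intros simp: theta_odd theta1_even)
    moreover have "((\<lambda>z. \<theta> z * h z) has_field_derivative h 0) (at 0)"
      using holomorphic_derivI[OF h(1), of 0] by (auto intro!: derivative_eq_intros)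
    ultimately show ?thesis using h(2) DERIV_unique by (metis (no_types, lifting) ext)
  qed
  then have h_lat: "h \<gamma> = 0" if "\<gamma> \<in> \<Gamma>" for \<gamma>
    using h(3)[OF that, of 0] by simp
  obtain k where k: "k holomorphic_on UNIV" "\<And>z. h z = \<theta> z * k z"
      "\<And>z \<gamma>. \<gamma> \<in> \<Gamma> \<Longrightarrow> k (z + \<gamma>) = 1 * k z"
    by (rule quasi_periodic_divide[OF h(1) theta_hol, of t mul "\<lambda>_ _. 1"])
       (use t theta_mul h(3) theta_simple h_lat in \<open>auto simp: theta_0_iff\<close>)
  obtain c where c: "\<And>z. k z = c"
    using periodic_entire_constant[OF k(1)] k(3) by auto
  have eq: "M z = (\<theta> z)\<^sup>2 * c" for z
    by (simp add: h(2) k(2) c power2_eq_square)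
  have "c = Q t"
    using eq[of t] theta_nz[OF t] by (simp add: M_def)
  then show ?thesis using eq[of z] by (simp add: M_def algebra_simps)
qed

text \<open>\<open>N1\<close> and \<open>N2\<close> are the products of the translates by \<tau> and
  by -\<tau>. Both vanish where \<open>T\<close> does and \<open>T\<close> has simple zeros, so N1
  N2 / T^2 is entire; because |I| = |\<beta>|^2 the automorphy factors agree and this quotient is
  constant. Each pair of factors is then rewritten by \<open>theta_add_diff\<close>.\<close>

lemma theta_mult_formula:
  assumes \<beta>: "\<beta> \<noteq> 0" "\<And>\<gamma>. \<gamma> \<in> \<Gamma> \<Longrightarrow> \<beta> * \<gamma> \<in> \<Gamma>"
    and I: "finite I" "i0 \<in> I" "\<tau> i0 = 0" "\<And>i. i \<in> I - {i0} \<Longrightarrow> \<tau> i \<notin> \<Gamma>"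
    and card: "of_nat (card I) = \<beta> * cnj \<beta>"
    and cover: "\<And>z. \<beta> * z \<in> \<Gamma> \<Longrightarrow> \<exists>i\<in>I. z - \<tau> i \<in> \<Gamma>"
  shows "(\<theta> (\<beta> * z))\<^sup>2 = \<beta>\<^sup>2 * (\<theta> z)\<^sup>2 * (\<Prod>i\<in>I - {i0}. Q z - P (\<tau> i) * (\<theta> z)\<^sup>2)"
proof -
  define N1 where "N1 = (\<lambda>z. \<Prod>i\<in>I. \<theta> (z + \<tau> i))"
  define N2 where "N2 = (\<lambda>z. \<Prod>i\<in>I. \<theta> (z - \<tau> i))"
  define T where "T = (\<lambda>z. \<theta> (\<beta> * z))"
  have hol: "N1 holomorphic_on UNIV" "N2 holomorphic_on UNIV" "T holomorphic_on UNIV"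
    unfolding N1_def N2_def T_def by (intro holomorphic_intros)+
  have dT: "(T has_field_derivative \<theta>1 (\<beta> * z) * \<beta>) (at z)" for z
    unfolding T_def by (auto intro!: derivative_eq_intros)
  have T_simple: "deriv T z \<noteq> 0" if "T z = 0" for z
  proof -
    have "\<theta>1 (\<beta> * z) \<noteq> 0" unfolding \<theta>1_def using that theta_simple by (simp add: T_def theta_0_iff)
    then show ?thesis using DERIV_imp_deriv[OF dT] \<beta>(1) by simp
  qed
  have Z2: "N2 z = 0" if "T z = 0" for z
    using cover[of z] that I(1) by (auto simp: T_def N2_def theta_0_iff)
  \<comment> \<open>The covering property is applied to -z, as the representatives need not be
    symmetric.\<close>
  have Z1: "N1 z = 0" if "T z = 0" for z
  proof -
    have "\<beta> * (- z) \<in> \<Gamma>" using that by (simp add: T_def theta_0_iff)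
    then obtain i where "i \<in> I" "- z - \<tau> i \<in> \<Gamma>" using cover by blast
    then have "z + \<tau> i \<in> \<Gamma>" using lattice_minus[of "- z - \<tau> i"] by (simp add: add.commute)
    then show ?thesis using \<open>i \<in> I\<close> I(1) by (auto simp: N1_def theta_0_iff)
  qed
  obtain h1 where h1: "h1 holomorphic_on UNIV" "\<And>z. N1 z = T z * h1 z"
    using entire_divide_simple_zeros[OF hol(1) hol(3) Z1 T_simple] by blast
  obtain h2 where h2: "h2 holomorphic_on UNIV" "\<And>z. N2 z = T z * h2 z"
    using entire_divide_simple_zeros[OF hol(2) hol(3) Z2 T_simple] by blast
  obtain a where a: "a \<notin> \<Gamma>" by (rule ex_nonlattice)
  have Ta: "(T (a / \<beta>))\<^sup>2 \<noteq> 0" using a \<beta>(1) by (simp add: T_def theta_0_iff)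
  have shiftNN: "N1 (z + \<gamma>) * N2 (z + \<gamma>) = (mul (\<beta> * \<gamma>) (\<beta> * z))\<^sup>2 * (N1 z * N2 z)" if "\<gamma> \<in> \<Gamma>" for z \<gamma>
  proof -
    have 1: "\<theta> (z + \<gamma> + \<tau> i) * \<theta> (z + \<gamma> - \<tau> i) = (mul \<gamma> z)\<^sup>2 * (\<theta> (z + \<tau> i) * \<theta> (z - \<tau> i))" for i
      using theta_mul[OF that, of "z + \<tau> i"] theta_mul[OF that, of "z - \<tau> i"]
      by (simp add: algebra_simps flip: mul_mul[of \<gamma> z "\<tau> i"])
    have "N1 (z + \<gamma>) * N2 (z + \<gamma>) = ((mul \<gamma> z)\<^sup>2) ^ card I * (N1 z * N2 z)"
      unfolding N1_def N2_def prod.distrib[symmetric] 1 by (simp add: prod.distrib)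
    also have "((mul \<gamma> z)\<^sup>2) ^ card I = (mul (\<beta> * \<gamma>) (\<beta> * z))\<^sup>2"
      using mul_sq[of \<gamma> z] mul_scale[of \<beta> \<gamma> z] by (simp only: exp_of_nat_mult flip: card)
    finally show ?thesis .
  qed
  have per: "h1 (z + \<gamma>) * h2 (z + \<gamma>) = h1 z * h2 z" if \<gamma>: "\<gamma> \<in> \<Gamma>" for z \<gamma>
  proof (rule entire_mult_left_cancel[of "\<lambda>z. (T z)\<^sup>2" "\<lambda>z. h1 (z + \<gamma>) * h2 (z + \<gamma>)" "\<lambda>z. h1 z * h2 z"])
    show "(\<lambda>z. (T z)\<^sup>2) holomorphic_on UNIV" "(\<lambda>z. h1 z * h2 z) holomorphic_on UNIV"
      using hol h1 h2 by (auto intro!: holomorphic_intros)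
    show "(\<lambda>z. h1 (z + \<gamma>) * h2 (z + \<gamma>)) holomorphic_on UNIV"
      by (intro holomorphic_on_mult entire_shift h1(1) h2(1))
    show "(T z)\<^sup>2 * (h1 (z + \<gamma>) * h2 (z + \<gamma>)) = (T z)\<^sup>2 * (h1 z * h2 z)" for z
    proof -
      have T: "T (z + \<gamma>) = mul (\<beta> * \<gamma>) (\<beta> * z) * T z"
        unfolding T_def using theta_mul[OF \<beta>(2)[OF \<gamma>], of "\<beta> * z"] by (simp add: ring_distribs)
      show ?thesis
        using shiftNN[OF \<gamma>, of z] unfolding h1(2) h2(2) T
        by (simp add: power2_eq_square mult_ac)
    qed
  qed (rule Ta)
  obtain C where C: "\<And>z. h1 z * h2 z = C"
    using periodic_entire_constant[of "\<lambda>z. h1 z * h2 z"] per h1(1) h2(1)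
    by (metis holomorphic_on_mult)
  \<comment> \<open>Each factor \<theta>(z)^2 Q(\<tau>) - \<theta>(\<tau>)^2 Q(z) contributes
    -\<theta>(\<tau>)^2 when it is rewritten with P(\<tau>).\<close>
  define c where "c = (\<Prod>i\<in>I - {i0}. - (\<theta> (\<tau> i))\<^sup>2)"
  have c_nz: "c \<noteq> 0"
    unfolding c_def using I by (auto simp: theta_0_iff)
  have NN: "N1 z * N2 z = c * ((\<theta> z)\<^sup>2 * (\<Prod>i\<in>I - {i0}. Q z - P (\<tau> i) * (\<theta> z)\<^sup>2))" for z
  proof -
    have "N1 z * N2 z = (\<Prod>i\<in>I. \<theta> (z + \<tau> i) * \<theta> (z - \<tau> i))"
      by (simp add: N1_def N2_def prod.distrib)
    also have "\<dots> = (\<theta> z)\<^sup>2 * (\<Prod>i\<in>I - {i0}. \<theta> (z + \<tau> i) * \<theta> (z - \<tau> i))"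
      using I(1-3) by (simp add: prod.remove power2_eq_square)
    also have "(\<Prod>i\<in>I - {i0}. \<theta> (z + \<tau> i) * \<theta> (z - \<tau> i)) =
        (\<Prod>i\<in>I - {i0}. - (\<theta> (\<tau> i))\<^sup>2 * (Q z - P (\<tau> i) * (\<theta> z)\<^sup>2))"
    proof (rule prod.cong[OF refl])
      fix i assume i: "i \<in> I - {i0}"
      have "Q (\<tau> i) = P (\<tau> i) * (\<theta> (\<tau> i))\<^sup>2" using theta_nz[OF I(4)[OF i]] by (simp add: P_def)
      then show "\<theta> (z + \<tau> i) * \<theta> (z - \<tau> i) = - (\<theta> (\<tau> i))\<^sup>2 * (Q z - P (\<tau> i) * (\<theta> z)\<^sup>2)"
        unfolding theta_add_diff[OF I(4)[OF i]] by (simp add: algebra_simps)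
    qed
    finally show ?thesis unfolding c_def prod.distrib by (simp only: mult_ac)
  qed
  have eq: "(T z)\<^sup>2 * C = c * ((\<theta> z)\<^sup>2 * (\<Prod>i\<in>I - {i0}. Q z - P (\<tau> i) * (\<theta> z)\<^sup>2))" for z
    using NN[of z] C[of z] h1(2)[of z] h2(2)[of z] by (simp add: power2_eq_square mult_ac)
  have "\<beta>\<^sup>2 * C = c"
  proof -
    \<comment> \<open>The constant is found by dividing by z^2 and letting z tend to 0.\<close>
    have isc: "isCont Q 0" "isCont \<theta> 0"
      using Q_hol theta_hol holomorphic_on_imp_continuous_on continuous_on_eq_continuous_at by blast+
    have Q0: "Q 0 = 1" by (simp add: Q_def)
    have th: "(\<theta> \<longlongrightarrow> 0) (at 0)" "(Q \<longlongrightarrow> 1) (at 0)" using isc Q0 by (auto simp: isCont_def)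
    have l1: "((\<lambda>z. \<theta> z / z) \<longlongrightarrow> 1) (at 0)"
      using D_theta[OF DERIV_ident, of 0 UNIV] by (simp add: has_field_derivative_iff)
    have l2: "((\<lambda>z. T z / z) \<longlongrightarrow> \<beta>) (at 0)"
      using dT[of 0] by (simp add: has_field_derivative_iff T_def)
    have "((\<lambda>z. (T z / z)\<^sup>2 * C) \<longlongrightarrow> \<beta>\<^sup>2 * C) (at 0)"
      by (intro tendsto_intros l2)
    moreover have "((\<lambda>z. c * ((\<theta> z / z)\<^sup>2 * (\<Prod>i\<in>I - {i0}. Q z - P (\<tau> i) * (\<theta> z)\<^sup>2))) \<longlongrightarrow>
          c * (1\<^sup>2 * (\<Prod>i\<in>I - {i0}. 1 - P (\<tau> i) * 0\<^sup>2))) (at 0)"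
      by (intro tendsto_intros th l1)
    moreover have "(T z / z)\<^sup>2 * C = c * ((\<theta> z / z)\<^sup>2 * (\<Prod>i\<in>I - {i0}. Q z - P (\<tau> i) * (\<theta> z)\<^sup>2))" for z
      using eq[of z] by (simp add: power_divide)
    ultimately show ?thesis using LIM_unique by fastforce
  qed
  moreover from this have "C \<noteq> 0" using c_nz by auto
  ultimately show ?thesis using eq[of z] by (auto simp: T_def)
qed

end

section \<open>Multiplication formulas\<close>

locale complex_subfield_closure =
  fixes L :: "complex set"
  assumes subfield: "complex_subfield L"
begin

lemma L_basic: "0 \<in> L" "1 \<in> L"
  "x \<in> L \<Longrightarrow> y \<in> L \<Longrightarrow> x + y \<in> L" "x \<in> L \<Longrightarrow> y \<in> L \<Longrightarrow> x * y \<in> L"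
  "x \<in> L \<Longrightarrow> - x \<in> L" "x \<in> L \<Longrightarrow> inverse x \<in> L"
  using subfield by (auto simp: complex_subfield_def)

lemma L_diff: "x \<in> L \<Longrightarrow> y \<in> L \<Longrightarrow> x - y \<in> L"
  using L_basic(3)[of x "- y"] L_basic(5) by simp
lemma L_divide: "x \<in> L \<Longrightarrow> y \<in> L \<Longrightarrow> x / y \<in> L"
  using L_basic(4,6) by (simp add: divide_inverse)
lemma L_power: "x \<in> L \<Longrightarrow> x ^ n \<in> L"
  by (induction n) (auto intro: L_basic)
lemma L_sum: "(\<And>i. i \<in> A \<Longrightarrow> f i \<in> L) \<Longrightarrow> sum f A \<in> L"
  by (induction A rule: infinite_finite_induct) (auto intro: L_basic)
lemma L_prod: "(\<And>i. i \<in> A \<Longrightarrow> f i \<in> L) \<Longrightarrow> prod f A \<in> L"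
  by (induction A rule: infinite_finite_induct) (auto intro: L_basic)
lemma L_of_nat: "of_nat n \<in> L"
  by (induction n) (auto intro: L_basic)
lemma L_numeral: "numeral n \<in> L"
  using L_of_nat[of "numeral n"] by simp

lemmas L_intros = L_basic L_diff L_divide L_power L_sum L_prod L_of_nat L_numeral

end

lemma has_field_derivative_prod_log:
  fixes f :: "'i \<Rightarrow> complex \<Rightarrow> complex"
  assumes "finite A" "\<And>i. i \<in> A \<Longrightarrow> (f i has_field_derivative f i z * l i) (at z)"
  shows "((\<lambda>z. \<Prod>i\<in>A. f i z) has_field_derivative (\<Prod>i\<in>A. f i z) * (\<Sum>i\<in>A. l i)) (at z)"
  using assms
proof (induction A rule: finite_induct)
  case (insert x A)
  have "((\<lambda>z. f x z * (\<Prod>i\<in>A. f i z)) has_field_derivative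
      f x z * l x * (\<Prod>i\<in>A. f i z) + ((\<Prod>i\<in>A. f i z) * (\<Sum>i\<in>A. l i)) * f x z) (at z)"
    by (rule DERIV_mult) (use insert in auto)
  then show ?case using insert by (simp add: algebra_simps)
qed simp

context complex_lattice
begin

section \<open>Torsion points and sublattices of finite index\<close>

definition torsion :: "complex \<Rightarrow> bool" where
  "torsion a \<longleftrightarrow> (\<exists>n>0. of_nat n * a \<in> \<Gamma>)"

lemma torsion_mult:
  assumes "torsion a" "\<And>\<gamma>. \<gamma> \<in> \<Gamma> \<Longrightarrow> \<beta> * \<gamma> \<in> \<Gamma>"
  shows "torsion (\<beta> * a)"
proof -
  obtain n where n: "n > 0" "of_nat n * a \<in> \<Gamma>" using assms(1) by (auto simp: torsion_def)
  then have "\<beta> * (of_nat n * a) \<in> \<Gamma>" using assms(2) by blast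
  then show ?thesis using n(1) unfolding torsion_def by (metis mult.left_commute)
qed

lemma torsion_add:
  assumes "torsion a" "torsion b" shows "torsion (a + b)"
proof -
  obtain n where n: "n > 0" "of_nat n * a \<in> \<Gamma>" using assms(1) by (auto simp: torsion_def)
  obtain m where m: "m > 0" "of_nat m * b \<in> \<Gamma>" using assms(2) by (auto simp: torsion_def)
  have "of_int (int m) * (of_nat n * a) + of_int (int n) * (of_nat m * b) \<in> \<Gamma>"
    by (intro lattice_add lattice_of_int n m)
  also have "of_int (int m) * (of_nat n * a) + of_int (int n) * (of_nat m * b) = of_nat (n * m) * (a + b)"
    by (simp add: algebra_simps)
  finally show ?thesis using n(1) m(1) unfolding torsion_def by (metis nat_0_less_mult_iff)
qed

lemma torsion_minus: "torsion a \<Longrightarrow> torsion (- a)"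
  using torsion_mult[of a "- 1"] by simp

lemma torsion_divide_nat: "\<gamma> \<in> \<Gamma> \<Longrightarrow> n > 0 \<Longrightarrow> torsion (\<gamma> / of_nat n)"
  unfolding torsion_def by (rule exI[of _ n]) auto

lemma of_rat_w1_notin:
  assumes "0 < q" "q < 1" shows "of_real q * w1 \<notin> \<Gamma>"
proof
  assume "of_real q * w1 \<in> \<Gamma>"
  then obtain m n :: int where "of_real q * w1 = of_int m * w1 + of_int n * w2"
    unfolding basis by auto
  then have "of_real q * w1 + of_real 0 * w2 = of_real (of_int m) * w1 + of_real (of_int n) * w2" by simp
  from coordinates_unique(1)[OF this] assms have "0 < m" "m < 1" by auto
  then show False by simp
qed

text \<open>Index pairs \<open>(i, j) \<in> I\<close> enumerate \<open>\<Gamma>/\<beta>\<Gamma>\<close> through \<open>i w\<^sub>1 + j w\<^sub>2\<close>: the lattice \<open>\<beta>\<Gamma>\<close> is required to have the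
  triangular basis \<open>b w\<^sub>2\<close>, \<open>c w\<^sub>1 + d w\<^sub>2\<close>.\<close>

definition sublattice_index :: "complex \<Rightarrow> (nat \<times> nat) set \<Rightarrow> bool" where
  "sublattice_index \<beta> I \<longleftrightarrow> (\<exists>b c d :: int. b \<noteq> 0 \<and> c \<noteq> 0 \<and> I = {..<nat \<bar>c\<bar>} \<times> {..<nat \<bar>b\<bar>} \<and>
     \<beta> \<noteq> 0 \<and> of_int \<bar>b * c\<bar> = \<beta> * cnj \<beta> \<and>
     (\<lambda>\<gamma>. \<beta> * \<gamma>) ` \<Gamma> = {of_int m * (of_int b * w2) + of_int k * (of_int c * w1 + of_int d * w2) | m k. True})"

text \<open>For pairs in \<open>I\<close> these represent \<beta>^-1 \<Gamma> modulo \<Gamma>, the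
  points killed by \<beta>.\<close>

definition rep :: "complex \<Rightarrow> nat \<times> nat \<Rightarrow> complex" where
  "rep \<beta> = (\<lambda>(i, j). (of_nat i * w1 + of_nat j * w2) / \<beta>)"

text \<open>A triangular basis allows division with remainder in two rounds: the coefficient of
  \<open>w1\<close> modulo c, and thereafter that of \<open>w2\<close> modulo b. The bounds on the
  remainders keep the nonzero representatives out of \<Gamma>.\<close>

lemma sublattice_index_props:
  assumes "sublattice_index \<beta> I"
  shows "\<beta> \<noteq> 0" "finite I" "(0, 0) \<in> I" "of_nat (card I) = \<beta> * cnj \<beta>"
    "\<gamma> \<in> \<Gamma> \<Longrightarrow> \<beta> * \<gamma> \<in> \<Gamma>"
    "i \<in> I - {(0, 0)} \<Longrightarrow> rep \<beta> i \<notin> \<Gamma>"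
    "torsion (rep \<beta> i)"
    "\<beta> * z \<in> \<Gamma> \<Longrightarrow> \<exists>i\<in>I. z - rep \<beta> i \<in> \<Gamma>"
proof -
  obtain b c d :: int where bc: "b \<noteq> 0" "c \<noteq> 0" and I: "I = {..<nat \<bar>c\<bar>} \<times> {..<nat \<bar>b\<bar>}"
    and \<beta>: "\<beta> \<noteq> 0" and N: "of_int \<bar>b * c\<bar> = \<beta> * cnj \<beta>"
    and im: "(\<lambda>\<gamma>. \<beta> * \<gamma>) ` \<Gamma> = {of_int m * (of_int b * w2) + of_int k * (of_int c * w1 + of_int d * w2) | m k. True}"
    using assms unfolding sublattice_index_def by blast
  show "\<beta> \<noteq> 0" "finite I" "(0, 0) \<in> I" using \<beta> I bc by auto
  have "card I = nat \<bar>b * c\<bar>" using I by (simp add: abs_mult nat_mult_distrib mult.commute)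
  then show "of_nat (card I) = \<beta> * cnj \<beta>" using N by (simp del: of_int_abs of_int_mult)
  have mem: "of_int m * (of_int b * w2) + of_int k * (of_int c * w1 + of_int d * w2) \<in> (\<lambda>\<gamma>. \<beta> * \<gamma>) ` \<Gamma>" for m k
    unfolding im by blast
  show "\<beta> * \<gamma> \<in> \<Gamma>" if \<gamma>: "\<gamma> \<in> \<Gamma>" for \<gamma>
  proof -
    have "\<beta> * \<gamma> \<in> (\<lambda>\<gamma>. \<beta> * \<gamma>) ` \<Gamma>" using \<gamma> by blast
    then obtain m k :: int where "\<beta> * \<gamma> = of_int m * (of_int b * w2) + of_int k * (of_int c * w1 + of_int d * w2)"
      unfolding im by blast
    also have "\<dots> = of_int (k * c) * w1 + of_int (m * b + k * d) * w2" by (simp add: algebra_simps)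
    finally show ?thesis unfolding basis by blast
  qed
  show "rep \<beta> i \<notin> \<Gamma>" if i: "i \<in> I - {(0, 0)}" for i
  proof
    assume "rep \<beta> i \<in> \<Gamma>"
    then have "\<beta> * rep \<beta> i \<in> (\<lambda>\<gamma>. \<beta> * \<gamma>) ` \<Gamma>" by blast
    then obtain m k :: int where mk: "\<beta> * rep \<beta> i = of_int m * (of_int b * w2) + of_int k * (of_int c * w1 + of_int d * w2)"
      unfolding im by blast
    obtain p q where pq: "i = (p, q)" by fastforce
    have "of_real (of_nat p) * w1 + of_real (of_nat q) * w2 = of_real (of_int (k * c)) * w1 + of_real (of_int (m * b + k * d)) * w2"
    proof -
      have "\<beta> * rep \<beta> i = of_nat p * w1 + of_nat q * w2" using \<beta> by (simp add: rep_def pq)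
      then show ?thesis using mk by (simp add: algebra_simps)
    qed
    from coordinates_unique[OF this] have e: "int p = k * c" "int q = m * b + k * d"
      by (metis of_int_eq_iff of_int_of_nat_eq)+
    have lt: "int p < \<bar>c\<bar>" "int q < \<bar>b\<bar>" using i pq I by auto
    have "k = 0"
    proof (rule ccontr)
      assume "k \<noteq> 0"
      then have "\<bar>c\<bar> * 1 \<le> \<bar>c\<bar> * \<bar>k\<bar>" by (intro mult_left_mono) auto
      moreover have "\<bar>int p\<bar> = \<bar>c\<bar> * \<bar>k\<bar>" unfolding e(1) by (simp add: abs_mult mult.commute)
      ultimately show False using lt by simp
    qed
    then have p0: "p = 0" and q: "int q = m * b" using e by auto
    have "m = 0"
    proof (rule ccontr)
      assume "m \<noteq> 0"
      then have "\<bar>b\<bar> * 1 \<le> \<bar>b\<bar> * \<bar>m\<bar>" by (intro mult_left_mono) auto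
      moreover have "\<bar>int q\<bar> = \<bar>b\<bar> * \<bar>m\<bar>" unfolding q by (simp add: abs_mult mult.commute)
      ultimately show False using lt by simp
    qed
    then show False using p0 q i pq by auto
  qed
  show "torsion (rep \<beta> i)" for i
  proof -
    obtain p q where pq: "i = (p, q)" by fastforce
    define \<gamma> where "\<gamma> = \<beta> * rep \<beta> i"
    have "\<gamma> = of_nat p * w1 + of_nat q * w2" using \<beta> by (simp add: \<gamma>_def rep_def pq)
    \<comment> \<open>The adjugate of the triangular matrix shows that bc annihilates
      \<Gamma>/\<beta>\<Gamma>.\<close>
    then have "of_int (b * c) * \<gamma> = of_int (int q * c - int p * d) * (of_int b * w2) + of_int (int p * b) * (of_int c * w1 + of_int d * w2)"
      by (simp add: algebra_simps)
    then have "of_int (b * c) * \<gamma> \<in> (\<lambda>\<gamma>. \<beta> * \<gamma>) ` \<Gamma>" using mem by metis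
    then obtain \<delta> where \<delta>: "\<delta> \<in> \<Gamma>" "of_int (b * c) * \<gamma> = \<beta> * \<delta>" by blast
    then have "\<beta> * (of_int (b * c) * rep \<beta> i) = \<beta> * \<delta>" by (simp add: \<gamma>_def algebra_simps)
    then have "of_int (b * c) * rep \<beta> i \<in> \<Gamma>" using \<beta> \<delta>(1) by simp
    then have "of_int (sgn (b * c)) * (of_int (b * c) * rep \<beta> i) \<in> \<Gamma>" by (rule lattice_of_int)
    also have "of_int (sgn (b * c)) * (of_int (b * c) * rep \<beta> i) = of_nat (nat \<bar>b * c\<bar>) * rep \<beta> i"
      using abs_sgn[of "b * c"] by (simp flip: of_int_mult mult.assoc add: mult.commute)
    finally show ?thesis unfolding torsion_def using bc by (intro exI[of _ "nat \<bar>b * c\<bar>"]) auto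
  qed
  show "\<exists>i\<in>I. z - rep \<beta> i \<in> \<Gamma>" if "\<beta> * z \<in> \<Gamma>" for z
  proof -
    obtain m n :: int where mn: "\<beta> * z = of_int m * w1 + of_int n * w2"
      using \<open>\<beta> * z \<in> \<Gamma>\<close> unfolding basis by blast
    \<comment> \<open>Remainders are taken modulo absolute values because b or c may be negative;
      with complex multiplication bc < 0.\<close>
    define p where "p = m mod \<bar>c\<bar>"
    have "\<bar>c\<bar> dvd m - p" by (simp add: p_def)
    then have "c dvd m - p" by simp
    then obtain k where k: "m - p = c * k" by (elim dvdE)
    define q where "q = (n - k * d) mod \<bar>b\<bar>"
    have "\<bar>b\<bar> dvd n - k * d - q" by (simp add: q_def)
    then have "b dvd n - k * d - q" by simp
    then obtain l where l: "n - k * d - q = b * l" by (elim dvdE)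
    have pq: "0 \<le> p" "p < \<bar>c\<bar>" "0 \<le> q" "q < \<bar>b\<bar>" using bc by (auto simp: p_def q_def)
    define i where "i = (nat p, nat q)"
    have r: "\<beta> * rep \<beta> i = of_int p * w1 + of_int q * w2"
      using pq \<beta> by (simp add: rep_def i_def)
    have "\<beta> * (z - rep \<beta> i) = of_int l * (of_int b * w2) + of_int k * (of_int c * w1 + of_int d * w2)"
    proof -
      have "m = p + c * k" "n = q + b * l + k * d" using k l by auto
      then show ?thesis unfolding right_diff_distrib mn r by (simp add: algebra_simps)
    qed
    then have "\<beta> * (z - rep \<beta> i) \<in> (\<lambda>\<gamma>. \<beta> * \<gamma>) ` \<Gamma>" using mem by metis
    then have "z - rep \<beta> i \<in> \<Gamma>" using \<beta> by auto
    moreover have "i \<in> I" using pq by (auto simp: i_def I)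
    ultimately show ?thesis by blast
  qed
qed

lemma sublattice_index_nat:
  assumes "n > 0"
  obtains I where "sublattice_index (of_nat n) I"
proof -
  have "(\<lambda>\<gamma>. of_nat n * \<gamma>) ` \<Gamma> = {of_int m * (of_int (int n) * w2) + of_int k * (of_int (int n) * w1 + of_int 0 * w2) | m k. True}"
  proof (intro equalityI subsetI)
    fix x assume "x \<in> (\<lambda>\<gamma>. of_nat n * \<gamma>) ` \<Gamma>"
    then obtain k m :: int where "x = of_nat n * (of_int k * w1 + of_int m * w2)" unfolding basis by blast
    then have "x = of_int m * (of_int (int n) * w2) + of_int k * (of_int (int n) * w1 + of_int 0 * w2)"
      by (simp add: algebra_simps)
    then show "x \<in> {of_int m * (of_int (int n) * w2) + of_int k * (of_int (int n) * w1 + of_int 0 * w2) | m k. True}" by blast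
  next
    fix x assume "x \<in> {of_int m * (of_int (int n) * w2) + of_int k * (of_int (int n) * w1 + of_int 0 * w2) | m k. True}"
    then obtain m k :: int where "x = of_int m * (of_int (int n) * w2) + of_int k * (of_int (int n) * w1 + of_int 0 * w2)" by blast
    then have "x = of_nat n * (of_int k * w1 + of_int m * w2)" by (simp add: algebra_simps)
    then show "x \<in> (\<lambda>\<gamma>. of_nat n * \<gamma>) ` \<Gamma>" unfolding basis by blast
  qed
  then have "sublattice_index (of_nat n) ({..<nat \<bar>int n\<bar>} \<times> {..<nat \<bar>int n\<bar>})"
    unfolding sublattice_index_def using assms by (intro exI[of _ "int n"] exI[of _ "0::int"]) auto
  then show ?thesis using that by blast
qed

text \<open>Subtracting a suitable integer from \<alpha> makes \<beta> w1 a multiple of w2, so the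
  images of w1 and w2 already form a triangular basis. The characteristic equation of \<beta> then
  shows that its norm is -bc.\<close>

lemma sublattice_index_CM:
  assumes \<alpha>: "Im \<alpha> \<noteq> 0" "\<And>\<gamma>. \<gamma> \<in> \<Gamma> \<Longrightarrow> \<alpha> * \<gamma> \<in> \<Gamma>"
  obtains a :: int and I where "sublattice_index (\<alpha> - of_int a) I"
proof -
  have "w1 = of_int 1 * w1 + of_int 0 * w2" "w2 = of_int 0 * w1 + of_int 1 * w2" by simp_all
  then have w: "w1 \<in> \<Gamma>" "w2 \<in> \<Gamma>" unfolding basis by blast+
  obtain a b :: int where ab: "\<alpha> * w1 = of_int a * w1 + of_int b * w2"
    using \<alpha>(2)[OF w(1)] unfolding basis by blast
  define \<beta> where "\<beta> = \<alpha> - of_int a"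
  have Im: "Im \<beta> \<noteq> 0" using \<alpha>(1) by (simp add: \<beta>_def)
  then have \<beta>0: "\<beta> \<noteq> 0" by auto
  have b1: "\<beta> * w1 = of_int b * w2" using ab by (simp add: \<beta>_def algebra_simps)
  have closed: "\<beta> * \<gamma> \<in> \<Gamma>" if "\<gamma> \<in> \<Gamma>" for \<gamma>
    using lattice_diff[OF \<alpha>(2)[OF that] lattice_of_int[OF that, of a]] by (simp add: \<beta>_def algebra_simps)
  obtain c d :: int where cd: "\<beta> * w2 = of_int c * w1 + of_int d * w2"
    using closed[OF w(2)] unfolding basis by blast
  have bnz: "b \<noteq> 0" using b1 \<beta>0 w_nz by auto
  have "\<beta>\<^sup>2 * w1 = \<beta> * (of_int b * w2)" by (simp add: power2_eq_square b1 mult.assoc)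
  also have "\<dots> = of_int (b * c) * w1 + of_int d * (of_int b * w2)" 
  proof -
    have "\<beta> * (of_int b * w2) = of_int b * (\<beta> * w2)" by (simp only: mult_ac)
    then show ?thesis unfolding cd by (simp add: algebra_simps)
  qed
  also have "\<dots> = (of_int (b * c) + of_int d * \<beta>) * w1" unfolding b1[symmetric] by (simp add: algebra_simps)
  finally have quad: "\<beta>\<^sup>2 = of_int (b * c) + of_int d * \<beta>" using w_nz by simp
  \<comment> \<open>The imaginary part of the quadratic equation identifies d as the trace of
    \<beta>.\<close>
  have "2 * Re \<beta> * Im \<beta> = of_int d * Im \<beta>" using arg_cong[OF quad, of Im] by (simp add: power2_eq_square)
  then have d: "of_int d = 2 * Re \<beta>" using Im by simp
  have "\<beta> * cnj \<beta> = of_real (2 * Re \<beta>) * \<beta> - \<beta>\<^sup>2"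
    by (simp add: complex_eq_iff power2_eq_square algebra_simps)
  also have "\<dots> = - of_int (b * c)" unfolding quad by (simp flip: d)
  finally have norm: "\<beta> * cnj \<beta> = of_int (- (b * c))" by simp
  have "(0::real) < (cmod \<beta>)\<^sup>2" using \<beta>0 by simp
  then have pos: "- (b * c) > 0"
    using norm by (metis complex_norm_square of_int_0_less_iff of_real_eq_iff of_real_of_int_eq)
  then have cnz: "c \<noteq> 0" by auto
  have "(\<lambda>\<gamma>. \<beta> * \<gamma>) ` \<Gamma> = {of_int m * (of_int b * w2) + of_int k * (of_int c * w1 + of_int d * w2) | m k. True}"
  proof (intro equalityI subsetI)
    fix x assume "x \<in> (\<lambda>\<gamma>. \<beta> * \<gamma>) ` \<Gamma>"
    then obtain k m :: int where "x = \<beta> * (of_int m * w1 + of_int k * w2)" unfolding basis by blast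
    then have "x = of_int m * (\<beta> * w1) + of_int k * (\<beta> * w2)" by (simp add: algebra_simps)
    then show "x \<in> {of_int m * (of_int b * w2) + of_int k * (of_int c * w1 + of_int d * w2) | m k. True}"
      unfolding b1 cd by blast
  next
    fix x assume "x \<in> {of_int m * (of_int b * w2) + of_int k * (of_int c * w1 + of_int d * w2) | m k. True}"
    then obtain m k :: int where "x = of_int m * (of_int b * w2) + of_int k * (of_int c * w1 + of_int d * w2)" by blast
    then have "x = of_int m * (\<beta> * w1) + of_int k * (\<beta> * w2)" unfolding b1 cd .
    then have "x = \<beta> * (of_int m * w1 + of_int k * w2)" by (simp add: algebra_simps)
    then show "x \<in> (\<lambda>\<gamma>. \<beta> * \<gamma>) ` \<Gamma>" unfolding basis by blast
  qed
  then have "sublattice_index \<beta> ({..<nat \<bar>c\<bar>} \<times> {..<nat \<bar>b\<bar>})"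
    unfolding sublattice_index_def using \<beta>0 bnz cnz norm pos by (intro exI[of _ b] exI[of _ c] exI[of _ d]) auto
  then show ?thesis using that unfolding \<beta>_def by blast
qed

end

context theta_lattice
begin

section \<open>Logarithmic derivatives of the multiplication formula\<close>

lemma open_compl_lattice: "open (- \<Gamma>)"
proof -
  have "continuous_on UNIV \<theta>" using theta_hol holomorphic_on_imp_continuous_on by blast
  then have "open (\<theta> -` (- {0}))" by (intro open_vimage) auto
  also have "\<theta> -` (- {0}) = - \<Gamma>" using theta_0_iff by auto
  finally show ?thesis .
qed

lemma P_hol: "P holomorphic_on - \<Gamma>"
  unfolding P_def Q_def by (intro holomorphic_intros) (auto simp: theta_0_iff)

lemma P1_hol: "deriv P holomorphic_on - \<Gamma>"
  using P_hol open_compl_lattice by (rule holomorphic_deriv)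

lemma D_P: "z \<notin> \<Gamma> \<Longrightarrow> (P has_field_derivative deriv P z) (at z)"
  using P_hol open_compl_lattice holomorphic_derivI[of P "- \<Gamma>" z UNIV] by simp

lemma D_P1: "z \<notin> \<Gamma> \<Longrightarrow> (deriv P has_field_derivative deriv (deriv P) z) (at z)"
  using P1_hol open_compl_lattice holomorphic_derivI[of "deriv P" "- \<Gamma>" z UNIV] by simp

definition zeta :: "complex \<Rightarrow> complex" where "zeta z = \<theta>1 z / \<theta> z"

lemma D_zeta: "z \<notin> \<Gamma> \<Longrightarrow> (zeta has_field_derivative - P z) (at z)"
  unfolding zeta_def P_def Q_def
  by (auto intro!: derivative_eq_intros simp: theta_0_iff field_simps power2_eq_square)

lemma zeta_shift: "\<gamma> \<in> \<Gamma> \<Longrightarrow> z \<notin> \<Gamma> \<Longrightarrow> zeta (z + \<gamma>) = zeta z + B * cnj \<gamma>"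
  unfolding zeta_def theta_mul theta1_mul using theta_nz[of z]
  by (simp add: field_simps)

lemma theta_mult_formula_P:
  assumes I: "sublattice_index \<beta> I" and z: "z \<notin> \<Gamma>"
  shows "(\<theta> (\<beta> * z))\<^sup>2 = \<beta>\<^sup>2 * (\<theta> z) ^ (2 * card I) * (\<Prod>i\<in>I - {(0, 0)}. P z - P (rep \<beta> i))"
proof -
  note p = sublattice_index_props[OF I]
  have r0: "rep \<beta> (0, 0) = 0" by (simp add: rep_def)
  have "(\<theta> (\<beta> * z))\<^sup>2 = \<beta>\<^sup>2 * (\<theta> z)\<^sup>2 * (\<Prod>i\<in>I - {(0, 0)}. Q z - P (rep \<beta> i) * (\<theta> z)\<^sup>2)"
    by (rule theta_mult_formula[where I = I and \<tau> = "rep \<beta>"]) (use p r0 in auto)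
  also have "(\<Prod>i\<in>I - {(0, 0)}. Q z - P (rep \<beta> i) * (\<theta> z)\<^sup>2) =
      (\<Prod>i\<in>I - {(0, 0)}. (\<theta> z)\<^sup>2 * (P z - P (rep \<beta> i)))"
    using theta_nz[OF z] by (intro prod.cong refl) (simp add: P_def field_simps)
  also have "\<dots> = ((\<theta> z)\<^sup>2) ^ (card I - 1) * (\<Prod>i\<in>I - {(0, 0)}. P z - P (rep \<beta> i))"
    using p(2,3) by (simp add: prod.distrib)
  also have "\<beta>\<^sup>2 * (\<theta> z)\<^sup>2 * \<dots> = \<beta>\<^sup>2 * (((\<theta> z)\<^sup>2) ^ Suc (card I - 1)) * (\<Prod>i\<in>I - {(0, 0)}. P z - P (rep \<beta> i))"
    by simp
  also have "Suc (card I - 1) = card I"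
    using p(2,3) by (metis Suc_diff_1 card_gt_0_iff empty_iff)
  finally show ?thesis by (simp add: power_mult)
qed

text \<open>The logarithmic derivative of \<open>theta_mult_formula_P\<close>. The differences P(z)
  - P(\<tau>) are nonzero because \<theta>(\<beta>z) is.\<close>

lemma zeta_mult_formula:
  assumes I: "sublattice_index \<beta> I" and z: "z \<notin> \<Gamma>" "\<beta> * z \<notin> \<Gamma>"
  shows "i \<in> I - {(0, 0)} \<Longrightarrow> P z \<noteq> P (rep \<beta> i)"
    and "2 * \<beta> * zeta (\<beta> * z) = 2 * of_nat (card I) * zeta z + (\<Sum>i\<in>I - {(0, 0)}. deriv P z / (P z - P (rep \<beta> i)))"
proof -
  note p = sublattice_index_props[OF I]
  define G where "G = (\<lambda>z. \<Prod>i\<in>I - {(0, 0)}. P z - P (rep \<beta> i))"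
  have nz: "(\<theta> (\<beta> * z))\<^sup>2 \<noteq> 0" using theta_nz[OF z(2)] by simp
  then have Gnz: "G z \<noteq> 0" using theta_mult_formula_P[OF I z(1)] by (auto simp: G_def)
  show ne: "P z \<noteq> P (rep \<beta> i)" if "i \<in> I - {(0, 0)}" for i
    using Gnz that p(2) by (auto simp: G_def)
  define S where "S = (\<Sum>i\<in>I - {(0, 0)}. deriv P z / (P z - P (rep \<beta> i)))"
  have "(G has_field_derivative G z * S) (at z)"
    unfolding G_def S_def
    by (rule has_field_derivative_prod_log)
       (use ne p(2) D_P[OF z(1)] in \<open>auto intro!: derivative_eq_intros\<close>)
  then have "((\<lambda>z. \<beta>\<^sup>2 * (\<theta> z) ^ (2 * card I) * G z) has_field_derivative
      \<beta>\<^sup>2 * (\<theta> z) ^ (2 * card I) * G z * (2 * of_nat (card I) * zeta z + S)) (at z)"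
  proof -
    have c: "card I \<noteq> 0" using p(2,3) by auto
    have "\<theta> z ^ (2 * card I) = \<theta> z * \<theta> z ^ (2 * card I - 1)"
      using c by (metis power_eq_if mult_eq_0_iff zero_neq_numeral)
    then have e: "of_nat (2 * card I) * (\<theta>1 z * \<theta> z ^ (2 * card I - Suc 0)) = \<theta> z ^ (2 * card I) * (2 * of_nat (card I) * zeta z)"
      using theta_nz[OF z(1)] by (simp add: zeta_def)
    assume DG: "(G has_field_derivative G z * S) (at z)"
    have "((\<lambda>z. \<theta> z ^ (2 * card I)) has_field_derivative of_nat (2 * card I) * (\<theta>1 z * \<theta> z ^ (2 * card I - Suc 0))) (at z)"
      using DERIV_power[OF D_theta[OF DERIV_ident, of z UNIV], of "2 * card I"] by simp
    from DERIV_mult[OF DERIV_cmult[OF this[unfolded e], of "\<beta>\<^sup>2"] DG]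
    show ?thesis by (simp add: algebra_simps)
  qed
  then have "((\<lambda>z. (\<theta> (\<beta> * z))\<^sup>2) has_field_derivative
      \<beta>\<^sup>2 * (\<theta> z) ^ (2 * card I) * G z * (2 * of_nat (card I) * zeta z + S)) (at z)"
    by (rule has_field_derivative_transform_within_open[OF _ open_compl_lattice])
       (use z theta_mult_formula_P[OF I] in \<open>auto simp: G_def\<close>)
  then have "((\<lambda>z. (\<theta> (\<beta> * z))\<^sup>2) has_field_derivative
      (\<theta> (\<beta> * z))\<^sup>2 * (2 * of_nat (card I) * zeta z + S)) (at z)"
    using theta_mult_formula_P[OF I z(1)] by (simp add: G_def)
  moreover have "((\<lambda>z. (\<theta> (\<beta> * z))\<^sup>2) has_field_derivative (\<theta> (\<beta> * z))\<^sup>2 * (2 * \<beta> * zeta (\<beta> * z))) (at z)"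
    using theta_nz[OF z(2)] by (auto intro!: derivative_eq_intros simp: zeta_def power2_eq_square)
  ultimately have "(\<theta> (\<beta> * z))\<^sup>2 * (2 * of_nat (card I) * zeta z + S) = (\<theta> (\<beta> * z))\<^sup>2 * (2 * \<beta> * zeta (\<beta> * z))"
    by (rule DERIV_unique)
  then show "2 * \<beta> * zeta (\<beta> * z) = 2 * of_nat (card I) * zeta z + S"
    using nz by simp
qed

text \<open>Obtained by differentiating \<open>zeta_mult_formula\<close>. On the right P enters only
  through differences and derivatives, so an additive constant in P survives on the left
  alone.\<close>

lemma P_mult_formula:
  assumes I: "sublattice_index \<beta> I" and z: "z \<notin> \<Gamma>" "\<beta> * z \<notin> \<Gamma>"
  shows "2 * of_nat (card I) * P z - 2 * \<beta>\<^sup>2 * P (\<beta> * z) =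
     (\<Sum>i\<in>I - {(0, 0)}. (deriv (deriv P) z * (P z - P (rep \<beta> i)) - (deriv P z)\<^sup>2) / (P z - P (rep \<beta> i))\<^sup>2)"
proof -
  note p = sublattice_index_props[OF I]
  define X where "X = - \<Gamma> \<inter> (\<lambda>z. \<beta> * z) -` (- \<Gamma>)"
  have "open X" unfolding X_def
    by (intro open_Int open_compl_lattice open_vimage continuous_intros)
  have zX: "z \<in> X" using z by (simp add: X_def)
  have "((\<lambda>z. 2 * \<beta> * zeta (\<beta> * z)) has_field_derivative 2 * \<beta> * (- P (\<beta> * z) * \<beta>)) (at z)"
  proof -
    have "((\<lambda>z. zeta (\<beta> * z)) has_field_derivative - P (\<beta> * z) * \<beta>) (at z)"
      by (rule DERIV_chain2[of zeta _ "\<lambda>z. \<beta> * z"]) (use D_zeta[OF z(2)] in \<open>auto intro!: derivative_eq_intros\<close>)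
    then show ?thesis by (rule DERIV_cmult)
  qed
  moreover have "((\<lambda>z. 2 * of_nat (card I) * zeta z + (\<Sum>i\<in>I - {(0, 0)}. deriv P z / (P z - P (rep \<beta> i)))) has_field_derivative
     2 * of_nat (card I) * (- P z) +
     (\<Sum>i\<in>I - {(0, 0)}. (deriv (deriv P) z * (P z - P (rep \<beta> i)) - deriv P z * deriv P z) /
         ((P z - P (rep \<beta> i)) * (P z - P (rep \<beta> i))))) (at z)"
  proof (intro DERIV_add DERIV_cmult D_zeta z DERIV_sum)
    fix i assume i: "i \<in> I - {(0, 0)}"
    have "((\<lambda>z. P z - P (rep \<beta> i)) has_field_derivative deriv P z) (at z)"
      using D_P[OF z(1)] by (auto intro!: derivative_eq_intros)
    then show "((\<lambda>z. deriv P z / (P z - P (rep \<beta> i))) has_field_derivative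
        (deriv (deriv P) z * (P z - P (rep \<beta> i)) - deriv P z * deriv P z) /
         ((P z - P (rep \<beta> i)) * (P z - P (rep \<beta> i)))) (at z)"
      using zeta_mult_formula(1)[OF I z i] D_P1[OF z(1)] by (intro DERIV_divide) auto
  qed
  then have "((\<lambda>z. 2 * \<beta> * zeta (\<beta> * z)) has_field_derivative
     2 * of_nat (card I) * (- P z) +
     (\<Sum>i\<in>I - {(0, 0)}. (deriv (deriv P) z * (P z - P (rep \<beta> i)) - deriv P z * deriv P z) /
         ((P z - P (rep \<beta> i)) * (P z - P (rep \<beta> i))))) (at z)"
    by (rule has_field_derivative_transform_within_open[OF _ \<open>open X\<close> zX])
       (use zeta_mult_formula(2)[OF I] in \<open>auto simp: X_def\<close>)
  ultimately have "2 * \<beta> * (- P (\<beta> * z) * \<beta>) = 2 * of_nat (card I) * (- P z) +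
     (\<Sum>i\<in>I - {(0, 0)}. (deriv (deriv P) z * (P z - P (rep \<beta> i)) - deriv P z * deriv P z) /
         ((P z - P (rep \<beta> i)) * (P z - P (rep \<beta> i))))"
    by (rule DERIV_unique)
  then show ?thesis by (simp add: power2_eq_square algebra_simps)
qed

definition fa :: "complex \<Rightarrow> complex \<Rightarrow> complex" where
  "fa a z = exp (- (B * (a * cnj a / 2 + z * cnj a))) * \<theta> (z + a)"

text \<open>\<theta>(a + \<gamma> + \<delta>) can be reached by two translations in either order,
  and the factors must agree. This is Legendre's relation in exponential form.\<close>

lemma legendre:
  assumes "\<gamma> \<in> \<Gamma>" "\<delta> \<in> \<Gamma>"
  shows "exp (B * (\<gamma> * cnj \<delta> - \<delta> * cnj \<gamma>)) = 1"
proof -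
  obtain a where a: "a \<notin> \<Gamma>" by (rule ex_nonlattice)
  have 1: "\<theta> (a + \<gamma> + \<delta>) = mul \<delta> (a + \<gamma>) * mul \<gamma> a * \<theta> a"
    using assms by (simp add: theta_mul)
  have 2: "\<theta> (a + \<delta> + \<gamma>) = mul \<gamma> (a + \<delta>) * mul \<delta> a * \<theta> a"
    using assms by (simp add: theta_mul)
  have m: "mul x (a + y) = mul x a * exp (B * (y * cnj x))" for x y
  proof -
    have "B * ((a + y) * cnj x + x * cnj x / 2) = B * (a * cnj x + x * cnj x / 2) + B * (y * cnj x)"
      by (simp add: algebra_simps)
    then show ?thesis unfolding mul_def by (simp only: exp_add mult.assoc)
  qed
  have "mul \<delta> (a + \<gamma>) * mul \<gamma> a = mul \<gamma> (a + \<delta>) * mul \<delta> a"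
    using 1 2 theta_nz[OF a] by (simp add: add_ac)
  then have "exp (B * (\<gamma> * cnj \<delta>)) = exp (B * (\<delta> * cnj \<gamma>))"
    unfolding m by (simp add: mult_ac)
  then show ?thesis by (simp add: right_diff_distrib exp_diff)
qed

text \<open>Multiplying by n and m turns both arguments into lattice points, where
  \<open>legendre\<close> applies; the additional factor 2 compensates the division by 2 in the
  exponent.\<close>

lemma exp_torsion_root_of_unity:
  assumes "torsion a" "torsion b"
  obtains n where "n > 0" "exp (B * (a * cnj b - b * cnj a) / 2) ^ n = 1"
proof -
  obtain n where n: "n > 0" "of_nat n * a \<in> \<Gamma>" using assms(1) by (auto simp: torsion_def)
  obtain m where m: "m > 0" "of_nat m * b \<in> \<Gamma>" using assms(2) by (auto simp: torsion_def)
  have "exp (B * (a * cnj b - b * cnj a) / 2) ^ (2 * (n * m)) = exp (of_nat (2 * (n * m)) * (B * (a * cnj b - b * cnj a) / 2))"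
    by (rule exp_of_nat_mult[symmetric])
  also have "of_nat (2 * (n * m)) * (B * (a * cnj b - b * cnj a) / 2) =
      B * ((of_nat n * a) * cnj (of_nat m * b) - (of_nat m * b) * cnj (of_nat n * a))"
    by (simp add: field_simps)
  also have "exp \<dots> = 1" by (rule legendre[OF n(2) m(2)])
  finally show ?thesis using that[of "2 * (n * m)"] n m by simp
qed

text \<open>The exponential prefactor of \<open>fa\<close> absorbs the z-dependent part of the
  automorphy factor; what remains depends on a and \<gamma> only.\<close>

lemma fa_shift:
  assumes "\<gamma> \<in> \<Gamma>"
  shows "fa (a + \<gamma>) z = s \<gamma> * exp (B * (a * cnj \<gamma> - \<gamma> * cnj a) / 2) * fa a z"
proof -
  have "fa (a + \<gamma>) z = exp (- (B * ((a + \<gamma>) * cnj (a + \<gamma>) / 2 + z * cnj (a + \<gamma>)))) * (mul \<gamma> (z + a) * \<theta> (z + a))"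
    using theta_mul[OF assms, of "z + a"] by (simp add: fa_def add_ac)
  also have "\<dots> = s \<gamma> * exp (- (B * ((a + \<gamma>) * cnj (a + \<gamma>) / 2 + z * cnj (a + \<gamma>))) + B * ((z + a) * cnj \<gamma> + \<gamma> * cnj \<gamma> / 2)) * \<theta> (z + a)"
    unfolding mul_def exp_add by (simp only: mult_ac)
  also have "- (B * ((a + \<gamma>) * cnj (a + \<gamma>) / 2 + z * cnj (a + \<gamma>))) + B * ((z + a) * cnj \<gamma> + \<gamma> * cnj \<gamma> / 2)
     = B * (a * cnj \<gamma> - \<gamma> * cnj a) / 2 + - (B * (a * cnj a / 2 + z * cnj a))"
    by (simp add: algebra_simps add_divide_distrib diff_divide_distrib)
  finally show ?thesis unfolding fa_def exp_add by (simp only: mult_ac)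
qed

end

section \<open>Algebraicity of theta values at torsion points\<close>

text \<open>The arithmetic input in abstract form: P - p0 stands for u, and \<open>L\<close> is a
  subfield closed under radicals that contains the torsion values of u. The uniformization of the
  curve supplies these facts at the very end.\<close>

locale theta_algebraic = theta_lattice \<Gamma> w1 w2 \<theta> B s + complex_subfield_closure L
  for \<Gamma> w1 w2 \<theta> B s L +
  fixes g2 g3 p0 \<beta>0 :: complex and I0
  assumes L_root: "\<And>x n. x ^ n \<in> L \<Longrightarrow> n > 0 \<Longrightarrow> x \<in> L"
    and L_g: "g2 \<in> L" "g3 \<in> L"
    and P_ode: "\<And>z. z \<notin> \<Gamma> \<Longrightarrow> (deriv P z)\<^sup>2 = 4 * (P z - p0) ^ 3 - g2 * (P z - p0) - g3"
    and P_ode2: "\<And>z. z \<notin> \<Gamma> \<Longrightarrow> deriv (deriv P) z = 6 * (P z - p0)\<^sup>2 - g2 / 2"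
    and L_torsion: "\<And>t. torsion t \<Longrightarrow> t \<notin> \<Gamma> \<Longrightarrow> P t - p0 \<in> L"
    and CM: "sublattice_index \<beta>0 I0" "Im \<beta>0 \<noteq> 0" "\<beta>0 \<in> L"
begin

lemma L_P1: assumes "torsion t" "t \<notin> \<Gamma>" shows "deriv P t \<in> L"
proof (rule L_root)
  show "deriv P t ^ 2 \<in> L"
    unfolding P_ode[OF assms(2)] by (intro L_intros L_g L_torsion[OF assms])
qed simp

lemma L_P2: assumes "torsion t" "t \<notin> \<Gamma>" shows "deriv (deriv P) t \<in> L"
  unfolding P_ode2[OF assms(2)] by (intro L_intros L_g L_torsion[OF assms])

lemma L_P_diff: "torsion t \<Longrightarrow> t \<notin> \<Gamma> \<Longrightarrow> torsion r \<Longrightarrow> r \<notin> \<Gamma> \<Longrightarrow> P t - P r \<in> L"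
  using L_diff[OF L_torsion[of t] L_torsion[of r]] by simp

lemma L_rep_diff:
  assumes "sublattice_index \<beta> I" "torsion t" "t \<notin> \<Gamma>" "i \<in> I - {(0, 0)}"
  shows "P t - P (rep \<beta> i) \<in> L"
  using L_P_diff assms(2,3) sublattice_index_props(6,7)[OF assms(1)] assms(4) by blast

text \<open>\<theta>(z)/z tends to 1 at 0, so \<Gamma> has no short nonzero vectors; for large n
  both w1/n and \<beta> w1/n are short and nonzero.\<close>

lemma ex_torsion_not_killed:
  assumes "\<beta> \<noteq> 0"
  obtains a where "torsion a" "a \<notin> \<Gamma>" "\<beta> * a \<notin> \<Gamma>"
proof -
  have "\<forall>\<^sub>F z in at 0. \<theta> z \<noteq> 0"
  proof -
    have "\<forall>\<^sub>F z in at 0. \<theta> z / z \<noteq> 0"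
      using D_theta[OF DERIV_ident, of 0 UNIV]
      by (intro tendsto_imp_eventually_ne[of _ 1]) (simp_all add: has_field_derivative_iff)
    then show ?thesis by eventually_elim auto
  qed
  then obtain e where e: "e > 0" "\<And>z. z \<noteq> 0 \<Longrightarrow> norm z < e \<Longrightarrow> z \<notin> \<Gamma>"
    unfolding eventually_at theta_0_iff by (auto simp: dist_norm)
  obtain n where n: "of_nat n > (norm w1 + norm (\<beta> * w1)) / e" using reals_Archimedean2 by blast
  moreover have "(norm w1 + norm (\<beta> * w1)) / e \<ge> 0" using e(1) by simp
  ultimately have n0: "n > 0" by (metis of_nat_0_less_iff order_le_less_trans)
  define a where "a = w1 / of_nat n"
  have "norm w1 + norm (\<beta> * w1) < of_nat n * e" using n e(1) by (simp add: field_simps)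
  then have "norm w1 / of_nat n < e" "norm (\<beta> * w1) / of_nat n < e"
    using n0 by (auto simp: field_simps intro: order_le_less_trans)
      (smt (verit, best) norm_ge_zero mult_nonneg_nonneg)+
  then have "norm a < e" "norm (\<beta> * a) < e"
    by (simp_all add: a_def norm_divide norm_mult)
  then have "a \<notin> \<Gamma>" "\<beta> * a \<notin> \<Gamma>" using e(2) assms n0 w_nz by (auto simp: a_def)
  moreover have "torsion a"
  proof -
    have "w1 = of_int 1 * w1 + of_int 0 * w2" by simp
    then have "w1 \<in> \<Gamma>" unfolding basis by blast
    then show ?thesis unfolding a_def using n0 by (rule torsion_divide_nat)
  qed
  ultimately show ?thesis using that by blast
qed

text \<open>Classically p0 is the nonholomorphic Eisenstein value of weight two. The right side of
  \<open>P_mult_formula\<close> is in \<open>L\<close> because p0 cancels in the differences, while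
  on the left p0 has the coefficient 2 (|\<beta>|^2 - \<beta>^2).\<close>

lemma L_p0: "p0 \<in> L"
proof -
  note p = sublattice_index_props[OF CM(1)]
  define U where "U = (\<lambda>z. P z - p0)"
  obtain a where a: "torsion a" "a \<notin> \<Gamma>" "\<beta>0 * a \<notin> \<Gamma>" using ex_torsion_not_killed[OF p(1)] .
  define S where "S = (\<Sum>i\<in>I0 - {(0, 0)}. (deriv (deriv P) a * (P a - P (rep \<beta>0 i)) - (deriv P a)\<^sup>2) / (P a - P (rep \<beta>0 i))\<^sup>2)"
  have "S \<in> L"
    unfolding S_def by (intro L_intros L_P1 L_P2 a L_rep_diff[OF CM(1)])
  have "2 * of_nat (card I0) * P a - 2 * \<beta>0\<^sup>2 * P (\<beta>0 * a) = S"
    unfolding S_def by (rule P_mult_formula[OF CM(1) a(2,3)])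
  then have "2 * (of_nat (card I0) - \<beta>0\<^sup>2) * p0 = S - 2 * of_nat (card I0) * U a + 2 * \<beta>0\<^sup>2 * U (\<beta>0 * a)"
    by (simp add: U_def algebra_simps)
  also have "\<dots> \<in> L"
  proof -
    have "U a \<in> L" "U (\<beta>0 * a) \<in> L"
      using L_torsion[OF a(1,2)] L_torsion[OF torsion_mult[OF a(1) p(5)] a(3)] by (simp_all add: U_def)
    then show ?thesis using \<open>S \<in> L\<close> by (intro L_intros CM(3))
  qed
  finally have *: "2 * (of_nat (card I0) - \<beta>0\<^sup>2) * p0 \<in> L" .
  have "2 * (of_nat (card I0) - \<beta>0\<^sup>2) \<in> L" by (intro L_intros CM(3))
  with * have "2 * (of_nat (card I0) - \<beta>0\<^sup>2) * p0 / (2 * (of_nat (card I0) - \<beta>0\<^sup>2)) \<in> L"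
    by (rule L_divide)
  \<comment> \<open>This is where a nonreal endomorphism matters: the difference is \<beta> times
    (cnj \<beta> - \<beta>).\<close>
  moreover have "of_nat (card I0) - \<beta>0\<^sup>2 \<noteq> 0"
  proof -
    have "of_nat (card I0) - \<beta>0\<^sup>2 = \<beta>0 * (cnj \<beta>0 - \<beta>0)" unfolding p(4) by (simp add: power2_eq_square algebra_simps)
    moreover have "cnj \<beta>0 - \<beta>0 \<noteq> 0" using CM(2) by (simp add: complex_eq_iff)
    ultimately show ?thesis using p(1) by simp
  qed
  ultimately show ?thesis by simp
qed

lemma L_root_of_unity: "x ^ n = 1 \<Longrightarrow> n > 0 \<Longrightarrow> x \<in> L"
  using L_root[of x n] L_basic by simp

lemma L_exp_torsion:
  assumes "torsion a" "torsion b" shows "exp (B * (a * cnj b - b * cnj a) / 2) \<in> L"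
  using exp_torsion_root_of_unity[OF assms] L_root_of_unity by metis

lemma L_sign: "s \<gamma> \<in> L"
  using L_root_of_unity[of "s \<gamma>" 2] sign_sq by (simp add: power2_eq_square)

text \<open>If k > 0 kills a, then n = k + 1 fixes a modulo \<Gamma>.\<close>

lemma torsion_multiplier:
  assumes "torsion a"
  obtains n where "n \<ge> 2" "of_nat n * a - a \<in> \<Gamma>"
proof -
  obtain n where n: "n > 0" "of_nat n * a \<in> \<Gamma>" using assms by (auto simp: torsion_def)
  then show ?thesis using that[of "Suc n"] by (simp add: algebra_simps)
qed

text \<open>Since n a = a + \<gamma>, the value of \<open>fa (n a)\<close> at 0 is a root of unity
  times f_a(0); by the multiplication formula its square is n^2 G f_a(0)^(2 n^2). Cancelling
  f_a(0)^2 leaves f_a(0)^(2 n^2 - 2) in \<open>L\<close>.\<close>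

lemma L_fa_0:
  assumes "torsion a" "a \<notin> \<Gamma>"
  shows "fa a 0 \<in> L"
proof -
  obtain n where n: "n \<ge> 2" "of_nat n * a - a \<in> \<Gamma>" using torsion_multiplier[OF assms(1)] .
  define \<gamma> where "\<gamma> = of_nat n * a - a"
  have na: "of_nat n * a = a + \<gamma>" and \<gamma>: "\<gamma> \<in> \<Gamma>" using n by (auto simp: \<gamma>_def)
  have na_notin: "of_nat n * a \<notin> \<Gamma>" unfolding na using lattice_add_iff[OF \<gamma>] assms(2) by simp
  obtain I where I: "sublattice_index (of_nat n) I" using sublattice_index_nat[of n] n by auto
  note p = sublattice_index_props[OF I]
  define G where "G = (\<Prod>i\<in>I - {(0, 0)}. P a - P (rep (of_nat n) i))"
  have "G \<in> L" unfolding G_def by (intro L_intros L_rep_diff[OF I] assms)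
  have cI: "card I = n * n"
  proof -
    have "(of_nat (card I) :: complex) = of_nat (n * n)" using p(4) by simp
    then show ?thesis using of_nat_eq_iff by blast
  qed
  define e where "e = s \<gamma> * exp (B * (a * cnj \<gamma> - \<gamma> * cnj a) / 2)"
  have "torsion \<gamma>" using \<gamma> by (auto simp: torsion_def intro!: exI[of _ 1])
  then have eL: "e \<in> L" unfolding e_def using assms by (intro L_basic L_sign L_exp_torsion)
  have e_nz: "e \<noteq> 0" using sign_sq[of \<gamma>] by (auto simp: e_def)
  have k_nz: "fa a 0 \<noteq> 0" using theta_nz[OF assms(2)] by (simp add: fa_def)
  have "(fa (of_nat n * a) 0)\<^sup>2 = (of_nat n)\<^sup>2 * G * (fa a 0) ^ (2 * (n * n))"
  proof -
    have "(fa (of_nat n * a) 0)\<^sup>2 = (exp (- (B * (of_nat n * a * cnj (of_nat n * a) / 2))))\<^sup>2 * (\<theta> (of_nat n * a))\<^sup>2"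
      by (simp add: fa_def power_mult_distrib)
    also have "(exp (- (B * (of_nat n * a * cnj (of_nat n * a) / 2))))\<^sup>2 = (exp (- (B * (a * cnj a / 2)))) ^ (2 * (n * n))"
      unfolding exp_of_nat_mult[symmetric] by (simp add: algebra_simps)
    also have "(\<theta> (of_nat n * a))\<^sup>2 = (of_nat n)\<^sup>2 * \<theta> a ^ (2 * (n * n)) * G"
      using theta_mult_formula_P[OF I assms(2)] by (simp add: cI G_def)
    finally show ?thesis by (simp add: fa_def power_mult_distrib mult_ac)
  qed
  moreover have "fa (of_nat n * a) 0 = e * fa a 0" unfolding na e_def by (rule fa_shift[OF \<gamma>])
  ultimately have "e\<^sup>2 * (fa a 0)\<^sup>2 = (of_nat n)\<^sup>2 * G * (fa a 0) ^ (2 * (n * n))"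
    by (simp add: power_mult_distrib)
  also have "(fa a 0) ^ (2 * (n * n)) = (fa a 0) ^ (2 * (n * n) - 2) * (fa a 0)\<^sup>2"
  proof -
    have "2 * (n * n) - 2 + 2 = 2 * (n * n)" using n(1) by (cases n) auto
    then show ?thesis by (metis power_add)
  qed
  finally have eq: "e\<^sup>2 = (of_nat n)\<^sup>2 * G * (fa a 0) ^ (2 * (n * n) - 2)"
    using k_nz by simp
  then have "G \<noteq> 0" using e_nz by auto
  then have "(fa a 0) ^ (2 * (n * n) - 2) = e\<^sup>2 / ((of_nat n)\<^sup>2 * G)"
    using eq n(1) by (simp add: field_simps)
  also have "\<dots> \<in> L" by (intro L_intros eL \<open>G \<in> L\<close>)
  finally have "(fa a 0) ^ (2 * (n * n) - 2) \<in> L" .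
  moreover have "2 * 2 \<le> n * n" using n(1) by (intro mult_mono) auto
  then have "2 * (n * n) - 2 > 0" by simp
  ultimately show ?thesis by (rule L_root)
qed

text \<open>Quasi-periodicity gives zeta(n a) = zeta(a) + B (n - 1) cnj a, the multiplication
  formula gives zeta(n a) = n zeta(a) + S/(2n). Eliminating zeta(n a) leaves a nonzero integer
  multiple of zeta(a) - B cnj a.\<close>

lemma L_zeta:
  assumes "torsion a" "a \<notin> \<Gamma>"
  shows "zeta a - B * cnj a \<in> L"
proof -
  obtain n where n: "n \<ge> 2" "of_nat n * a - a \<in> \<Gamma>" using torsion_multiplier[OF assms(1)] .
  define \<gamma> where "\<gamma> = of_nat n * a - a"
  have na: "of_nat n * a = a + \<gamma>" and \<gamma>: "\<gamma> \<in> \<Gamma>" using n by (auto simp: \<gamma>_def)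
  have na_notin: "of_nat n * a \<notin> \<Gamma>" unfolding na using lattice_add_iff[OF \<gamma>] assms(2) by simp
  obtain I where I: "sublattice_index (of_nat n) I" using sublattice_index_nat[of n] n by auto
  note p = sublattice_index_props[OF I]
  define S where "S = (\<Sum>i\<in>I - {(0, 0)}. deriv P a / (P a - P (rep (of_nat n) i)))"
  have "S \<in> L" unfolding S_def by (intro L_intros L_rep_diff[OF I] L_P1 assms)
  have "2 * of_nat n * zeta (of_nat n * a) = 2 * (of_nat n * of_nat n) * zeta a + S"
    using zeta_mult_formula(2)[OF I assms(2) na_notin] p(4) by (simp add: S_def)
  moreover have "zeta (of_nat n * a) = zeta a + B * (of_nat n * cnj a - cnj a)"
    unfolding na zeta_shift[OF \<gamma> assms(2)] by (simp add: \<gamma>_def)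
  ultimately have "2 * of_nat n * (zeta a + B * (of_nat n * cnj a - cnj a)) = 2 * (of_nat n * of_nat n) * zeta a + S"
    by simp
  then have "S = 2 * of_nat n * (zeta a + B * (of_nat n * cnj a - cnj a)) - 2 * (of_nat n * of_nat n) * zeta a"
    by simp
  then have "2 * of_nat n * (1 - of_nat n) * (zeta a - B * cnj a) = S"
    by (simp add: algebra_simps)
  moreover have "2 * of_nat n * (1 - of_nat n :: complex) \<noteq> 0"
    using n(1) by (metis diff_eq_diff_eq eq_iff_diff_eq_0 mult_eq_0_iff not_numeral_le_zero of_nat_1_eq_iff of_nat_eq_0_iff zero_neq_numeral one_less_numeral_iff semiring_norm(76) leD)
  ultimately have "zeta a - B * cnj a = S / (2 * of_nat n * (1 - of_nat n))"
    by (simp add: field_simps)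
  also have "\<dots> \<in> L" by (intro L_intros \<open>S \<in> L\<close>)
  finally show ?thesis .
qed

end

section \<open>Power series in two variables\<close>

lemma has_sum_times_complex:
  fixes p :: "'a \<Rightarrow> complex" and q :: "'b \<Rightarrow> complex"
  assumes p: "(p has_sum x) A" and q: "(q has_sum y) B"
  shows "((\<lambda>(a, b). p a * q b) has_sum (x * y)) (A \<times> B)"
proof (rule has_sum_SigmaI)
  show "((\<lambda>b. case (a, b) of (a, b) \<Rightarrow> p a * q b) has_sum (p a * y)) B" for a
    using has_sum_cmult_right[OF q] by simp
  show "((\<lambda>a. p a * y) has_sum (x * y)) A"
    using has_sum_cmult_left[OF p] by simp
  have "(\<lambda>a. norm (p a)) summable_on A" "(\<lambda>b. norm (q b)) summable_on B"
    using p q summable_on_iff_abs_summable_on_complex by (auto simp: summable_on_def)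
  then have "(\<lambda>v. norm (case v of (a, b) \<Rightarrow> p a * q b)) summable_on A \<times> B"
    unfolding Infinite_Sum.abs_summable_on_Sigma_iff
    by (simp add: norm_mult infsum_cmult_right' abs_mult summable_on_cmult_right summable_on_cmult_left)
  then show "(\<lambda>(a, b). p a * q b) summable_on A \<times> B"
    by (rule abs_summable_summable)
qed

lemma has_sum_extend_zero:
  assumes "(f has_sum x) S" "\<And>v. v \<notin> S \<Longrightarrow> f v = 0"
  shows "(f has_sum x) UNIV"
  using has_sum_cong_neutral[of S UNIV f f x] assms by simp

definition conv2 :: "(nat \<Rightarrow> nat \<Rightarrow> complex) \<Rightarrow> (nat \<Rightarrow> nat \<Rightarrow> complex) \<Rightarrow> nat \<Rightarrow> nat \<Rightarrow> complex" where
  "conv2 p q m n = (\<Sum>(i, j)\<in>{..m} \<times> {..n}. p i j * q (m - i) (n - j))"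

definition has_power_series2 :: "(complex \<Rightarrow> complex \<Rightarrow> complex) \<Rightarrow> (nat \<Rightarrow> nat \<Rightarrow> complex) \<Rightarrow> bool" where
  "has_power_series2 f c \<longleftrightarrow> (\<exists>r>0. \<forall>z w. norm z < r \<longrightarrow> norm w < r \<longrightarrow>
      ((\<lambda>(m, n). c m n * z ^ m * w ^ n) has_sum f z w) UNIV)"

text \<open>The Cauchy product: the sum over quadruples of exponents is regrouped by the total
  exponents (m, n).\<close>

lemma has_sum_conv2:
  assumes p: "((\<lambda>(m, n). p m n * z ^ m * w ^ n) has_sum x) UNIV"
    and q: "((\<lambda>(m, n). q m n * z ^ m * w ^ n) has_sum y) UNIV"
  shows "((\<lambda>(m, n). conv2 p q m n * z ^ m * w ^ n) has_sum (x * y)) UNIV"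
proof -
  define T where "T = (\<lambda>((i, j), (k, l)). (p i j * z ^ i * w ^ j) * (q k l * z ^ k * w ^ l))"
  define \<phi> :: "(nat \<times> nat) \<times> (nat \<times> nat) \<Rightarrow> (nat \<times> nat) \<times> (nat \<times> nat)"
    where "\<phi> = (\<lambda>((m, n), (i, j)). ((i, j), (m - i, n - j)))"
  have "(T has_sum (x * y)) UNIV"
    using has_sum_times_complex[OF p q] by (simp add: T_def case_prod_unfold)
  moreover have "bij_betw \<phi> (Sigma UNIV (\<lambda>(m, n). {..m} \<times> {..n})) UNIV"
    by (rule bij_betw_byWitness[where f' = "\<lambda>((i, j), (k, l)). ((i + k, j + l), (i, j))"])
       (auto simp: \<phi>_def)
  ultimately have "((\<lambda>v. T (\<phi> v)) has_sum (x * y)) (Sigma UNIV (\<lambda>(m, n). {..m} \<times> {..n}))"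
    using has_sum_reindex_bij_betw by blast
  moreover have "((\<lambda>u. T (\<phi> (v, u))) has_sum ((\<lambda>(m, n). conv2 p q m n * z ^ m * w ^ n) v)) ((\<lambda>(m, n). {..m} \<times> {..n}) v)" for v
  proof -
    obtain m n where v: "v = (m, n)" by fastforce
    have "(\<Sum>u\<in>{..m} \<times> {..n}. T (\<phi> (v, u))) = conv2 p q m n * z ^ m * w ^ n"
      unfolding conv2_def sum_distrib_right
    proof (rule sum.cong[OF refl])
      fix u assume "u \<in> {..m} \<times> {..n}"
      then obtain i j where u: "u = (i, j)" and ij: "i \<le> m" "j \<le> n" by auto
      have "z ^ m = z ^ i * z ^ (m - i)" "w ^ n = w ^ j * w ^ (n - j)"
        using ij by (simp_all flip: power_add)
      then show "T (\<phi> (v, u)) = (case u of (i, j) \<Rightarrow> p i j * q (m - i) (n - j)) * z ^ m * w ^ n"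
        by (simp add: T_def \<phi>_def v u)
    qed
    moreover have "((\<lambda>u. T (\<phi> (v, u))) has_sum (\<Sum>u\<in>{..m} \<times> {..n}. T (\<phi> (v, u)))) ({..m} \<times> {..n})"
      by (rule has_sum_finite) auto
    ultimately show ?thesis by (simp add: v)
  qed
  ultimately show ?thesis
    by (rule has_sum_SigmaD[where f = "\<lambda>v. T (\<phi> v)" and A = UNIV and B = "\<lambda>(m, n). {..m} \<times> {..n}"
          and g = "\<lambda>(m, n). conv2 p q m n * z ^ m * w ^ n"])
qed

lemma has_power_series2_mult:
  assumes "has_power_series2 f p" "has_power_series2 g q"
  shows "has_power_series2 (\<lambda>z w. f z w * g z w) (conv2 p q)"
proof -
  obtain r where r: "r > 0" "\<And>z w. norm z < r \<Longrightarrow> norm w < r \<Longrightarrow> ((\<lambda>(m, n). p m n * z ^ m * w ^ n) has_sum f z w) UNIV"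
    using assms(1) unfolding has_power_series2_def by blast
  obtain r' where r': "r' > 0" "\<And>z w. norm z < r' \<Longrightarrow> norm w < r' \<Longrightarrow> ((\<lambda>(m, n). q m n * z ^ m * w ^ n) has_sum g z w) UNIV"
    using assms(2) unfolding has_power_series2_def by blast
  show ?thesis unfolding has_power_series2_def
    by (rule exI[of _ "min r r'"]) (use r r' has_sum_conv2 in auto)
qed

lemma has_fps_expansion_has_sum:
  fixes F :: "complex fps"
  assumes "f has_fps_expansion F"
  obtains r where "r > 0" "\<And>z. norm z < r \<Longrightarrow> ((\<lambda>n. fps_nth F n * z ^ n) has_sum f z) UNIV"
    "\<And>z. norm z < r \<Longrightarrow> summable (\<lambda>n. norm (fps_nth F n * z ^ n))"
proof -
  have "fps_conv_radius F > 0" and ev: "eventually (\<lambda>z. eval_fps F z = f z) (nhds 0)"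
    using assms by (auto simp: has_fps_expansion_def)
  then obtain R :: real where R: "0 < R" "ereal R < fps_conv_radius F"
    using ereal_dense2 zero_ereal_def by (metis ereal_less(2))
  obtain e where e: "e > 0" "\<And>z. norm z < e \<Longrightarrow> eval_fps F z = f z"
    using ev unfolding eventually_nhds_metric by (auto simp: dist_norm)
  have conv: "norm z < fps_conv_radius F" if "norm z < min R e" for z :: complex
    using R that by (metis ereal_less_eq(3) less_imp_le min_less_iff_conj order_le_less_trans)
  show ?thesis
  proof (rule that[of "min R e"])
    fix z :: complex assume z: "norm z < min R e"
    show s: "summable (\<lambda>n. norm (fps_nth F n * z ^ n))"
      by (rule norm_summable_fps[OF conv[OF z]])
    have "(\<lambda>n. fps_nth F n * z ^ n) sums eval_fps F z"
      by (rule sums_eval_fps[OF conv[OF z]])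
    then show "((\<lambda>n. fps_nth F n * z ^ n) has_sum f z) UNIV"
      using norm_summable_imp_has_sum[OF s] e z by auto
  qed (use R e in auto)
qed

lemma has_power_series2_left:
  assumes "f has_fps_expansion F"
  shows "has_power_series2 (\<lambda>z w. f z) (\<lambda>m n. if n = 0 then fps_nth F m else 0)"
proof -
  obtain r where r: "r > 0" "\<And>z. norm z < r \<Longrightarrow> ((\<lambda>n. fps_nth F n * z ^ n) has_sum f z) UNIV"
     "\<And>z. norm z < r \<Longrightarrow> summable (\<lambda>n. norm (fps_nth F n * z ^ n))"
    using has_fps_expansion_has_sum[OF assms] by blast
  have "((\<lambda>(m, n). (if n = 0 then fps_nth F m else 0) * z ^ m * w ^ n) has_sum f z) UNIV"
    if "norm z < r" for z w :: complex
  proof -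
    have bij: "bij_betw (\<lambda>m::nat. (m, 0::nat)) UNIV (UNIV \<times> {0})"
      unfolding bij_betw_def inj_on_def by blast
    define T where "T = (\<lambda>(m, n). (if n = 0 then fps_nth F m else 0) * z ^ m * w ^ n)"
    have "T (m, 0) = fps_nth F m * z ^ m" for m
      unfolding T_def by (simp only: prod.case if_True power_0 mult_1_right refl)
    then have "((\<lambda>m. T (m, 0)) has_sum f z) UNIV"
      using r(2)[OF that] by (simp only:)
    then have "(T has_sum f z) (UNIV \<times> {0})"
      using has_sum_reindex_bij_betw[OF bij, of T] by blast
    then have "(T has_sum f z) UNIV"
      by (rule has_sum_extend_zero) (auto simp: T_def split: if_splits)
    then show ?thesis unfolding T_def .
  qed
  then show ?thesis unfolding has_power_series2_def using r(1) by blast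
qed

lemma has_power_series2_swap:
  assumes "has_power_series2 f c"
  shows "has_power_series2 (\<lambda>z w. f w z) (\<lambda>m n. c n m)"
proof -
  obtain r where r: "r > 0" "\<And>z w. norm z < r \<Longrightarrow> norm w < r \<Longrightarrow> ((\<lambda>(m, n). c m n * z ^ m * w ^ n) has_sum f z w) UNIV"
    using assms(1) unfolding has_power_series2_def by blast
  have "((\<lambda>(m, n). c n m * z ^ m * w ^ n) has_sum f w z) UNIV" if "norm z < r" "norm w < r" for z w
  proof -
    have "bij_betw prod.swap UNIV (UNIV :: (nat \<times> nat) set)" by simp
    from has_sum_reindex_bij_betw[OF this, of "\<lambda>(m, n). c m n * w ^ m * z ^ n" "f w z"] r(2)[OF that(2,1)]
    show ?thesis by (simp add: case_prod_unfold mult_ac)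
  qed
  then show ?thesis unfolding has_power_series2_def using r(1) by blast
qed

text \<open>The binomial expansions of F_k (z + w)^k are summed over k. Absolute summability holds
  as the norms of the terms add up to |F_k| (|z| + |w|)^k, and |z| + |w| < r once both are below
  r/2.\<close>

lemma has_power_series2_add:
  assumes "f has_fps_expansion F"
  shows "has_power_series2 (\<lambda>z w. f (z + w)) (\<lambda>m n. of_nat ((m + n) choose m) * fps_nth F (m + n))"
proof -
  obtain r where r: "r > 0" "\<And>z. norm z < r \<Longrightarrow> ((\<lambda>n. fps_nth F n * z ^ n) has_sum f z) UNIV"
     "\<And>z. norm z < r \<Longrightarrow> summable (\<lambda>n. norm (fps_nth F n * z ^ n))"
    using has_fps_expansion_has_sum[OF assms] by blast
  have "((\<lambda>(m, n). (of_nat ((m + n) choose m) * fps_nth F (m + n)) * z ^ m * w ^ n) has_sum f (z + w)) UNIV"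
    if zw: "norm z < r / 2" "norm w < r / 2" for z w :: complex
  proof -
    define T where "T = (\<lambda>(k, m). of_nat (k choose m) * fps_nth F k * z ^ m * w ^ (k - m))"
    have inner: "((\<lambda>m. T (k, m)) has_sum fps_nth F k * (z + w) ^ k) {..k}" for k
    proof -
      have "fps_nth F k * (z + w) ^ k = (\<Sum>m\<le>k. T (k, m))"
        unfolding binomial_ring sum_distrib_left T_def by (simp add: mult_ac)
      then show ?thesis using has_sum_finite[of "{..k}" "\<lambda>m. T (k, m)"] by simp
    qed
    have nzw: "norm (z + w) < r" "norm (complex_of_real (norm z + norm w)) < r"
      using zw norm_triangle_ineq[of z w] by (simp_all del: of_real_add)
    have norms: "(\<Sum>m\<le>k. norm (T (k, m))) = norm (fps_nth F k * complex_of_real (norm z + norm w) ^ k)" for k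
    proof -
      have "norm (fps_nth F k * complex_of_real (norm z + norm w) ^ k) = norm (fps_nth F k) * (norm z + norm w) ^ k"
        by (simp add: norm_mult norm_power del: of_real_add)
      then show ?thesis
        unfolding binomial_ring sum_distrib_left T_def by (simp add: norm_mult norm_power mult_ac)
    qed
    have "(\<lambda>v. norm (T v)) summable_on Sigma UNIV (\<lambda>k. {..k})"
      unfolding Infinite_Sum.abs_summable_on_Sigma_iff
    proof (intro conjI ballI)
      show "(\<lambda>k. norm (infsum (\<lambda>m. norm (T (k, m))) {..k})) summable_on UNIV"
        using r(3)[OF nzw(2)] by (simp add: norms norm_summable_imp_summable_on)
    qed auto
    then have "(T has_sum f (z + w)) (Sigma UNIV (\<lambda>k. {..k}))"
      using has_sum_SigmaI[OF inner r(2)[OF nzw(1)]] abs_summable_summable by blast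
    moreover have "bij_betw (\<lambda>(m, n). (m + n, m)) UNIV (Sigma UNIV (\<lambda>k::nat. {..k}))"
      by (rule bij_betw_byWitness[where f' = "\<lambda>(k, m). (m, k - m)"]) auto
    ultimately have "((\<lambda>v. T (case v of (m, n) \<Rightarrow> (m + n, m))) has_sum f (z + w)) UNIV"
      using has_sum_reindex_bij_betw by blast
    then show ?thesis by (simp add: T_def case_prod_unfold)
  qed
  then show ?thesis unfolding has_power_series2_def using r(1) by (intro exI[of _ "r / 2"]) auto
qed

lemma has_laurent_expansion_at_origin_shift:
  assumes c: "has_power_series2 f c"
    and g: "\<And>z w. 0 < norm z \<Longrightarrow> norm z < e \<Longrightarrow> 0 < norm w \<Longrightarrow> norm w < e \<Longrightarrow>
          g z w = z powi (- int k) * w powi (- int l) * f z w" and e: "e > 0"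
  shows "has_laurent_expansion_at_origin g
    (\<lambda>m n. if m < - int k \<or> n < - int l then 0 else c (nat (m + int k)) (nat (n + int l)))"
proof -
  define d where "d = (\<lambda>m n. if m < - int k \<or> n < - int l then 0 else c (nat (m + int k)) (nat (n + int l)))"
  obtain r where r: "r > 0" "\<And>z w. norm z < r \<Longrightarrow> norm w < r \<Longrightarrow> ((\<lambda>(m, n). c m n * z ^ m * w ^ n) has_sum f z w) UNIV"
    using c unfolding has_power_series2_def by blast
  have "((\<lambda>(m, n). d m n * z powi m * w powi n) has_sum g z w) UNIV"
    if zw: "0 < norm z" "norm z < min r e" "0 < norm w" "norm w < min r e" for z w
  proof -
    define R where "R = {- int k..} \<times> {- int l..}"
    have bij: "bij_betw (\<lambda>(m, n). (nat (m + int k), nat (n + int l))) R UNIV"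
      by (rule bij_betw_byWitness[where f' = "\<lambda>(m, n). (int m - int k, int n - int l)"]) (auto simp: R_def)
    have "((\<lambda>(m, n). c m n * z ^ m * w ^ n) has_sum f z w) UNIV" using r(2) zw by simp
    from has_sum_cmult_right[OF this, of "z powi (- int k) * w powi (- int l)"]
    have "((\<lambda>(m, n). z powi (- int k) * w powi (- int l) * (c m n * z ^ m * w ^ n)) has_sum g z w) UNIV"
      using g[of z w] zw by (simp add: case_prod_unfold)
    then have "((\<lambda>v. case (case v of (m, n) \<Rightarrow> (nat (m + int k), nat (n + int l))) of (m, n) \<Rightarrow>
        z powi (- int k) * w powi (- int l) * (c m n * z ^ m * w ^ n)) has_sum g z w) R"
      using has_sum_reindex_bij_betw[OF bij] by blast
    then have "((\<lambda>(m, n). d m n * z powi m * w powi n) has_sum g z w) R"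
    proof (rule has_sum_cong[THEN iffD1, rotated], goal_cases)
      case (1 v)
      obtain m n where v: "v = (m, n)" by fastforce
      have mn: "m \<ge> - int k" "n \<ge> - int l" using 1 by (auto simp: R_def v)
      have "z powi m = z powi (- int k) * z ^ nat (m + int k)"
        using mn zw(1) power_int_add[of z "- int k" "m + int k"] by (simp add: power_int_def)
      moreover have "w powi n = w powi (- int l) * w ^ nat (n + int l)"
        using mn zw(3) power_int_add[of w "- int l" "n + int l"] by (simp add: power_int_def)
      ultimately show ?case using mn by (simp add: v d_def)
    qed
    then show ?thesis
      by (rule has_sum_extend_zero) (auto simp: R_def d_def split: if_splits)
  qed
  moreover have "\<exists>N. \<forall>m n. m < N \<or> n < N \<longrightarrow> d m n = 0"
    by (rule exI[of _ "- int k - int l"]) (auto simp: d_def)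
  ultimately have "has_laurent_expansion_at_origin g d"
    unfolding has_laurent_expansion_at_origin_def using r(1) e by (auto intro!: exI[of _ "min r e"])
  then show ?thesis by (simp add: d_def[abs_def])
qed

section \<open>Power series with coefficients in a subfield\<close>

context complex_subfield_closure
begin

lemma L_fps_mult: "(\<And>i. i \<le> n \<Longrightarrow> fps_nth F i \<in> L) \<Longrightarrow> (\<And>i. i \<le> n \<Longrightarrow> fps_nth G i \<in> L) \<Longrightarrow> fps_nth (F * G) n \<in> L"
  unfolding fps_mult_nth by (intro L_intros) auto

text \<open>F * inverse F = 1 is solved for the n-th coefficient of the inverse; the only division
  is by the constant term of F.\<close>

lemma L_fps_inverse:
  assumes "\<And>i. fps_nth F i \<in> L" and nz: "fps_nth F 0 \<noteq> 0"
  shows "fps_nth (inverse F) n \<in> L"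
proof (induction n rule: less_induct)
  case (less n)
  show ?case
  proof -
    have eq: "fps_nth F 0 * fps_nth (inverse F) n + (\<Sum>i\<in>{1..n}. fps_nth F i * fps_nth (inverse F) (n - i)) = fps_nth (1 :: complex fps) n"
    proof -
      have "F * inverse F = 1" using nz by (simp add: inverse_mult_eq_1')
      then have "fps_nth (1 :: complex fps) n = (\<Sum>i=0..n. fps_nth F i * fps_nth (inverse F) (n - i))"
        by (metis fps_mult_nth)
      also have "\<dots> = fps_nth F 0 * fps_nth (inverse F) n + (\<Sum>i\<in>{1..n}. fps_nth F i * fps_nth (inverse F) (n - i))"
        by (subst sum.atLeast_Suc_atMost) simp_all
      finally show ?thesis by (rule sym)
    qed
    have "(\<Sum>i\<in>{1..n}. fps_nth F i * fps_nth (inverse F) (n - i)) \<in> L"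
      using less by (intro L_intros assms) auto
    moreover have "fps_nth (1 :: complex fps) n \<in> L" using L_basic by simp
    ultimately have "(fps_nth (1 :: complex fps) n - (\<Sum>i\<in>{1..n}. fps_nth F i * fps_nth (inverse F) (n - i))) / fps_nth F 0 \<in> L"
      by (intro L_divide[OF L_diff] assms(1))
    moreover have "fps_nth (inverse F) n = (fps_nth (1 :: complex fps) n - (\<Sum>i\<in>{1..n}. fps_nth F i * fps_nth (inverse F) (n - i))) / fps_nth F 0"
      using nz by (simp only: eq[symmetric]) simp
    ultimately show ?thesis by metis
  qed
qed

text \<open>Each denominator depends on one variable, so its reciprocal is a negative power of that
  variable, given by the subdegree, times a power series in one variable; the numerator depends on z
  + w and has no pole.\<close>

lemma laurent_expansion_quotient:
  assumes f: "f has_fps_expansion F" and g: "g has_fps_expansion G" and h: "h has_fps_expansion H"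
    and nz: "G \<noteq> 0" "H \<noteq> 0" and e: "e \<in> L"
    and FL: "\<And>i. fps_nth F i \<in> L" and GL: "\<And>i. fps_nth G i \<in> L" and HL: "\<And>i. fps_nth H i \<in> L"
  shows "\<exists>c. has_laurent_expansion_at_origin (\<lambda>z w. e * f (z + w) / (g z * h w)) c \<and> (\<forall>m n. c m n \<in> L)"
proof -
  have reciprocal: "\<exists>R \<rho> \<epsilon>. \<rho> has_fps_expansion R \<and> (\<forall>i. fps_nth R i \<in> L) \<and> \<epsilon> > 0 \<and>
      (\<forall>z. 0 < norm z \<longrightarrow> norm z < \<epsilon> \<longrightarrow> 1 / g z = z powi (- int (subdegree G)) * \<rho> z)"
    if g: "g has_fps_expansion G" and "G \<noteq> 0" and GL: "\<And>i. fps_nth G i \<in> L" for g :: "complex \<Rightarrow> complex" and G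
  proof -
    define k where "k = subdegree G"
    define G' where "G' = fps_shift k G"
    have G'0: "fps_nth G' 0 \<noteq> 0" using \<open>G \<noteq> 0\<close> by (simp add: G'_def k_def)
    have "(\<lambda>z. if z = 0 then fps_nth G k else g z / z ^ k) has_fps_expansion G'"
      unfolding G'_def using g by (intro has_fps_expansion_shift) (auto simp: k_def)
    then have inv: "(\<lambda>z. inverse (if z = 0 then fps_nth G k else g z / z ^ k)) has_fps_expansion inverse G'"
      using G'0 by (intro has_fps_expansion_inverse)
    have "fps_nth (inverse G') i \<in> L" for i
      by (rule L_fps_inverse) (use G'0 in \<open>simp_all add: G'_def GL\<close>)
    \<comment> \<open>This holds for every nonzero z, also where \<open>g\<close> vanishes, since
      both sides are then 0; so \<epsilon> = 1 will do.\<close>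
    moreover have "1 / g z = z powi (- int k) * inverse (if z = 0 then fps_nth G k else g z / z ^ k)" if "0 < norm z" for z
      using that by (simp add: power_int_minus field_simps)
    ultimately show ?thesis using inv unfolding k_def[symmetric] by (intro exI[of _ "inverse G'"] exI conjI allI impI) (auto intro: zero_less_one)
  qed
  obtain R \<rho> \<epsilon> where R: "\<rho> has_fps_expansion R" "\<And>i. fps_nth R i \<in> L" "\<epsilon> > 0"
      "\<And>z. 0 < norm z \<Longrightarrow> norm z < \<epsilon> \<Longrightarrow> 1 / g z = z powi (- int (subdegree G)) * \<rho> z"
    using reciprocal[OF g nz(1) GL] by blast
  obtain R' \<rho>' \<epsilon>' where R': "\<rho>' has_fps_expansion R'" "\<And>i. fps_nth R' i \<in> L" "\<epsilon>' > 0"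
      "\<And>z. 0 < norm z \<Longrightarrow> norm z < \<epsilon>' \<Longrightarrow> 1 / h z = z powi (- int (subdegree H)) * \<rho>' z"
    using reciprocal[OF h nz(2) HL] by blast
  define S where "S = fps_const e * R"
  have S: "(\<lambda>z. e * \<rho> z) has_fps_expansion S"
    unfolding S_def using R(1) by (intro fps_expansion_intros)
  define c where "c = conv2 (conv2 (\<lambda>m n. if n = 0 then fps_nth S m else 0) (\<lambda>m n. if m = 0 then fps_nth R' n else 0))
     (\<lambda>m n. of_nat ((m + n) choose m) * fps_nth F (m + n))"
  have "has_power_series2 (\<lambda>z w. e * \<rho> z * \<rho>' w * f (z + w)) c"
    unfolding c_def
    by (intro has_power_series2_mult has_power_series2_left S has_power_series2_add f
        has_power_series2_swap[OF has_power_series2_left[OF R'(1)]])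
  then have "has_laurent_expansion_at_origin (\<lambda>z w. e * f (z + w) / (g z * h w))
    (\<lambda>m n. if m < - int (subdegree G) \<or> n < - int (subdegree H) then 0 else c (nat (m + int (subdegree G))) (nat (n + int (subdegree H))))"
  proof (rule has_laurent_expansion_at_origin_shift[where e = "min \<epsilon> \<epsilon>'"])
    fix z w :: complex assume zw: "0 < norm z" "norm z < min \<epsilon> \<epsilon>'" "0 < norm w" "norm w < min \<epsilon> \<epsilon>'"
    have "1 / g z = z powi (- int (subdegree G)) * \<rho> z" "1 / h w = w powi (- int (subdegree H)) * \<rho>' w"
      using R(4)[of z] R'(4)[of w] zw by simp_all
    moreover have "e * f (z + w) / (g z * h w) = e * f (z + w) * (1 / g z) * (1 / h w)" by simp
    ultimately show "e * f (z + w) / (g z * h w) = z powi (- int (subdegree G)) * w powi (- int (subdegree H)) * (e * \<rho> z * \<rho>' w * f (z + w))"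
      by (simp only: mult_ac)
  qed (use R R' in auto)
  moreover have "c m n \<in> L" for m n
    unfolding c_def conv2_def case_prod_unfold S_def
    using e R(2) R'(2) FL by (auto intro!: L_intros)
  ultimately show ?thesis using L_basic by (intro exI conjI) auto
qed

end

section \<open>Algebraicity of the Taylor coefficients\<close>

lemma has_fps_expansion_derivI:
  fixes f :: "complex \<Rightarrow> complex"
  assumes "f has_fps_expansion F" "open X" "0 \<in> X" "\<And>z. z \<in> X \<Longrightarrow> (f has_field_derivative f' z) (at z)"
  shows "f' has_fps_expansion fps_deriv F"
proof -
  have "deriv f has_fps_expansion fps_deriv F" using assms(1) by (rule has_fps_expansion_deriv)
  moreover have "eventually (\<lambda>z. z \<in> X) (nhds 0)" using assms(2,3) by (rule eventually_nhds_in_open)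
  then have "eventually (\<lambda>z. deriv f z = f' z) (nhds 0)"
    by eventually_elim (use assms(4) DERIV_imp_deriv in blast)
  ultimately show ?thesis using has_fps_expansion_cong by blast
qed

lemma has_fps_expansion_eqI:
  fixes f g :: "complex \<Rightarrow> complex"
  assumes "f has_fps_expansion F" "g has_fps_expansion G" "open X" "0 \<in> X" "\<And>z. z \<in> X \<Longrightarrow> f z = g z"
  shows "F = G"
proof -
  have "eventually (\<lambda>z. z \<in> X) (nhds 0)" using assms(3,4) by (rule eventually_nhds_in_open)
  then have "eventually (\<lambda>z. f z = g z) (nhds 0)" by eventually_elim (use assms(5) in blast)
  then have "g has_fps_expansion F" using has_fps_expansion_cong assms(1) by blast
  then show ?thesis using assms(2) fps_expansion_unique_complex by blast
qed

lemma holomorphic_has_fps_expansion: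
  fixes f :: "complex \<Rightarrow> complex"
  assumes "f holomorphic_on X" "open X" "0 \<in> X"
  shows "f has_fps_expansion fps_expansion f 0"
  using assms analytic_at_imp_has_fps_expansion_0 analytic_at by blast

context complex_subfield_closure
begin

lemma L_fps_deriv_step:
  assumes "fps_nth (fps_deriv F) n \<in> L" shows "fps_nth F (Suc n) \<in> L"
proof -
  have "fps_nth F (Suc n) = fps_nth (fps_deriv F) n / of_nat (Suc n)"
    using of_nat_neq_0[of n, where 'a = complex] by (simp del: of_nat_Suc)
  also have "\<dots> \<in> L" by (intro L_intros assms)
  finally show ?thesis .
qed

lemma L_fps_const: "c \<in> L \<Longrightarrow> fps_nth (fps_const c) n \<in> L"
  by (simp add: L_basic)

end

context theta_algebraic
begin

lemma fa_hol: "fa a holomorphic_on UNIV"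
  unfolding fa_def by (intro holomorphic_intros)

lemma fa_fps: "fa a has_fps_expansion fps_expansion (fa a) 0"
  by (rule holomorphic_has_fps_expansion[OF fa_hol]) auto

text \<open>The equation u'' = 6 u^2 - g2/2 yields the Taylor coefficients of u at a, zeta' = -P
  those of the logarithmic derivative of f_a, and that derivative those of f_a. Initial values are
  u(a), u'(a), zeta(a) - B cnj a and f_a(0). The first-order equation of u would instead ask for
  division by u'(a), which vanishes at 2-torsion points.\<close>

lemma L_fps_fa_nonlattice:
  assumes a: "torsion a" "a \<notin> \<Gamma>"
  shows "fps_nth (fps_expansion (fa a) 0) n \<in> L"
proof -
  define X where "X = (\<lambda>z. z + a) -` (- \<Gamma>)"
  have X: "open X" "0 \<in> X"
    unfolding X_def using a by (auto intro!: open_vimage open_compl_lattice continuous_intros)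
  have shift: "((\<lambda>z. f (z + a)) has_field_derivative D) (at z)" if "(f has_field_derivative D) (at (z + a))" for f :: "complex \<Rightarrow> complex" and D z
    using that by (simp add: DERIV_shift)
  define u where "u = (\<lambda>z. P (z + a) - p0)"
  define u1 where "u1 = (\<lambda>z. deriv P (z + a))"
  define u2 where "u2 = (\<lambda>z. deriv (deriv P) (z + a))"
  define ze where "ze = (\<lambda>z. zeta (z + a) - B * cnj a)"
  have du: "(u has_field_derivative u1 z) (at z)" and du1: "(u1 has_field_derivative u2 z) (at z)"
    and dze: "(ze has_field_derivative - (u z + p0)) (at z)" if "z \<in> X" for z
  proof -
    have z: "z + a \<notin> \<Gamma>" using that by (simp add: X_def)
    show "(u has_field_derivative u1 z) (at z)"
      unfolding u_def u1_def using DERIV_diff[OF shift[OF D_P[OF z]] DERIV_const[of p0]] by simp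
    show "(u1 has_field_derivative u2 z) (at z)"
      unfolding u1_def u2_def by (rule shift[OF D_P1[OF z]])
    show "(ze has_field_derivative - (u z + p0)) (at z)"
      unfolding ze_def u_def using DERIV_diff[OF shift[OF D_zeta[OF z]] DERIV_const[of "B * cnj a"]] by simp
  qed
  have hol: "u holomorphic_on X" "ze holomorphic_on X"
    using du dze X(1) by (auto simp: holomorphic_on_open)
  define q where "q = fps_expansion u 0"
  define E where "E = fps_expansion ze 0"
  define F where "F = fps_expansion (fa a) 0"
  have q: "u has_fps_expansion q" unfolding q_def by (rule holomorphic_has_fps_expansion[OF hol(1) X])
  have E: "ze has_fps_expansion E" unfolding E_def by (rule holomorphic_has_fps_expansion[OF hol(2) X])
  have F: "fa a has_fps_expansion F" unfolding F_def by (rule fa_fps)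
  have q1: "u1 has_fps_expansion fps_deriv q" using has_fps_expansion_derivI[OF q X du] .
  have q2: "u2 has_fps_expansion fps_deriv (fps_deriv q)" using has_fps_expansion_derivI[OF q1 X du1] .
  have q0L: "fps_nth q 0 \<in> L"
    using has_fps_expansion_imp_0_eq_fps_nth_0[OF q] L_torsion[OF a] by (simp add: u_def)
  have q1L: "fps_nth q (Suc 0) \<in> L"
    using has_fps_expansion_imp_0_eq_fps_nth_0[OF q1] L_P1[OF a] by (simp add: u1_def)
  have "(\<lambda>z. 6 * (u z * u z) - g2 / 2) has_fps_expansion fps_const 6 * (q * q) - fps_const (g2 / 2)"
    by (intro fps_expansion_intros q)
  then have ode: "fps_deriv (fps_deriv q) = fps_const 6 * (q * q) - fps_const (g2 / 2)"
    by (rule has_fps_expansion_eqI[OF q2 _ X])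
       (simp add: u2_def u_def X_def P_ode2 power2_eq_square)
  have qL: "fps_nth q n \<in> L" for n
  proof (induction n rule: less_induct)
    case (less n)
    consider "n = 0" | "n = 1" | m where "n = Suc (Suc m)" by (metis One_nat_def not0_implies_Suc)
    then show ?case
    proof cases
      case 3
      have "fps_nth (q * q) m \<in> L" using less 3 by (intro L_fps_mult) auto
      then have "fps_nth (fps_const 6 * (q * q) - fps_const (g2 / 2)) m \<in> L"
        unfolding fps_sub_nth fps_mult_left_const_nth
        by (intro L_diff L_basic(4) L_numeral L_fps_const L_divide L_g)
      then have "fps_nth (fps_deriv (fps_deriv q)) m \<in> L" unfolding ode .
      then show ?thesis unfolding 3 by (intro L_fps_deriv_step)
    qed (use q0L q1L in auto)
  qed
  have dE: "fps_deriv E = - (q + fps_const p0)"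
  proof (rule fps_expansion_unique_complex)
    show "(\<lambda>z. - (u z + p0)) has_fps_expansion fps_deriv E" by (rule has_fps_expansion_derivI[OF E X dze])
    show "(\<lambda>z. - (u z + p0)) has_fps_expansion - (q + fps_const p0)" by (intro fps_expansion_intros q)
  qed
  have EL: "fps_nth E n \<in> L" for n
  proof (cases n)
    case 0
    then show ?thesis using has_fps_expansion_imp_0_eq_fps_nth_0[OF E] L_zeta[OF a] by (simp add: ze_def)
  next
    case (Suc m)
    have "fps_nth (fps_deriv E) m \<in> L" unfolding dE using qL L_p0 by (auto intro!: L_intros)
    then show ?thesis unfolding Suc by (rule L_fps_deriv_step)
  qed
  have dfa: "(fa a has_field_derivative ze z * fa a z) (at z)" if "z \<in> X" for z
  proof -
    have z: "z + a \<notin> \<Gamma>" using that by (simp add: X_def)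
    have "(fa a has_field_derivative exp (- (B * (a * cnj a / 2 + z * cnj a))) * (- (B * cnj a)) * \<theta> (z + a)
        + exp (- (B * (a * cnj a / 2 + z * cnj a))) * \<theta>1 (z + a)) (at z)"
      unfolding fa_def[abs_def] by (auto intro!: derivative_eq_intros)
    also have "exp (- (B * (a * cnj a / 2 + z * cnj a))) * (- (B * cnj a)) * \<theta> (z + a)
        + exp (- (B * (a * cnj a / 2 + z * cnj a))) * \<theta>1 (z + a) = ze z * fa a z"
      using theta_nz[OF z] by (simp add: ze_def zeta_def fa_def left_diff_distrib)
    finally show ?thesis .
  qed
  have dF: "fps_deriv F = E * F"
  proof (rule fps_expansion_unique_complex)
    show "(\<lambda>z. ze z * fa a z) has_fps_expansion fps_deriv F" by (rule has_fps_expansion_derivI[OF F X dfa])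
    show "(\<lambda>z. ze z * fa a z) has_fps_expansion E * F" by (intro fps_expansion_intros E F)
  qed
  have "fps_nth F n \<in> L" for n
  proof (induction n rule: less_induct)
    case (less n)
    show ?case
    proof (cases n)
      case 0
      then show ?thesis using has_fps_expansion_imp_0_eq_fps_nth_0[OF F] L_fa_0[OF a] by simp
    next
      case (Suc m)
      have "fps_nth (fps_deriv F) m \<in> L" unfolding dF using less Suc EL by (intro L_fps_mult) auto
      then show ?thesis unfolding Suc by (rule L_fps_deriv_step)
    qed
  qed
  then show ?thesis unfolding F_def .
qed

text \<open>For t outside \<Gamma> the product of \<open>fa t\<close> and \<open>fa (- t)\<close>,
  divided by f_t(0)^2, is P(t) \<theta>^2 - Q. Two points eliminate Q and leave \<theta>^2.\<close>

lemma theta_sq_fa: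
  assumes "a \<notin> \<Gamma>" "b \<notin> \<Gamma>"
  shows "(P a - P b) * (\<theta> z * \<theta> z) = fa a z * fa (- a) z / (fa a 0)\<^sup>2 - fa b z * fa (- b) z / (fa b 0)\<^sup>2"
proof -
  have *: "fa t z * fa (- t) z / (fa t 0)\<^sup>2 = P t * (\<theta> z)\<^sup>2 - Q z" if t: "t \<notin> \<Gamma>" for t
  proof -
    have "fa t z * fa (- t) z = exp (- (B * (t * cnj t / 2 + z * cnj t)) + - (B * (t * cnj t / 2 - z * cnj t))) * (\<theta> (z + t) * \<theta> (z - t))"
      unfolding fa_def exp_add by simp
    also have "- (B * (t * cnj t / 2 + z * cnj t)) + - (B * (t * cnj t / 2 - z * cnj t)) = 2 * (- (B * (t * cnj t / 2)))"
      by (simp add: algebra_simps)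
    also have "exp \<dots> = (exp (- (B * (t * cnj t / 2))))\<^sup>2" by (rule exp_double)
    finally have "fa t z * fa (- t) z = (exp (- (B * (t * cnj t / 2))))\<^sup>2 * ((\<theta> z)\<^sup>2 * Q t - (\<theta> t)\<^sup>2 * Q z)"
      by (simp only: theta_add_diff[OF t])
    moreover have "fa t 0 = exp (- (B * (t * cnj t / 2))) * \<theta> t" by (simp add: fa_def)
    ultimately show ?thesis
      using theta_nz[OF t] by (simp add: P_def power_mult_distrib diff_divide_distrib)
  qed
  show ?thesis unfolding *[OF assms(1)] *[OF assms(2)] by (simp add: power2_eq_square algebra_simps)
qed

text \<open>By \<open>theta_sq_fa\<close> the coefficients of \<theta>^2 lie in \<open>L\<close>,
  and \<theta> = z + ... is determined by its square through a recursion that divides only by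
  2.\<close>

lemma L_fps_theta: "fps_nth (fps_expansion \<theta> 0) n \<in> L"
proof -
  have w1: "w1 \<in> \<Gamma>"
  proof -
    have "w1 = of_int 1 * w1 + of_int 0 * w2" by simp
    then show ?thesis unfolding basis by blast
  qed
  \<comment> \<open>With a = w1/4 and b = w1/2 none of a, b, b + a, b - a is a lattice point, so
    \<open>theta_add_diff\<close> gives P(a) \<noteq> P(b).\<close>
  define a where "a = of_real (1 / 4) * w1"
  define b where "b = of_real (1 / 2) * w1"
  have nl: "a \<notin> \<Gamma>" "b \<notin> \<Gamma>" "b + a \<notin> \<Gamma>" "b - a \<notin> \<Gamma>"
    using of_rat_w1_notin[of "1/4"] of_rat_w1_notin[of "1/2"] of_rat_w1_notin[of "3/4"]
    by (simp_all add: a_def b_def field_simps)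
  have tor: "torsion a" "torsion b"
    using torsion_divide_nat[OF w1, of 4] torsion_divide_nat[OF w1, of 2] by (simp_all add: a_def b_def)
  have "P a \<noteq> P b"
  proof
    assume "P a = P b"
    then have "(\<theta> b)\<^sup>2 * Q a = (\<theta> a)\<^sup>2 * Q b"
      using theta_nz nl by (simp add: P_def field_simps)
    then have "\<theta> (b + a) * \<theta> (b - a) = 0" using theta_add_diff[OF nl(1), of b] by simp
    then show False using nl by (simp add: theta_0_iff)
  qed
  define T where "T = fps_expansion \<theta> 0"
  have T: "\<theta> has_fps_expansion T" unfolding T_def by (rule holomorphic_has_fps_expansion[OF theta_hol]) auto
  define G where "G = (\<lambda>t. fps_const (1 / (fa t 0)\<^sup>2) * (fps_expansion (fa t) 0 * fps_expansion (fa (- t)) 0))"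
  have GL: "fps_nth (G t) n \<in> L" if "torsion t" "t \<notin> \<Gamma>" for t n
  proof -
    have "fps_nth (fps_expansion (fa t) 0 * fps_expansion (fa (- t)) 0) n \<in> L"
      using that torsion_minus by (intro L_fps_mult L_fps_fa_nonlattice) auto
    then show ?thesis unfolding G_def using L_fa_0[OF that] by (auto intro!: L_intros)
  qed
  have "(\<lambda>z. (P a - P b) * (\<theta> z * \<theta> z)) has_fps_expansion fps_const (P a - P b) * (T * T)"
    by (intro fps_expansion_intros T)
  moreover have "(\<lambda>z. 1 / (fa a 0)\<^sup>2 * (fa a z * fa (- a) z) - 1 / (fa b 0)\<^sup>2 * (fa b z * fa (- b) z)) has_fps_expansion G a - G b"
    unfolding G_def by (intro fps_expansion_intros fa_fps)
  ultimately have eq: "fps_const (P a - P b) * (T * T) = G a - G b"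
    by (rule has_fps_expansion_eqI[where X = UNIV]) (use theta_sq_fa[OF nl(1,2)] in auto)
  have TT: "fps_nth (T * T) n \<in> L" for n
  proof -
    have "(P a - P b) * fps_nth (T * T) n = fps_nth (G a - G b) n" unfolding eq[symmetric] by simp
    then have "fps_nth (T * T) n = fps_nth (G a - G b) n / (P a - P b)"
      using \<open>P a \<noteq> P b\<close> by (simp add: field_simps)
    also have "\<dots> \<in> L"
      unfolding fps_sub_nth by (intro L_divide[OF L_diff L_P_diff] GL tor nl)
    finally show ?thesis .
  qed
  have T0: "fps_nth T 0 = 0" using has_fps_expansion_imp_0_eq_fps_nth_0[OF T] by simp
  have "\<theta>1 has_fps_expansion fps_deriv T"
    by (rule has_fps_expansion_derivI[OF T open_UNIV UNIV_I]) (use D_theta[OF DERIV_ident] in simp)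
  then have T1: "fps_nth T (Suc 0) = 1" using has_fps_expansion_imp_0_eq_fps_nth_0 by fastforce
  have "fps_nth T n \<in> L" for n
  proof (induction n rule: less_induct)
    case (less n)
    consider "n = 0" | "n = 1" | "n \<ge> 2" by linarith
    then show ?case
    proof cases
      case 3
      \<comment> \<open>As T starts with z, the coefficient of degree n + 1 of T^2 contains T_n as 2
        T_n; the other nonzero terms have indices from 2 to n - 1.\<close>
      have "fps_nth (T * T) (Suc n) = (\<Sum>i=0..Suc n. fps_nth T i * fps_nth T (Suc n - i))"
        by (simp only: fps_mult_nth)
      also have "\<dots> = (\<Sum>i\<in>{0, 1, n, Suc n} \<union> {2..<n}. fps_nth T i * fps_nth T (Suc n - i))"
        by (rule sum.cong) (use 3 in auto)
      also have "\<dots> = (\<Sum>i\<in>{0, 1, n, Suc n}. fps_nth T i * fps_nth T (Suc n - i)) + (\<Sum>i\<in>{2..<n}. fps_nth T i * fps_nth T (Suc n - i))"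
        by (rule sum.union_disjoint) (use 3 in auto)
      also have "(\<Sum>i\<in>{0, 1, n, Suc n}. fps_nth T i * fps_nth T (Suc n - i)) = 2 * fps_nth T n"
        using 3 T0 T1 by simp
      finally have "fps_nth T n = (fps_nth (T * T) (Suc n) - (\<Sum>i\<in>{2..<n}. fps_nth T i * fps_nth T (Suc n - i))) / 2"
        by simp
      also have "\<dots> \<in> L" using TT less by (auto intro!: L_divide L_diff L_sum L_basic(4) L_numeral)
      finally show ?thesis .
    qed (use T0 T1 L_basic in auto)
  qed
  then show ?thesis unfolding T_def .
qed

lemma L_fps_fa:
  assumes "torsion a" shows "fps_nth (fps_expansion (fa a) 0) n \<in> L"
proof (cases "a \<in> \<Gamma>")
  case True
  have "fa a z = s a * \<theta> z" for z using fa_shift[OF True, of 0 z] by (simp add: fa_def)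
  then have "(\<lambda>z. s a * \<theta> z) has_fps_expansion fps_expansion (fa a) 0" using fa_fps[of a] by presburger
  moreover have "(\<lambda>z. s a * \<theta> z) has_fps_expansion fps_const (s a) * fps_expansion \<theta> 0"
    by (intro fps_expansion_intros holomorphic_has_fps_expansion[OF theta_hol]) auto
  ultimately have "fps_expansion (fa a) 0 = fps_const (s a) * fps_expansion \<theta> 0"
    using fps_expansion_unique_complex by blast
  then show ?thesis using L_fps_theta L_sign by (auto intro: L_basic)
qed (use assms L_fps_fa_nonlattice in auto)

text \<open>The exponents of the three factors match up to a constant, whose exponential is a root
  of unity for torsion \<open>z0\<close> and \<open>w0\<close>.\<close>

lemma fa_quotient:
  "exp (- (B * (z0 * cnj w0))) * exp (- (B * (z * cnj w0 + w * cnj z0))) * (\<theta> (z + z0 + (w + w0)) / (\<theta> (z + z0) * \<theta> (w + w0)))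
   = exp (B * (w0 * cnj z0 - z0 * cnj w0) / 2) * fa (z0 + w0) (z + w) / (fa z0 z * fa w0 w)"
proof -
  define X where "X = - (B * ((z0 + w0) * cnj (z0 + w0) / 2 + (z + w) * cnj (z0 + w0)))"
  define Y where "Y = - (B * (z0 * cnj z0 / 2 + z * cnj z0))"
  define Z where "Z = - (B * (w0 * cnj w0 / 2 + w * cnj w0))"
  have "- (B * (z0 * cnj w0)) + - (B * (z * cnj w0 + w * cnj z0)) = B * (w0 * cnj z0 - z0 * cnj w0) / 2 + X - Y - Z"
    by (simp add: X_def Y_def Z_def field_simps)
  then have "exp (- (B * (z0 * cnj w0))) * exp (- (B * (z * cnj w0 + w * cnj z0))) = exp (B * (w0 * cnj z0 - z0 * cnj w0) / 2) * exp X / (exp Y * exp Z)"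
    by (simp only: exp_add[symmetric] exp_diff[symmetric]) (simp add: exp_add exp_diff)
  then show ?thesis
    unfolding fa_def X_def[symmetric] Y_def[symmetric] Z_def[symmetric]
    by (simp only: times_divide_times_eq times_divide_eq_right times_divide_eq_left divide_divide_eq_left add_ac mult_ac)
qed

theorem kronecker_theta_translate_algebraic:
  assumes "torsion z0" "torsion w0"
  shows "\<exists>c. has_laurent_expansion_at_origin (\<lambda>z w. exp (- (B * (z0 * cnj w0))) * exp (- (B * (z * cnj w0 + w * cnj z0))) * (\<theta> (z + z0 + (w + w0)) / (\<theta> (z + z0) * \<theta> (w + w0)))) c
     \<and> (\<forall>m n. c m n \<in> L)"
proof -
  \<comment> \<open>A vanishing expansion would make \<open>fa t\<close> vanish identically, whereas
    \<theta> has nonzero values.\<close>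
  have nz: "fps_expansion (fa t) 0 \<noteq> 0" for t
  proof
    assume "fps_expansion (fa t) 0 = 0"
    then have "fa t has_fps_expansion 0" using fa_fps[of t] by simp
    then have "eventually (\<lambda>z. fa t z = 0) (nhds 0)" by (simp add: has_fps_expansion_0_iff)
    then obtain e where e: "e > 0" "\<And>z. norm z < e \<Longrightarrow> fa t z = 0"
      unfolding eventually_nhds_metric by (auto simp: dist_norm)
    obtain a where a: "a \<notin> \<Gamma>" by (rule ex_nonlattice)
    have "fa t (a - t) = 0"
      by (rule analytic_continuation_open[of "ball 0 e" UNIV "fa t" "\<lambda>_. 0"]) (use e fa_hol in auto)
    then show False using theta_nz[OF a] by (simp add: fa_def)
  qed
  show ?thesis
    unfolding fa_quotient
    by (rule laurent_expansion_quotient[OF fa_fps fa_fps fa_fps nz nz])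
       (use assms in \<open>auto intro!: L_fps_fa L_exp_torsion torsion_add\<close>)
qed

end

section \<open>Analytic continuation by duplication\<close>

lemma holomorphic_on_openI:
  fixes f :: "complex \<Rightarrow> complex"
  assumes "open S" "\<And>z. z \<in> S \<Longrightarrow> (f has_field_derivative f' z) (at z)"
  shows "f holomorphic_on S"
  using assms unfolding holomorphic_on_open[OF assms(1)] by blast

lemma holomorphic_ball_nonzero:
  fixes f :: "complex \<Rightarrow> complex"
  assumes "f holomorphic_on X" "open X" "a \<in> X" "f a \<noteq> 0"
  obtains e where "e > 0" "\<And>z. z \<in> ball a e \<Longrightarrow> z \<in> X \<and> f z \<noteq> 0"
proof -
  have "open (X \<inter> f -` (- {0}))"
    using assms(1,2) by (intro continuous_open_preimage holomorphic_on_imp_continuous_on) auto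
  moreover have "a \<in> X \<inter> f -` (- {0})" using assms by simp
  ultimately obtain e where "e > 0" "ball a e \<subseteq> X \<inter> f -` (- {0})"
    using open_contains_ball by blast
  then show ?thesis using that[of e] by blast
qed

lemma fps_power_nth_cong:
  assumes "\<And>i. i \<le> n \<Longrightarrow> fps_nth F i = fps_nth G i"
  shows "fps_nth (F ^ k) n = fps_nth (G ^ k :: complex fps) n"
  using assms
proof (induction k arbitrary: n)
  case (Suc k)
  show ?case unfolding power_Suc fps_mult_nth
    by (rule sum.cong[OF refl]) (use Suc in auto)
qed simp

text \<open>The coefficient of degree m + 2 is determined by those of degree at most m. The shape of
  the right side covers the equations of u and of w = 1/u alike.\<close>

lemma fps_ode2_unique:
  fixes F G :: "complex fps"
  assumes F: "fps_deriv (fps_deriv F) = fps_const c0 + fps_const c2 * F ^ 2 + fps_const c3 * F ^ 3"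
    and G: "fps_deriv (fps_deriv G) = fps_const c0 + fps_const c2 * G ^ 2 + fps_const c3 * G ^ 3"
    and init: "fps_nth F 0 = fps_nth G 0" "fps_nth F 1 = fps_nth G 1"
  shows "F = G"
proof (rule fps_ext)
  fix n show "fps_nth F n = fps_nth G n"
  proof (induction n rule: less_induct)
    case (less n)
    consider "n = 0" | "n = 1" | m where "n = Suc (Suc m)" by (metis One_nat_def not0_implies_Suc)
    then show ?case
    proof cases
      case 3
      have "fps_nth (F ^ k) m = fps_nth (G ^ k) m" for k
        by (rule fps_power_nth_cong) (use less 3 in auto)
      then have "fps_nth (fps_deriv (fps_deriv F)) m = fps_nth (fps_deriv (fps_deriv G)) m"
        unfolding F G by simp
      then have "of_nat (Suc m) * (of_nat (Suc (Suc m)) * fps_nth F n) = of_nat (Suc m) * (of_nat (Suc (Suc m)) * fps_nth G n)"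
        unfolding 3 by (simp del: of_nat_Suc)
      then show ?thesis
        by (simp only: mult_cancel_left of_nat_eq_0_iff) simp
    qed (use init in auto)
  qed
qed

lemma ode2_unique:
  fixes f g :: "complex \<Rightarrow> complex"
  assumes X: "open X" "0 \<in> X"
    and f: "\<And>z. z \<in> X \<Longrightarrow> (f has_field_derivative f1 z) (at z)"
      "\<And>z. z \<in> X \<Longrightarrow> (f1 has_field_derivative c0 + c2 * f z ^ 2 + c3 * f z ^ 3) (at z)"
    and g: "\<And>z. z \<in> X \<Longrightarrow> (g has_field_derivative g1 z) (at z)"
      "\<And>z. z \<in> X \<Longrightarrow> (g1 has_field_derivative c0 + c2 * g z ^ 2 + c3 * g z ^ 3) (at z)"
    and init: "f 0 = g 0" "f1 0 = g1 0"
  shows "eventually (\<lambda>z. f z = g z) (nhds 0)"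
proof -
  have expand: "\<exists>F. h has_fps_expansion F \<and> fps_deriv (fps_deriv F) = fps_const c0 + fps_const c2 * F ^ 2 + fps_const c3 * F ^ 3
      \<and> fps_nth F 0 = h 0 \<and> fps_nth F 1 = h1 0"
    if h: "\<And>z. z \<in> X \<Longrightarrow> (h has_field_derivative h1 z) (at z)"
      "\<And>z. z \<in> X \<Longrightarrow> (h1 has_field_derivative c0 + c2 * h z ^ 2 + c3 * h z ^ 3) (at z)" for h h1
  proof -
    have "h holomorphic_on X" using h X(1) by (auto simp: holomorphic_on_open)
    then have F: "h has_fps_expansion fps_expansion h 0" (is "_ has_fps_expansion ?F")
      by (rule holomorphic_has_fps_expansion[OF _ X])
    note F1 = has_fps_expansion_derivI[OF F X h(1)]
    note F2 = has_fps_expansion_derivI[OF F1 X h(2)]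
    have "(\<lambda>z. c0 + c2 * h z ^ 2 + c3 * h z ^ 3) has_fps_expansion fps_const c0 + fps_const c2 * ?F ^ 2 + fps_const c3 * ?F ^ 3"
      by (intro fps_expansion_intros F)
    with F2 have "fps_deriv (fps_deriv ?F) = fps_const c0 + fps_const c2 * ?F ^ 2 + fps_const c3 * ?F ^ 3"
      by (rule fps_expansion_unique_complex)
    moreover have "fps_nth ?F 0 = h 0" using has_fps_expansion_imp_0_eq_fps_nth_0[OF F] by simp
    moreover have "fps_nth ?F 1 = h1 0" using has_fps_expansion_imp_0_eq_fps_nth_0[OF F1] by simp
    ultimately show ?thesis using F by blast
  qed
  obtain F where F: "f has_fps_expansion F" "fps_deriv (fps_deriv F) = fps_const c0 + fps_const c2 * F ^ 2 + fps_const c3 * F ^ 3"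
      "fps_nth F 0 = f 0" "fps_nth F 1 = f1 0" using expand[OF f] by blast
  obtain G where G: "g has_fps_expansion G" "fps_deriv (fps_deriv G) = fps_const c0 + fps_const c2 * G ^ 2 + fps_const c3 * G ^ 3"
      "fps_nth G 0 = g 0" "fps_nth G 1 = g1 0" using expand[OF g] by blast
  have "F = G" using fps_ode2_unique[OF F(2) G(2)] F(3,4) G(3,4) init by simp
  then have "eventually (\<lambda>z. eval_fps F z = f z) (nhds 0)" "eventually (\<lambda>z. eval_fps F z = g z) (nhds 0)"
    using F(1) G(1) by (auto simp: has_fps_expansion_def)
  then show ?thesis by eventually_elim simp
qed

text \<open>Differentiating f'^2 = H(f) gives f' (2 f'' - H'(f)) = 0; the point a, where f' is
  nonzero, and the identity theorem remove the factor f'.\<close>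

lemma ode1_imp_ode2:
  fixes f :: "complex \<Rightarrow> complex"
  assumes S: "open S" "connected S" "a \<in> S" and f: "f holomorphic_on S"
    and ode: "\<And>z. z \<in> S \<Longrightarrow> (deriv f z)\<^sup>2 = H (f z)"
    and H: "\<And>x. (H has_field_derivative H' x) (at x)" "H' holomorphic_on UNIV"
    and nz: "deriv f a \<noteq> 0" and z: "z \<in> S"
  shows "deriv (deriv f) z = H' (f z) / 2"
proof -
  have f1: "deriv f holomorphic_on S" using f S(1) by (rule holomorphic_deriv)
  have f2: "deriv (deriv f) holomorphic_on S" using f1 S(1) by (rule holomorphic_deriv)
  have H'f: "(\<lambda>z. H' (f z)) holomorphic_on S"
    using holomorphic_on_compose_gen[OF f H(2)] by (simp add: o_def)
  have key: "deriv f z * (2 * deriv (deriv f) z - H' (f z)) = 0" if "z \<in> S" for z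
  proof -
    have d1: "(f has_field_derivative deriv f z) (at z)" "(deriv f has_field_derivative deriv (deriv f) z) (at z)"
      using holomorphic_derivI[OF f S(1) that] holomorphic_derivI[OF f1 S(1) that] by auto
    have "((\<lambda>z. (deriv f z)\<^sup>2) has_field_derivative 2 * deriv f z * deriv (deriv f) z) (at z)"
      using d1 by (auto intro!: derivative_eq_intros)
    moreover have "((\<lambda>z. H (f z)) has_field_derivative H' (f z) * deriv f z) (at z)"
      using DERIV_chain2[OF H(1) d1(1)] .
    then have "((\<lambda>z. (deriv f z)\<^sup>2) has_field_derivative H' (f z) * deriv f z) (at z)"
      by (rule has_field_derivative_transform_within_open[OF _ S(1) that]) (use ode in auto)
    ultimately have "2 * deriv f z * deriv (deriv f) z = H' (f z) * deriv f z" by (rule DERIV_unique)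
    then show ?thesis by (simp add: algebra_simps)
  qed
  obtain e where e: "e > 0" "\<And>x. x \<in> ball a e \<Longrightarrow> x \<in> S \<and> deriv f x \<noteq> 0"
    by (rule holomorphic_ball_nonzero[OF f1 S(1,3) nz]) (rule that)
  have "2 * deriv (deriv f) z - H' (f z) = 0"
  proof (rule analytic_continuation_open[of "ball a e" S "\<lambda>z. 2 * deriv (deriv f) z - H' (f z)" "\<lambda>_. 0"])
    fix x assume "x \<in> ball a e"
    then have "x \<in> S" "deriv f x \<noteq> 0" using e by auto
    then show "2 * deriv (deriv f) x - H' (f x) = 0" using key by force
  qed (use e S z f2 H'f in \<open>auto intro!: holomorphic_intros\<close>)
  then show ?thesis by (simp add: eq_divide_eq mult.commute)
qed

text \<open>The equation for w degenerates at w = 0. With w = S^2 it becomes S' = Q(S), where Q(s)^2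
  = 1 - g2/4 s^4 - g3/4 s^6, and S is the local inverse of the elliptic integral of 1/Q.\<close>

lemma weierstrass_local_solution:
  fixes g2 g3 :: complex
  obtains r w where "r > 0" "w holomorphic_on ball 0 r" "w 0 = 0"
    "\<And>z. z \<in> ball 0 r \<Longrightarrow> (deriv w z)\<^sup>2 = 4 * w z - g2 * w z ^ 3 - g3 * w z ^ 4"
    "\<And>z. z \<in> ball 0 r \<Longrightarrow> z \<noteq> 0 \<Longrightarrow> w z \<noteq> 0"
proof -
  define q where "q = (\<lambda>s. 1 - g2 / 4 * s ^ 4 - g3 / 4 * s ^ 6)"
  have "isCont q 0" unfolding q_def by (intro continuous_intros)
  \<comment> \<open>The radius keeps q in the right half-plane, where the principal square root is
    holomorphic.\<close>
  then obtain \<rho> where \<rho>: "\<rho> > 0" "\<And>s. norm s < \<rho> \<Longrightarrow> dist (q s) (q 0) < 1"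
    unfolding continuous_at_eps_delta by (metis dist_norm diff_zero zero_less_one)
  have q0: "q 0 = 1" by (simp add: q_def)
  have Re: "Re (q s) > 0" if "s \<in> ball 0 \<rho>" for s
  proof -
    have "norm (q s - 1) < 1" using \<rho>(2)[of s] that by (simp add: q0 dist_norm)
    then have "\<bar>Re (q s - 1)\<bar> < 1" using abs_Re_le_cmod order_le_less_trans by blast
    then show ?thesis by simp
  qed
  define Q where "Q = (\<lambda>s. csqrt (q s))"
  have Qh: "Q holomorphic_on ball 0 \<rho>"
    unfolding Q_def
  proof (rule holomorphic_on_csqrt')
    show "q holomorphic_on ball 0 \<rho>" unfolding q_def by (intro holomorphic_intros) auto
    show "q s \<notin> \<real>\<^sub>\<le>\<^sub>0" if "s \<in> ball 0 \<rho>" for s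
      using Re[OF that] by (auto simp: complex_nonpos_Reals_iff)
  qed
  have Qnz: "Q s \<noteq> 0" if "s \<in> ball 0 \<rho>" for s using Re[OF that] by (auto simp: Q_def)
  have "(\<lambda>s. 1 / Q s) holomorphic_on ball 0 \<rho>" using Qh Qnz by (intro holomorphic_intros) auto
  then obtain Z0 where Z0: "\<And>s. s \<in> ball 0 \<rho> \<Longrightarrow> (Z0 has_field_derivative 1 / Q s) (at s within ball 0 \<rho>)"
    using holomorphic_convex_primitive'[of "ball 0 \<rho>" "\<lambda>s. 1 / Q s"] by auto
  define Z where "Z = (\<lambda>s. Z0 s - Z0 0)"
  have DZ: "(Z has_field_derivative 1 / Q s) (at s)" if "s \<in> ball 0 \<rho>" for s
  proof -
    have "(Z0 has_field_derivative 1 / Q s) (at s)"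
      using Z0[OF that] that at_within_open[OF that] by simp
    then show ?thesis unfolding Z_def by (auto intro!: derivative_eq_intros)
  qed
  have Zh: "Z holomorphic_on ball 0 \<rho>" using DZ by (rule holomorphic_on_openI[OF open_ball])
  have z0: "(0::complex) \<in> ball 0 \<rho>" using \<rho> by simp
  then have dZ0: "deriv Z 0 \<noteq> 0" using DERIV_imp_deriv[OF DZ] Qnz by simp
  obtain R where R: "R > 0" "ball (0::complex) R \<subseteq> ball 0 \<rho>" "open (Z ` ball 0 R)" "inj_on Z (ball 0 R)"
    by (rule has_complex_derivative_locally_invertible[OF Zh z0 open_ball dZ0])
  have ZhR: "Z holomorphic_on ball 0 R" using Zh R(2) holomorphic_on_subset by blast
  have "\<exists>S. S holomorphic_on (Z ` ball 0 R) \<and> (\<forall>s\<in>ball 0 R. deriv Z s * deriv S (Z s) = 1) \<and> (\<forall>s\<in>ball 0 R. S (Z s) = s)"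
    by (rule holomorphic_has_inverse[OF ZhR open_ball R(4)]) blast
  then obtain S where S: "S holomorphic_on (Z ` ball 0 R)" "\<And>s. s \<in> ball 0 R \<Longrightarrow> deriv Z s * deriv S (Z s) = 1"
      "\<And>s. s \<in> ball 0 R \<Longrightarrow> S (Z s) = s"
    by blast
  have "0 \<in> Z ` ball 0 R" using R(1) by (auto simp: Z_def intro!: image_eqI[of _ _ 0])
  then obtain r where r: "r > 0" "ball 0 r \<subseteq> Z ` ball 0 R" using R(3) open_contains_ball by blast
  have inv: "S z \<in> ball 0 R" "Z (S z) = z" if "z \<in> ball 0 r" for z
    using r(2) that S(3) by force+
  have DS: "(S has_field_derivative Q (S z)) (at z)" if z: "z \<in> ball 0 r" for z
  proof -
    have "z \<in> Z ` ball 0 R" using r z by blast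
    then have "(S has_field_derivative deriv S z) (at z)" using holomorphic_derivI[OF S(1) R(3)] by blast
    moreover have "deriv S z = Q (S z)"
    proof -
      have Sz: "S z \<in> ball 0 \<rho>" using inv(1)[OF z] R(2) by blast
      have "1 / Q (S z) * deriv S z = 1" using S(2)[OF inv(1)[OF z]] inv(2)[OF z] DERIV_imp_deriv[OF DZ[OF Sz]] by simp
      then show ?thesis using Qnz[OF Sz] by (simp add: field_simps)
    qed
    ultimately show ?thesis by simp
  qed
  have S0: "S 0 = 0" using S(3)[of 0] R(1) by (simp add: Z_def)
  define w where "w = (\<lambda>z. (S z)\<^sup>2)"
  have Dw: "(w has_field_derivative 2 * S z * Q (S z)) (at z)" if "z \<in> ball 0 r" for z
    unfolding w_def using DS[OF that] by (auto intro!: derivative_eq_intros)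
  show ?thesis
  proof (rule that[of r w])
    show "w holomorphic_on ball 0 r" using Dw by (rule holomorphic_on_openI[OF open_ball])
    show "w 0 = 0" by (simp add: w_def S0)
    show "(deriv w z)\<^sup>2 = 4 * w z - g2 * w z ^ 3 - g3 * w z ^ 4" if "z \<in> ball 0 r" for z
    proof -
      have "(deriv w z)\<^sup>2 = 4 * (S z)\<^sup>2 * (Q (S z))\<^sup>2" unfolding DERIV_imp_deriv[OF Dw[OF that]] by (simp add: power_mult_distrib)
      also have "(Q (S z))\<^sup>2 = q (S z)" by (simp add: Q_def)
      finally show ?thesis by (simp add: q_def w_def algebra_simps flip: power_mult power_add)
    qed
    show "w z \<noteq> 0" if "z \<in> ball 0 r" "z \<noteq> 0" for z
    proof
      assume "w z = 0"
      then have "S z = 0" by (simp add: w_def)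
      then have "z = Z 0" using inv(2)[OF that(1)] by simp
      then show False using that(2) by (simp add: Z_def)
    qed
  qed (rule r(1))
qed

text \<open>Duplication of the coordinate \<open>x = a/b\<close> on \<open>y\<^sup>2 = 4 x\<^sup>3 - g\<^sub>2 x - g\<^sub>3\<close>, in homogeneous coordinates \<open>(a, b)\<close>.\<close>

definition dup :: "complex \<Rightarrow> complex \<Rightarrow> complex \<times> complex \<Rightarrow> complex \<times> complex" where
  "dup g2 g3 = (\<lambda>(a, b). (a ^ 4 + g2 / 2 * a\<^sup>2 * b\<^sup>2 + 2 * g3 * a * b ^ 3 + g2\<^sup>2 / 16 * b ^ 4,
     b * (4 * a ^ 3 - g2 * a * b\<^sup>2 - g3 * b ^ 3)))"

text \<open>Equality of points of the projective line. The pair (0, 0) is related to everything,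
  hence the nonvanishing hypotheses in the lemmas on it.\<close>

definition proj_eq :: "complex \<times> complex \<Rightarrow> complex \<times> complex \<Rightarrow> bool" where
  "proj_eq p q \<longleftrightarrow> fst p * snd q = fst q * snd p"

lemma proj_eq_scale:
  assumes "proj_eq p q" "p \<noteq> (0, 0)" "q \<noteq> (0, 0)"
  obtains c where "c \<noteq> 0" "fst p = c * fst q" "snd p = c * snd q"
proof (cases "fst q = 0")
  case False
  then have "fst p \<noteq> 0" using assms by (auto simp: proj_eq_def prod_eq_iff)
  then show ?thesis using False assms(1) that[of "fst p / fst q"] by (simp add: proj_eq_def field_simps)
next
  case True
  then have q: "snd q \<noteq> 0" using assms(3) by (auto simp: prod_eq_iff)
  then have "fst p = 0" using assms(1) True by (simp add: proj_eq_def)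
  then show ?thesis using True q assms(2) that[of "snd p / snd q"] by (auto simp: prod_eq_iff)
qed

lemma proj_eq_trans:
  assumes "proj_eq p q" "proj_eq q r" "q \<noteq> (0, 0)"
  shows "proj_eq p r"
proof (cases "fst q = 0")
  case True
  then have "snd q \<noteq> 0" using assms(3) by (auto simp: prod_eq_iff)
  then show ?thesis using True assms(1,2) by (auto simp: proj_eq_def)
next
  case False
  have "fst q * (fst p * snd r) = fst q * (fst r * snd p)"
  proof -
    have "fst q * (fst p * snd r) = fst p * (fst q * snd r)" by (simp only: mult_ac)
    also have "\<dots> = fst r * (fst p * snd q)" using assms(2) by (simp add: proj_eq_def)
    also have "\<dots> = fst q * (fst r * snd p)" using assms(1) by (simp add: proj_eq_def)
    finally show ?thesis .
  qed
  then show ?thesis using False by (simp add: proj_eq_def)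
qed

lemma proj_eq_sym: "proj_eq p q \<Longrightarrow> proj_eq q p"
  by (simp add: proj_eq_def)

lemma dup_scale: "dup g2 g3 (c * a, c * b) = (c ^ 4 * fst (dup g2 g3 (a, b)), c ^ 4 * snd (dup g2 g3 (a, b)))"
  by (simp add: dup_def power_mult_distrib algebra_simps) (simp add: power2_eq_square power3_eq_cube power4_eq_xxxx)

lemma dup_proj_eq:
  assumes "proj_eq p q" "p \<noteq> (0, 0)" "q \<noteq> (0, 0)"
  shows "proj_eq (dup g2 g3 p) (dup g2 g3 q)"
proof -
  obtain c where "c \<noteq> 0" "fst p = c * fst q" "snd p = c * snd q" using proj_eq_scale[OF assms] .
  then have "p = (c * fst q, c * snd q)" by (simp add: prod_eq_iff)
  then show ?thesis using dup_scale[of g2 g3 c "fst q" "snd q"] by (simp add: proj_eq_def)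
qed

lemma cubic_no_common_root:
  fixes g2 g3 x :: complex
  assumes "4 * x ^ 3 - g2 * x - g3 = 0" "12 * x\<^sup>2 - g2 = 0"
  shows "g2 ^ 3 = 27 * g3\<^sup>2"
proof -
  have g2: "g2 = 12 * x\<^sup>2" using assms(2) by simp
  have "g3 = 4 * x ^ 3 - g2 * x" using assms(1) by simp
  then have g3: "g3 = - 8 * x ^ 3" unfolding g2 by (simp add: power2_eq_square power3_eq_cube)
  show ?thesis unfolding g2 g3 by (simp add: power_mult_distrib flip: power_mult)
qed

text \<open>If both components vanish, then x = a/b is a root of the cubic and of the duplication
  numerator. These two express (12 x^2 - g2)^2, so x would be a double root, which the discriminant
  excludes.\<close>

lemma dup_nonzero:
  assumes disc: "g2 ^ 3 \<noteq> 27 * g3\<^sup>2" and p: "p \<noteq> (0, 0)"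
  shows "dup g2 g3 p \<noteq> (0, 0)"
proof
  obtain a b where ab: "p = (a, b)" by fastforce
  assume "dup g2 g3 p = (0, 0)"
  then have 1: "a ^ 4 + g2 / 2 * a\<^sup>2 * b\<^sup>2 + 2 * g3 * a * b ^ 3 + g2\<^sup>2 / 16 * b ^ 4 = 0"
    and 2: "b * (4 * a ^ 3 - g2 * a * b\<^sup>2 - g3 * b ^ 3) = 0" by (auto simp: dup_def ab)
  have b: "b \<noteq> 0" using 1 p by (auto simp: ab)
  define x where "x = a / b"
  have a: "a = x * b" using b by (simp add: x_def)
  have "b ^ 4 * (4 * x ^ 3 - g2 * x - g3) = 0"
    using 2 unfolding a by (simp add: power_mult_distrib algebra_simps power2_eq_square power3_eq_cube power4_eq_xxxx)
  then have f: "4 * x ^ 3 - g2 * x - g3 = 0" using b by simp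
  have "b ^ 4 * (x ^ 4 + g2 / 2 * x\<^sup>2 + 2 * g3 * x + g2\<^sup>2 / 16) = 0"
    using 1 unfolding a by (simp add: power_mult_distrib algebra_simps power2_eq_square power3_eq_cube power4_eq_xxxx)
  then have n: "x ^ 4 + g2 / 2 * x\<^sup>2 + 2 * g3 * x + g2\<^sup>2 / 16 = 0" using b by simp
  have "(12 * x\<^sup>2 - g2)\<^sup>2 = 16 * (x ^ 4 + g2 / 2 * x\<^sup>2 + 2 * g3 * x + g2\<^sup>2 / 16) + 32 * x * (4 * x ^ 3 - g2 * x - g3)"
    by (simp add: algebra_simps power2_eq_square power3_eq_cube power4_eq_xxxx)
  then have "12 * x\<^sup>2 - g2 = 0" unfolding n f by simp
  then show False using cubic_no_common_root[OF f] disc by blast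
qed

text \<open>In the coordinate x = 1/u duplication is n/m, and this identity makes n/m at w(z/2)
  satisfy the differential equation of w again. Writing g2 x^2 and g3 x^3 through p and f reduces it
  to a polynomial identity in p and f.\<close>

lemma dup_ode_identity:
  fixes g2 g3 x :: complex
  defines "n \<equiv> 4 * x - g2 * x ^ 3 - g3 * x ^ 4" and "m \<equiv> 1 + g2 / 2 * x\<^sup>2 + 2 * g3 * x ^ 3 + g2\<^sup>2 / 16 * x ^ 4"
  shows "((4 - 3 * g2 * x\<^sup>2 - 4 * g3 * x ^ 3) * m - n * (g2 * x + 6 * g3 * x\<^sup>2 + g2\<^sup>2 / 4 * x ^ 3))\<^sup>2
     = 4 * (4 * m ^ 3 - g2 * n\<^sup>2 * m - g3 * n ^ 3)"
proof -
  define p where "p = 12 - g2 * x\<^sup>2"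
  define f where "f = 4 - g2 * x\<^sup>2 - g3 * x ^ 3"
  have e1: "g2 * x\<^sup>2 = 12 - p" and e2: "g3 * x ^ 3 = p - 8 - f" by (simp_all add: p_def f_def)
  have e3: "g2\<^sup>2 * x ^ 4 = (12 - p)\<^sup>2" unfolding e1[symmetric] by (simp add: power_mult_distrib flip: power_mult)
  have n: "n = x * f" by (simp add: n_def f_def algebra_simps power2_eq_square power3_eq_cube power4_eq_xxxx)
  have "m = 1 + (12 - p) / 2 + 2 * (p - 8 - f) + (12 - p)\<^sup>2 / 16"
    unfolding e1[symmetric] e2[symmetric] e3[unfolded e1[symmetric], symmetric] by (simp add: m_def)
  also have "\<dots> = p\<^sup>2 / 16 - 2 * f" by (simp add: power2_eq_square field_simps)
  finally have m: "m = p\<^sup>2 / 16 - 2 * f" .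
  have n': "4 - 3 * g2 * x\<^sup>2 - 4 * g3 * x ^ 3 = 4 * f - p"
    by (simp add: p_def f_def algebra_simps)
  have "x * (g2 * x + 6 * g3 * x\<^sup>2 + g2\<^sup>2 / 4 * x ^ 3) = g2 * x\<^sup>2 + 6 * (g3 * x ^ 3) + (g2\<^sup>2 * x ^ 4) / 4"
    by (simp add: field_simps power2_eq_square power3_eq_cube power4_eq_xxxx)
  also have "\<dots> = p\<^sup>2 / 4 - p - 6 * f" unfolding e1 e2 e3 by (simp add: power2_eq_square field_simps)
  finally have nm': "n * (g2 * x + 6 * g3 * x\<^sup>2 + g2\<^sup>2 / 4 * x ^ 3) = f * (p\<^sup>2 / 4 - p - 6 * f)"
    unfolding n by (simp add: mult_ac)
  have r1: "g2 * n\<^sup>2 = (12 - p) * f\<^sup>2" unfolding n e1[symmetric] by (simp add: power_mult_distrib mult_ac)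
  have r2: "g3 * n ^ 3 = (p - 8 - f) * f ^ 3" unfolding n e2[symmetric] by (simp add: power_mult_distrib mult_ac)
  show ?thesis unfolding n' nm' r1 r2 m
    by (simp add: power2_eq_square power3_eq_cube field_simps)
qed

lemma quotient_rule_factor:
  fixes a b d m n :: complex
  shows "(a * d * m - n * (b * d)) / (m * m) = (a * m - n * b) / m\<^sup>2 * d"
  by (simp add: power2_eq_square algebra_simps)

text \<open>Here \<open>w = 1/u\<close> for the solution \<open>u\<close> of \<open>u'\<^sup>2 = 4 u\<^sup>3 - g\<^sub>2 u - g\<^sub>3\<close> with a double pole at \<open>0\<close>.\<close>

locale weierstrass_germ =
  fixes g2 g3 :: complex and r :: real and w :: "complex \<Rightarrow> complex"
  assumes disc: "g2 ^ 3 \<noteq> 27 * g3\<^sup>2" and r: "r > 0"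
    and w_hol: "w holomorphic_on ball 0 r" and w0: "w 0 = 0"
    and w_ode: "\<And>z. z \<in> ball 0 r \<Longrightarrow> (deriv w z)\<^sup>2 = 4 * w z - g2 * w z ^ 3 - g3 * w z ^ 4"
    and w_nz: "\<And>z. z \<in> ball 0 r \<Longrightarrow> z \<noteq> 0 \<Longrightarrow> w z \<noteq> 0"
begin

lemma ex_deriv_nonzero:
  assumes "h holomorphic_on ball 0 \<rho>" "a \<in> ball 0 \<rho>" "h a \<noteq> h 0"
  obtains b where "b \<in> ball 0 \<rho>" "deriv h b \<noteq> 0"
proof (rule ccontr)
  assume "\<not> thesis"
  then have "\<And>b. b \<in> ball 0 \<rho> \<Longrightarrow> (h has_field_derivative 0) (at b)"
    using that holomorphic_derivI[OF assms(1) open_ball] by metis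
  then have "\<exists>c. \<forall>x\<in>ball 0 \<rho>. h x = c"
    by (intro has_field_derivative_zero_constant) (auto intro: has_field_derivative_at_within)
  moreover have "0 \<in> ball 0 \<rho>" using assms(2) by (auto intro: order_le_less_trans[OF norm_ge_zero])
  ultimately have "h a = h 0" using assms(2) by metis
  then show False using assms(3) by simp
qed

lemma w_ode2: "z \<in> ball 0 r \<Longrightarrow> deriv (deriv w) z = 2 - 3 / 2 * g2 * w z ^ 2 - 2 * g3 * w z ^ 3"
proof -
  assume z: "z \<in> ball 0 r"
  have "of_real (r / 2) \<in> ball (0::complex) r" "(of_real (r / 2) :: complex) \<noteq> 0" using r by auto
  then obtain b where b: "b \<in> ball 0 r" "deriv w b \<noteq> 0"
    using ex_deriv_nonzero[OF w_hol, of "of_real (r / 2)"] w_nz w0 by metis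
  have "deriv (deriv w) z = (4 - 3 * g2 * w z ^ 2 - 4 * g3 * w z ^ 3) / 2"
    by (rule ode1_imp_ode2[where H = "\<lambda>x. 4 * x - g2 * x ^ 3 - g3 * x ^ 4" and H' = "\<lambda>x. 4 - 3 * g2 * x ^ 2 - 4 * g3 * x ^ 3", OF open_ball _ b(1) w_hol w_ode _ _ b(2) z])
       (auto intro!: derivative_eq_intros holomorphic_intros)
  then show ?thesis by (simp add: field_simps)
qed

lemma Dw: "z \<in> ball 0 r \<Longrightarrow> (w has_field_derivative deriv w z) (at z)"
  by (rule holomorphic_derivI[OF w_hol open_ball])

lemma w1_hol: "deriv w holomorphic_on ball 0 r"
  by (rule holomorphic_deriv[OF w_hol open_ball])

lemma Dw1: "z \<in> ball 0 r \<Longrightarrow> (deriv w has_field_derivative 2 + (- 3 / 2 * g2) * w z ^ 2 + (- 2 * g3) * w z ^ 3) (at z)"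
  using holomorphic_derivI[OF w1_hol open_ball, of z UNIV] w_ode2[of z] by simp

lemma w1_0: "deriv w 0 = 0"
  using w_ode[of 0] r w0 by simp

lemma germ_unique:
  assumes \<rho>: "0 < \<rho>"
    and v: "\<And>z. z \<in> ball 0 \<rho> \<Longrightarrow> (v has_field_derivative v1 z) (at z)"
      "\<And>z. z \<in> ball 0 \<rho> \<Longrightarrow> (v1 has_field_derivative 2 + (- 3 / 2 * g2) * v z ^ 2 + (- 2 * g3) * v z ^ 3) (at z)"
    and init: "v 0 = 0" "v1 0 = 0"
  shows "eventually (\<lambda>z. v z = w z) (nhds 0)"
proof (rule ode2_unique[of "ball 0 (min \<rho> r)" v v1 2 "- 3 / 2 * g2" "- 2 * g3" w "deriv w"])
  fix z assume "z \<in> ball (0::complex) (min \<rho> r)"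
  then have z: "z \<in> ball 0 \<rho>" "z \<in> ball 0 r" by auto
  show "(v has_field_derivative v1 z) (at z)" by (rule v(1)[OF z(1)])
  show "(v1 has_field_derivative 2 + (- 3 / 2 * g2) * v z ^ 2 + (- 2 * g3) * v z ^ 3) (at z)" by (rule v(2)[OF z(1)])
  show "(w has_field_derivative deriv w z) (at z)" by (rule Dw[OF z(2)])
  show "(deriv w has_field_derivative 2 + (- 3 / 2 * g2) * w z ^ 2 + (- 2 * g3) * w z ^ 3) (at z)" by (rule Dw1[OF z(2)])
qed (use \<rho> r init w0 w1_0 in simp_all)

text \<open>The first-order equation also has the solution 0; a point where v is nonzero excludes it
  and allows the passage to the second-order equation, whose initial data at 0 are forced.\<close>

lemma germ_unique1:
  assumes \<rho>: "0 < \<rho>" and v: "v holomorphic_on ball 0 \<rho>"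
    and ode: "\<And>z. z \<in> ball 0 \<rho> \<Longrightarrow> (deriv v z)\<^sup>2 = 4 * v z - g2 * v z ^ 3 - g3 * v z ^ 4"
    and v0: "v 0 = 0" and b: "b \<in> ball 0 \<rho>" "v b \<noteq> 0"
  shows "eventually (\<lambda>z. v z = w z) (nhds 0)"
proof (rule germ_unique[OF \<rho>, of v "deriv v"])
  show "(v has_field_derivative deriv v z) (at z)" if "z \<in> ball 0 \<rho>" for z
    using holomorphic_derivI[OF v open_ball that] .
  obtain c where c: "c \<in> ball 0 \<rho>" "deriv v c \<noteq> 0"
    using ex_deriv_nonzero[OF v b(1)] b(2) v0 by metis
  show "(deriv v has_field_derivative 2 + (- 3 / 2 * g2) * v z ^ 2 + (- 2 * g3) * v z ^ 3) (at z)" if z: "z \<in> ball 0 \<rho>" for z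
  proof -
    have "deriv (deriv v) z = (4 - 3 * g2 * v z ^ 2 - 4 * g3 * v z ^ 3) / 2"
      by (rule ode1_imp_ode2[where H = "\<lambda>x. 4 * x - g2 * x ^ 3 - g3 * x ^ 4" and H' = "\<lambda>x. 4 - 3 * g2 * x ^ 2 - 4 * g3 * x ^ 3", OF open_ball _ c(1) v ode _ _ c(2) z])
         (auto intro!: derivative_eq_intros holomorphic_intros)
    also have "\<dots> = 2 + (- 3 / 2 * g2) * v z ^ 2 + (- 2 * g3) * v z ^ 3" by (simp add: field_simps)
    finally show ?thesis
      using holomorphic_derivI[OF holomorphic_deriv[OF v open_ball] open_ball z, of UNIV] by simp
  qed
  show "v 0 = 0" by (rule v0)
  show "deriv v 0 = 0" using ode[of 0] \<rho> v0 by simp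
qed

lemma w_even: "z \<in> ball 0 r \<Longrightarrow> w (- z) = w z"
proof -
  assume z: "z \<in> ball 0 r"
  have hol: "(\<lambda>z. w (- z)) holomorphic_on ball 0 r"
  proof -
    have "uminus ` ball 0 r \<subseteq> ball (0::complex) r" by auto
    moreover have "uminus holomorphic_on ball (0::complex) r"
      using holomorphic_on_minus[OF holomorphic_on_ident] .
    ultimately show ?thesis
      using holomorphic_on_compose_gen[of uminus "ball 0 r" w "ball 0 r"] w_hol by (simp add: o_def)
  qed
  have d: "((\<lambda>z. w (- z)) has_field_derivative - deriv w (- z)) (at z)" if "z \<in> ball 0 r" for z
    using DERIV_chain2[of w _ uminus, OF Dw[of "- z"] DERIV_minus[OF DERIV_ident]] that by simp
  have d1: "((\<lambda>z. - deriv w (- z)) has_field_derivative 2 + (- 3 / 2 * g2) * w (- z) ^ 2 + (- 2 * g3) * w (- z) ^ 3) (at z)"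
    if "z \<in> ball 0 r" for z
    using DERIV_minus[OF DERIV_chain2[of "deriv w" _ uminus, OF Dw1[of "- z"] DERIV_minus[OF DERIV_ident]]] that by simp
  have "eventually (\<lambda>z. w (- z) = w z) (nhds 0)"
    by (rule germ_unique[OF r d d1]) (simp_all add: w0 w1_0)
  then obtain e where e: "e > 0" "\<And>z. norm z < e \<Longrightarrow> w (- z) = w z"
    unfolding eventually_nhds_metric by (auto simp: dist_norm)
  show ?thesis
    by (rule analytic_continuation_open[of "ball 0 (min e r)" "ball 0 r" "\<lambda>z. w (- z)" w])
       (use e r z hol w_hol in auto)
qed

text \<open>Duplication in the coordinate x = 1/u is \<open>dn\<close>/\<open>dm\<close>; moreover
  \<open>dn\<close> is the right side of the differential equation of w.\<close>

definition dn :: "complex \<Rightarrow> complex" where "dn x = 4 * x - g2 * x ^ 3 - g3 * x ^ 4"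
definition dm :: "complex \<Rightarrow> complex" where "dm x = 1 + g2 / 2 * x\<^sup>2 + 2 * g3 * x ^ 3 + g2\<^sup>2 / 16 * x ^ 4"

lemma dup_1: "dup g2 g3 (1, x) = (dm x, dn x)"
  by (simp add: dup_def dm_def dn_def algebra_simps power2_eq_square power3_eq_cube power4_eq_xxxx)

text \<open>dn/dm at w(z/2) solves the equation of w by \<open>dup_ode_identity\<close>, vanishes at
  0 and is not identically 0, so it is w near 0. The cross-multiplied form continues past zeros of
  \<open>dm\<close>.\<close>

lemma w_dup: 
  assumes z: "z \<in> ball 0 (r / 2)"
  shows "w (2 * z) * dm (w z) = dn (w z)"
proof -
  have D: "(dn has_field_derivative 4 - 3 * g2 * x\<^sup>2 - 4 * g3 * x ^ 3) (at x)"
    "(dm has_field_derivative g2 * x + 6 * g3 * x\<^sup>2 + g2\<^sup>2 / 4 * x ^ 3) (at x)" for x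
    unfolding dn_def[abs_def] dm_def[abs_def] by (auto intro!: derivative_eq_intros)
  have dmw: "(\<lambda>z. dm (w z)) holomorphic_on ball 0 r" and dnw: "(\<lambda>z. dn (w z)) holomorphic_on ball 0 r"
    unfolding dm_def dn_def using w_hol by (auto intro!: holomorphic_intros)
  have "0 \<in> ball (0::complex) r" "dm (w 0) \<noteq> 0" using r by (simp_all add: dm_def w0)
  then obtain e where e0: "e > 0" "\<And>z. z \<in> ball 0 e \<Longrightarrow> z \<in> ball 0 r \<and> dm (w z) \<noteq> 0"
    using holomorphic_ball_nonzero[OF dmw open_ball] by metis
  then have e: "e > 0" "\<And>z. norm z < e \<Longrightarrow> dm (w z) \<noteq> 0" by auto
  define \<rho> where "\<rho> = min e r"
  have \<rho>: "\<rho> > 0" "\<rho> \<le> r" "\<rho> \<le> e" using e r by (auto simp: \<rho>_def)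
  define v where "v = (\<lambda>z. dn (w (z / 2)) / dm (w (z / 2)))"
  have half: "z / 2 \<in> ball 0 r" "norm (z / 2) < e" if "z \<in> ball 0 \<rho>" for z :: complex
  proof -
    have "norm (z / 2) \<le> norm z" by (simp add: norm_divide)
    then show "z / 2 \<in> ball 0 r" "norm (z / 2) < e" using that \<rho> by auto
  qed
  have Dv: "(v has_field_derivative
      ((4 - 3 * g2 * (w (z / 2))\<^sup>2 - 4 * g3 * w (z / 2) ^ 3) * dm (w (z / 2)) - dn (w (z / 2)) * (g2 * w (z / 2) + 6 * g3 * (w (z / 2))\<^sup>2 + g2\<^sup>2 / 4 * w (z / 2) ^ 3))
       / (dm (w (z / 2)))\<^sup>2 * (deriv w (z / 2) / 2)) (at z)" if z: "z \<in> ball 0 \<rho>" for z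
  proof -
    have "((\<lambda>z. z / 2) has_field_derivative 1 / 2) (at z)" by (auto intro!: derivative_eq_intros)
    from DERIV_chain2[of w _ "\<lambda>z. z / 2", OF Dw[OF half(1)[OF z]] this]
    have dw2: "((\<lambda>z. w (z / 2)) has_field_derivative deriv w (z / 2) / 2) (at z)" by simp
    show ?thesis unfolding v_def
      by (rule DERIV_cong[OF DERIV_divide[OF DERIV_chain2[OF D(1) dw2] DERIV_chain2[OF D(2) dw2] e(2)[OF half(2)[OF z]]]])
         (rule quotient_rule_factor)
  qed
  have vh: "v holomorphic_on ball 0 \<rho>" by (rule holomorphic_on_openI[OF open_ball Dv])
  have vode: "(deriv v z)\<^sup>2 = 4 * v z - g2 * v z ^ 3 - g3 * v z ^ 4" if z: "z \<in> ball 0 \<rho>" for z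
  proof -
    define x where "x = w (z / 2)"
    define n where "n = dn x" define m where "m = dm x"
    have mnz: "m \<noteq> 0" using e(2)[OF half(2)[OF z]] by (simp add: m_def x_def)
    have vz: "v z = n / m" by (simp add: v_def n_def m_def x_def)
    have w2: "(deriv w (z / 2))\<^sup>2 = n" using w_ode[OF half(1)[OF z]] by (simp add: n_def dn_def x_def)
    have "(deriv v z)\<^sup>2 = 4 * (4 * m ^ 3 - g2 * n\<^sup>2 * m - g3 * n ^ 3) / (m\<^sup>2)\<^sup>2 * (n / 4)"
      unfolding DERIV_imp_deriv[OF Dv[OF z]] power_mult_distrib power_divide w2
      using dup_ode_identity[of g2 x g3] by (simp add: n_def m_def dn_def dm_def x_def[symmetric])
    also have "\<dots> = 4 * (n / m) - g2 * (n / m) ^ 3 - g3 * (n / m) ^ 4"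
      using mnz by (simp add: field_simps power2_eq_square power3_eq_cube power4_eq_xxxx)
    finally show ?thesis by (simp add: vz)
  qed
  have v0: "v 0 = 0" by (simp add: v_def w0 dn_def)
  \<comment> \<open>If v vanished, so would dn(w) = w'^2 near 0, and w would be constant
    there.\<close>
  have "\<exists>b\<in>ball 0 \<rho>. v b \<noteq> 0"
  proof (rule ccontr)
    assume "\<not> ?thesis"
    then have all0: "v z = 0" if "z \<in> ball 0 \<rho>" for z using that by blast
    have "dn (w z) = 0" if "z \<in> ball 0 (\<rho> / 2)" for z
    proof -
      have z2: "2 * z \<in> ball 0 \<rho>" using that by (simp add: norm_mult)
      show ?thesis using all0[OF z2] e(2)[of z] half(2)[OF z2] by (simp add: v_def)
    qed
    then have d0: "(deriv w z)\<^sup>2 = 0" if "z \<in> ball 0 (\<rho> / 2)" for z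
      using that w_ode[of z] \<rho> by (simp add: dn_def)
    have "w holomorphic_on ball 0 (\<rho> / 2)" using w_hol \<rho> by (auto elim!: holomorphic_on_subset)
    moreover have "of_real (\<rho> / 4) \<in> ball (0::complex) (\<rho> / 2)" using \<rho> by simp
    moreover have "w (of_real (\<rho> / 4)) \<noteq> w 0"
      using w_nz[of "of_real (\<rho> / 4)"] \<rho> by (simp add: w0)
    ultimately obtain b where "b \<in> ball 0 (\<rho> / 2)" "deriv w b \<noteq> 0" using ex_deriv_nonzero by metis
    then show False using d0 by simp
  qed
  then obtain b where b: "b \<in> ball 0 \<rho>" "v b \<noteq> 0" by blast
  have "eventually (\<lambda>z. v z = w z) (nhds 0)"
    by (rule germ_unique1[OF \<rho>(1) vh vode v0 b])
  then obtain d where d: "d > 0" "\<And>z. norm z < d \<Longrightarrow> v z = w z"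
    unfolding eventually_nhds_metric by (auto simp: dist_norm)
  have hol2: "(\<lambda>z. w (2 * z)) holomorphic_on ball 0 (r / 2)"
  proof -
    have "(\<lambda>z. 2 * z) ` ball 0 (r / 2) \<subseteq> ball (0::complex) r" by (auto simp: norm_mult)
    moreover have "(\<lambda>z. 2 * z) holomorphic_on ball (0::complex) (r / 2)" by (intro holomorphic_intros)
    ultimately show ?thesis
      using holomorphic_on_compose_gen[of "\<lambda>z. 2 * z" "ball 0 (r / 2)" w "ball 0 r"] w_hol
      by (simp add: o_def)
  qed
  show ?thesis
  proof (rule analytic_continuation_open[of "ball 0 (min d (min e r) / 2)" "ball 0 (r / 2)" "\<lambda>z. w (2 * z) * dm (w z)" "\<lambda>z. dn (w z)"])
    show "(\<lambda>z. w (2 * z) * dm (w z)) holomorphic_on ball 0 (r / 2)" "(\<lambda>z. dn (w z)) holomorphic_on ball 0 (r / 2)"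
      using hol2 dmw dnw r by (auto intro!: holomorphic_intros elim!: holomorphic_on_subset)
    fix z :: complex assume "z \<in> ball 0 (min d (min e r) / 2)"
    then have "norm (2 * z) < d" "norm z + norm z < e" by (auto simp: norm_mult)
    then have "norm (2 * z) < d" "norm z < e" using norm_ge_zero[of z] by linarith+
    then show "w (2 * z) * dm (w z) = dn (w z)" using d(2)[of "2 * z"] e(2)[of z] by (simp add: v_def field_simps)
  qed (use d e r z in auto)
qed

end

section \<open>Global continuation in homogeneous coordinates\<close>

context weierstrass_germ
begin

text \<open>Homogeneous coordinates of \<open>u\<close>, valid on the ball of radius \<open>2\<^sup>k r\<close>.\<close>

definition HH :: "nat \<Rightarrow> complex \<Rightarrow> complex \<times> complex" where
  "HH k z = (dup g2 g3 ^^ k) (1, w (z / 2 ^ k))"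

definition A :: "nat \<Rightarrow> complex \<Rightarrow> complex" where "A k z = fst (HH k z)"
definition B :: "nat \<Rightarrow> complex \<Rightarrow> complex" where "B k z = snd (HH k z)"

lemma HH_Suc: "HH (Suc k) z = dup g2 g3 (HH k (z / 2))"
  by (simp add: HH_def)

lemma HH_nz: "HH k z \<noteq> (0, 0)"
proof (induction k arbitrary: z)
  case (Suc k)
  then show ?case unfolding HH_Suc by (intro dup_nonzero disc)
qed (simp add: HH_def)

lemma AB_nz: "\<not> (A k z = 0 \<and> B k z = 0)"
  using HH_nz[of k z] by (auto simp: A_def B_def prod_eq_iff)

lemma AB_Suc:
  "A (Suc k) z = A k (z / 2) ^ 4 + g2 / 2 * (A k (z / 2))\<^sup>2 * (B k (z / 2))\<^sup>2 + 2 * g3 * A k (z / 2) * B k (z / 2) ^ 3 + g2\<^sup>2 / 16 * B k (z / 2) ^ 4"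
  "B (Suc k) z = B k (z / 2) * (4 * A k (z / 2) ^ 3 - g2 * A k (z / 2) * (B k (z / 2))\<^sup>2 - g3 * B k (z / 2) ^ 3)"
  by (simp_all add: A_def B_def HH_Suc dup_def case_prod_unfold)

lemma half_ball: "(\<lambda>z. z / 2) ` ball 0 (2 * R) \<subseteq> ball (0::complex) R"
  by (auto simp: norm_divide)

lemma AB_hol: "A k holomorphic_on ball 0 (2 ^ k * r)" "B k holomorphic_on ball 0 (2 ^ k * r)"
proof (induction k)
  case 0
  have "A 0 = (\<lambda>z. 1)" "B 0 = w" by (auto simp: A_def B_def HH_def fun_eq_iff)
  then show "A 0 holomorphic_on ball 0 (2 ^ 0 * r)" "B 0 holomorphic_on ball 0 (2 ^ 0 * r)"
    using w_hol by (auto intro!: holomorphic_intros)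
next
  case (Suc k)
  have h: "(\<lambda>z. f (z / 2)) holomorphic_on ball 0 (2 ^ Suc k * r)" if "f holomorphic_on ball 0 (2 ^ k * r)" for f :: "complex \<Rightarrow> complex"
  proof -
    have "(\<lambda>z. z / 2) holomorphic_on ball (0::complex) (2 ^ Suc k * r)" by (intro holomorphic_intros) auto
    from holomorphic_on_compose_gen[OF this that] half_ball[of "2 ^ k * r"] show ?thesis by (simp add: o_def mult.assoc)
  qed
  note hA = h[OF Suc(1)] and hB = h[OF Suc(2)]
  show "A (Suc k) holomorphic_on ball 0 (2 ^ Suc k * r)" "B (Suc k) holomorphic_on ball 0 (2 ^ Suc k * r)"
    unfolding AB_Suc[abs_def] by (intro holomorphic_intros hA hB)+
qed

text \<open>\<open>w_dup\<close> is the case k = 0; thereafter each level is the duplication of the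
  previous one at z/2.\<close>

lemma HH_proj_Suc: "norm z < 2 ^ k * r \<Longrightarrow> proj_eq (HH (Suc k) z) (HH k z)"
proof (induction k arbitrary: z)
  case 0
  then have "z / 2 \<in> ball 0 (r / 2)" by (simp add: norm_divide)
  from w_dup[OF this] show ?case
    by (simp add: HH_def dup_1 proj_eq_def mult.commute)
next
  case (Suc k)
  have "norm (z / 2) < 2 ^ k * r" using Suc.prems by (simp add: norm_divide)
  then have "proj_eq (HH (Suc k) (z / 2)) (HH k (z / 2))" by (rule Suc.IH)
  then show ?case unfolding HH_Suc[of "Suc k" z] HH_Suc[of k z] by (intro dup_proj_eq HH_nz)
qed

lemma HH_proj: "k \<le> l \<Longrightarrow> norm z < 2 ^ k * r \<Longrightarrow> proj_eq (HH l z) (HH k z)"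
proof (induction l rule: dec_induct)
  case base
  then show ?case by (simp add: proj_eq_def)
next
  case (step l)
  have "2 ^ k * r \<le> 2 ^ l * r" using step.hyps r by (intro mult_right_mono power_increasing) auto
  then have "norm z < 2 ^ l * r" using step.prems by linarith
  then show ?case using proj_eq_trans[OF HH_proj_Suc step.IH HH_nz] step.prems by blast
qed

lemma B_eq_Aw:
  assumes "z \<in> ball 0 r" shows "B k z = A k z * w z" "A k z \<noteq> 0"
proof -
  have "proj_eq (HH k z) (HH 0 z)" using HH_proj[of 0 k z] assms by simp
  then show 1: "B k z = A k z * w z" by (simp add: proj_eq_def A_def B_def HH_def)
  show "A k z \<noteq> 0" using AB_nz[of k z] 1 by auto
qed

text \<open>The Wronskian, so that u' = W/B^2. As it is holomorphic at the poles of u, the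
  differential equations can be written polynomially, checked near 0 in terms of A and w, and
  continued to the whole ball.\<close>

definition W :: "nat \<Rightarrow> complex \<Rightarrow> complex" where
  "W k z = deriv (A k) z * B k z - A k z * deriv (B k) z"

lemma big_ball: "ball 0 r \<subseteq> ball (0::complex) (2 ^ k * r)"
proof -
  have "1 * r \<le> 2 ^ k * r" using r by (intro mult_right_mono) auto
  then show ?thesis by (intro subset_ball) simp
qed

lemma deriv_AB_hol: "deriv (A k) holomorphic_on ball 0 (2 ^ k * r)" "deriv (B k) holomorphic_on ball 0 (2 ^ k * r)"
  by (intro holomorphic_deriv AB_hol open_ball)+

lemma W_hol: "W k holomorphic_on ball 0 (2 ^ k * r)"
  unfolding W_def[abs_def] by (intro holomorphic_intros AB_hol deriv_AB_hol)

lemma deriv_W_hol: "deriv (W k) holomorphic_on ball 0 (2 ^ k * r)"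
  by (intro holomorphic_deriv W_hol open_ball)

lemma D_AB:
  assumes "z \<in> ball 0 (2 ^ k * r)"
  shows "(A k has_field_derivative deriv (A k) z) (at z)" "(B k has_field_derivative deriv (B k) z) (at z)"
    "(W k has_field_derivative deriv (W k) z) (at z)"
  using holomorphic_derivI[OF _ open_ball assms] AB_hol W_hol by auto

lemma W_local:
  assumes z: "z \<in> ball 0 r"
  shows "W k z = - ((A k z)\<^sup>2 * deriv w z)" "deriv (B k) z = deriv (A k) z * w z + A k z * deriv w z"
    "deriv (W k) z = - (2 * A k z * deriv (A k) z * deriv w z + (A k z)\<^sup>2 * (2 - 3 / 2 * g2 * w z ^ 2 - 2 * g3 * w z ^ 3))"
proof -
  have W1: "W k z = - ((A k z)\<^sup>2 * deriv w z) \<and> deriv (B k) z = deriv (A k) z * w z + A k z * deriv w z" if z: "z \<in> ball 0 r" for z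
  proof -
    have zb: "z \<in> ball 0 (2 ^ k * r)" using z big_ball by blast
    have "((\<lambda>z. A k z * w z) has_field_derivative deriv (A k) z * w z + A k z * deriv w z) (at z)"
      by (rule DERIV_cong[OF DERIV_mult[OF D_AB(1)[OF zb] Dw[OF z]]]) (simp add: algebra_simps)
    then have "(B k has_field_derivative deriv (A k) z * w z + A k z * deriv w z) (at z)"
      by (rule has_field_derivative_transform_within_open[OF _ open_ball z]) (use B_eq_Aw in simp)
    then have dB: "deriv (B k) z = deriv (A k) z * w z + A k z * deriv w z" by (rule DERIV_imp_deriv)
    then show ?thesis using B_eq_Aw[OF z, of k] by (simp add: W_def algebra_simps power2_eq_square)
  qed
  then show "W k z = - ((A k z)\<^sup>2 * deriv w z)" "deriv (B k) z = deriv (A k) z * w z + A k z * deriv w z"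
    using z by blast+
  have zb: "z \<in> ball 0 (2 ^ k * r)" using z big_ball by blast
  define w2 where "w2 = 2 - 3 / 2 * g2 * w z ^ 2 - 2 * g3 * w z ^ 3"
  have "(deriv w has_field_derivative w2) (at z)" using Dw1[OF z] by (simp add: w2_def)
  then have "((\<lambda>z. - ((A k z)\<^sup>2 * deriv w z)) has_field_derivative
      - (2 * A k z * deriv (A k) z * deriv w z + (A k z)\<^sup>2 * w2)) (at z)"
    using D_AB(1)[OF zb] by (auto intro!: derivative_eq_intros simp: algebra_simps)
  then have "(W k has_field_derivative - (2 * A k z * deriv (A k) z * deriv w z + (A k z)\<^sup>2 * w2)) (at z)"
    by (rule has_field_derivative_transform_within_open[OF _ open_ball z]) (use W1 in auto)
  then show "deriv (W k) z = - (2 * A k z * deriv (A k) z * deriv w z + (A k z)\<^sup>2 * (2 - 3 / 2 * g2 * w z ^ 2 - 2 * g3 * w z ^ 3))"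
    unfolding w2_def by (rule DERIV_imp_deriv)
qed

lemma continue_identity:
  assumes "f holomorphic_on ball 0 (2 ^ k * r)" "g holomorphic_on ball 0 (2 ^ k * r)"
    and "\<And>z. z \<in> ball 0 r \<Longrightarrow> f z = g z" and "z \<in> ball 0 (2 ^ k * r)"
  shows "f z = g z"
  by (rule analytic_continuation_open[of "ball 0 r" "ball 0 (2 ^ k * r)" f g])
     (use assms r big_ball[of k] in auto)

lemma W_sq:
  assumes z: "z \<in> ball 0 (2 ^ k * r)"
  shows "(W k z)\<^sup>2 = 4 * A k z ^ 3 * B k z - g2 * A k z * B k z ^ 3 - g3 * B k z ^ 4"
proof (rule continue_identity[OF _ _ _ z])
  fix z :: complex assume z: "z \<in> ball 0 r"
  have "(W k z)\<^sup>2 = (A k z) ^ 4 * (4 * w z - g2 * w z ^ 3 - g3 * w z ^ 4)"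
    unfolding W_local(1)[OF z] w_ode[OF z, symmetric] by (simp add: power_mult_distrib flip: power_mult)
  then show "(W k z)\<^sup>2 = 4 * A k z ^ 3 * B k z - g2 * A k z * B k z ^ 3 - g3 * B k z ^ 4"
    unfolding B_eq_Aw(1)[OF z, of k] by (simp add: algebra_simps power2_eq_square power3_eq_cube power4_eq_xxxx)
qed (intro holomorphic_intros AB_hol W_hol)+

text \<open>Homogeneous form of u'' = 6 u^2 - g2/2, to be divided by a power of B away from the
  poles.\<close>

lemma W_deriv_B:
  assumes z: "z \<in> ball 0 (2 ^ k * r)"
  shows "2 * (deriv (W k) z * B k z - 2 * W k z * deriv (B k) z) = 12 * (A k z)\<^sup>2 * B k z - g2 * B k z ^ 3"
proof (rule continue_identity[OF _ _ _ z])
  fix z :: complex assume z: "z \<in> ball 0 r"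
  define a a' x x' where "a = A k z" and "a' = deriv (A k) z" and "x = w z" and "x' = deriv w z"
  have x2: "x' * x' = 4 * x - g2 * x ^ 3 - g3 * x ^ 4" using w_ode[OF z] by (simp add: x_def x'_def power2_eq_square)
  have "2 * (deriv (W k) z * B k z - 2 * W k z * deriv (B k) z) =
     a ^ 3 * (4 * (x' * x') - 2 * x * (2 - 3 / 2 * g2 * x\<^sup>2 - 2 * g3 * x ^ 3))"
    unfolding W_local[OF z] B_eq_Aw(1)[OF z, of k] a_def[symmetric] a'_def[symmetric] x_def[symmetric] x'_def[symmetric]
    by (simp add: algebra_simps power2_eq_square power3_eq_cube)
  also have "\<dots> = 12 * a\<^sup>2 * (a * x) - g2 * (a * x) ^ 3"
    unfolding x2 by (simp add: algebra_simps power2_eq_square power3_eq_cube power4_eq_xxxx)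
  finally show "2 * (deriv (W k) z * B k z - 2 * W k z * deriv (B k) z) = 12 * (A k z)\<^sup>2 * B k z - g2 * B k z ^ 3"
    unfolding B_eq_Aw(1)[OF z, of k] a_def x_def .
qed (intro holomorphic_intros AB_hol W_hol deriv_AB_hol deriv_W_hol)+

text \<open>Homogeneous form of the second-order equation of B/A = 1/u, the one to use at poles,
  where A is nonzero.\<close>

lemma W_deriv_A:
  assumes z: "z \<in> ball 0 (2 ^ k * r)"
  shows "deriv (W k) z * A k z - 2 * W k z * deriv (A k) z = - 2 * A k z ^ 3 + 3 / 2 * g2 * A k z * (B k z)\<^sup>2 + 2 * g3 * B k z ^ 3"
proof (rule continue_identity[OF _ _ _ z])
  fix z :: complex assume z: "z \<in> ball 0 r"
  show "deriv (W k) z * A k z - 2 * W k z * deriv (A k) z = - 2 * A k z ^ 3 + 3 / 2 * g2 * A k z * (B k z)\<^sup>2 + 2 * g3 * B k z ^ 3"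
    unfolding W_local[OF z] B_eq_Aw(1)[OF z, of k]
    by (simp add: algebra_simps power2_eq_square power3_eq_cube)
qed (intro holomorphic_intros AB_hol W_hol deriv_AB_hol deriv_W_hol)+

definition \<Lambda> :: "complex set" where "\<Lambda> = {z. \<exists>k. norm z < 2 ^ k * r \<and> B k z = 0}"
text \<open>The choice of k is immaterial by \<open>u_eq\<close>. At poles the value is 0 by the
  convention for division, which keeps \<open>pole_period\<close> valid at all points.\<close>

definition u :: "complex \<Rightarrow> complex" where
  "u z = (let k = (SOME k. norm z < 2 ^ k * r) in A k z / B k z)"

lemma ex_ball: obtains k where "R < 2 ^ k * r"
proof -
  obtain k where "R / r < 2 ^ k" using real_arch_pow[of 2 "R / r"] by auto
  then show ?thesis using that r by (auto simp: field_simps)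
qed

lemma HH_proj': "norm z < 2 ^ k * r \<Longrightarrow> norm z < 2 ^ l * r \<Longrightarrow> proj_eq (HH k z) (HH l z)"
  using HH_proj[of k l z] HH_proj[of l k z] proj_eq_sym by (metis le_cases)

lemma B_zero_cong: "norm z < 2 ^ k * r \<Longrightarrow> norm z < 2 ^ l * r \<Longrightarrow> B k z = 0 \<longleftrightarrow> B l z = 0"
  using HH_proj'[of z k l] AB_nz[of k z] AB_nz[of l z] by (auto simp: proj_eq_def A_def B_def)

lemma pole_iff: "norm z < 2 ^ k * r \<Longrightarrow> z \<in> \<Lambda> \<longleftrightarrow> B k z = 0"
  unfolding \<Lambda>_def using B_zero_cong by blast

lemma u_eq: "norm z < 2 ^ k * r \<Longrightarrow> u z = A k z / B k z"
proof -
  assume k: "norm z < 2 ^ k * r"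
  define l where "l = (SOME k. norm z < 2 ^ k * r)"
  have l: "norm z < 2 ^ l * r" unfolding l_def by (rule someI[of "\<lambda>k. norm z < 2 ^ k * r", OF k])
  have "A l z / B l z = A k z / B k z"
  proof (cases "B k z = 0")
    case False
    then have "B l z \<noteq> 0" using B_zero_cong[OF k l] by simp
    then show ?thesis using False HH_proj'[OF k l] by (simp add: proj_eq_def A_def B_def field_simps)
  qed (use B_zero_cong[OF k l] in simp)
  then show ?thesis by (simp add: u_def l_def)
qed

lemma open_compl_poles: "open (- \<Lambda>)"
  unfolding open_contains_ball
proof
  fix z assume z: "z \<in> - \<Lambda>"
  obtain k where k: "norm z < 2 ^ k * r" using ex_ball .
  then have "B k z \<noteq> 0" "z \<in> ball 0 (2 ^ k * r)" using z pole_iff by auto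
  then obtain e where e: "e > 0" "\<And>x. x \<in> ball z e \<Longrightarrow> x \<in> ball 0 (2 ^ k * r) \<and> B k x \<noteq> 0"
    using holomorphic_ball_nonzero[OF AB_hol(2) open_ball] by metis
  have "ball z e \<subseteq> - \<Lambda>"
  proof
    fix x assume "x \<in> ball z e"
    then show "x \<in> - \<Lambda>" using e(2)[of x] pole_iff[of x k] by simp
  qed
  then show "\<exists>e>0. ball z e \<subseteq> - \<Lambda>" using e(1) by blast
qed

lemma D_u_k:
  assumes z: "z \<notin> \<Lambda>" and k: "norm z < 2 ^ k * r"
  shows "(u has_field_derivative W k z / (B k z)\<^sup>2) (at z)"
proof -
  have zb: "z \<in> ball 0 (2 ^ k * r)" using k by simp
  have nz: "B k z \<noteq> 0" using z pole_iff[OF k] by simp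
  have "((\<lambda>z. A k z / B k z) has_field_derivative W k z / (B k z)\<^sup>2) (at z)"
    by (rule DERIV_cong[OF DERIV_divide[OF D_AB(1,2)[OF zb] nz]]) (simp add: W_def power2_eq_square)
  then show ?thesis
    by (rule has_field_derivative_transform_within_open[OF _ open_ball zb]) (use u_eq in auto)
qed

lemma deriv_u_k: "z \<notin> \<Lambda> \<Longrightarrow> norm z < 2 ^ k * r \<Longrightarrow> deriv u z = W k z / (B k z)\<^sup>2"
  using D_u_k DERIV_imp_deriv by blast

lemma D_u: "z \<notin> \<Lambda> \<Longrightarrow> (u has_field_derivative deriv u z) (at z)"
  using D_u_k deriv_u_k ex_ball[of "norm z"] by metis

lemma u_ode: assumes "z \<notin> \<Lambda>" shows "(deriv u z)\<^sup>2 = 4 * u z ^ 3 - g2 * u z - g3"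
proof -
  obtain k where k: "norm z < 2 ^ k * r" using ex_ball .
  have nz: "B k z \<noteq> 0" using assms pole_iff[OF k] by simp
  have "(deriv u z)\<^sup>2 = (W k z)\<^sup>2 / (B k z) ^ 4"
    unfolding deriv_u_k[OF assms k] by (simp add: power_divide flip: power_mult)
  also have "(W k z)\<^sup>2 = 4 * A k z ^ 3 * B k z - g2 * A k z * B k z ^ 3 - g3 * B k z ^ 4"
    by (rule W_sq) (use k in simp)
  also have "\<dots> / (B k z) ^ 4 = 4 * (A k z / B k z) ^ 3 - g2 * (A k z / B k z) - g3"
    using nz by (simp add: field_simps power2_eq_square power3_eq_cube power4_eq_xxxx)
  finally show ?thesis unfolding u_eq[OF k] .
qed

lemma D_u1: assumes "z \<notin> \<Lambda>" shows "(deriv u has_field_derivative 6 * (u z)\<^sup>2 - g2 / 2) (at z)"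
proof -
  obtain k where k: "norm z < 2 ^ k * r" using ex_ball .
  have zb: "z \<in> ball 0 (2 ^ k * r)" using k by simp
  have nz: "B k z \<noteq> 0" using assms pole_iff[OF k] by simp
  define W' B' a b where "W' = deriv (W k) z" and "B' = deriv (B k) z" and "a = A k z" and "b = B k z"
  have id: "2 * (W' * b - 2 * W k z * B') = 12 * a\<^sup>2 * b - g2 * b ^ 3"
    unfolding W'_def B'_def a_def b_def by (rule W_deriv_B[OF zb])
  have "((\<lambda>z. W k z / (B k z * B k z)) has_field_derivative (W' * (b * b) - W k z * (B' * b + B' * b)) / ((b * b) * (b * b))) (at z)"
    using DERIV_divide[OF D_AB(3)[OF zb] DERIV_mult[OF D_AB(2)[OF zb] D_AB(2)[OF zb]]] nz by (simp add: W'_def B'_def b_def)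
  also have "(W' * (b * b) - W k z * (B' * b + B' * b)) / ((b * b) * (b * b)) = 2 * (W' * b - 2 * W k z * B') / (2 * b ^ 3)"
    using nz by (simp add: b_def[symmetric] field_simps power3_eq_cube)
  also have "\<dots> = 6 * (a / b)\<^sup>2 - g2 / 2"
    unfolding id using nz by (simp add: b_def[symmetric] field_simps power2_eq_square power3_eq_cube)
  also have "a / b = u z" unfolding u_eq[OF k] a_def b_def ..
  finally have "((\<lambda>z. W k z / (B k z * B k z)) has_field_derivative 6 * (u z)\<^sup>2 - g2 / 2) (at z)" .
  moreover have "open (- \<Lambda> \<inter> ball 0 (2 ^ k * r))" "z \<in> - \<Lambda> \<inter> ball 0 (2 ^ k * r)"
    using open_compl_poles assms zb by auto
  ultimately show ?thesis
    by (rule has_field_derivative_transform_within_open) (use deriv_u_k in \<open>auto simp: power2_eq_square\<close>)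
qed

lemma zero_pole: "0 \<in> \<Lambda>"
  using pole_iff[of 0 0] r by (simp add: B_def HH_def w0)

lemma u_local: "z \<in> ball 0 r \<Longrightarrow> u z = 1 / w z"
  using u_eq[of z 0] by (simp add: A_def B_def HH_def)

lemma pole_local: "z \<in> ball 0 r \<Longrightarrow> z \<in> \<Lambda> \<longleftrightarrow> z = 0"
  using pole_iff[of z 0] w_nz[of z] w0 by (auto simp: A_def B_def HH_def)

section \<open>Evenness and periods of the continued function\<close>

lemma HH_even: "norm z < 2 ^ k * r \<Longrightarrow> HH k (- z) = HH k z"
  using w_even[of "z / 2 ^ k"] by (simp add: HH_def norm_divide norm_power field_simps)

lemma pole_minus: "- z \<in> \<Lambda> \<longleftrightarrow> z \<in> \<Lambda>"
proof -
  obtain k where k: "norm z < 2 ^ k * r" using ex_ball .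
  then show ?thesis using pole_iff[of z k] pole_iff[of "- z" k] HH_even[OF k] by (simp add: B_def)
qed

lemma u_even: "u (- z) = u z"
proof -
  obtain k where k: "norm z < 2 ^ k * r" using ex_ball .
  then show ?thesis using u_eq[of z k] u_eq[of "- z" k] HH_even[OF k] by (simp add: B_def A_def)
qed

lemma deriv_u_odd: assumes "z \<notin> \<Lambda>" shows "deriv u (- z) = - deriv u z"
proof -
  have "- z \<notin> \<Lambda>" using assms pole_minus by simp
  have "((\<lambda>z. u (- z)) has_field_derivative - deriv u (- z)) (at z)"
    using DERIV_chain2[of u _ uminus, OF D_u[OF \<open>- z \<notin> \<Lambda>\<close>] DERIV_minus[OF DERIV_ident]] by simp
  then have "- deriv u (- z) = deriv u z" using D_u[OF assms] unfolding u_even by (rule DERIV_unique)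
  then show ?thesis by (metis minus_minus)
qed

text \<open>The identity theorem on the ball of radius 2^k r - |\<gamma>|, where z and z + \<gamma>
  both stay in the domain of \<open>A k\<close> and \<open>B k\<close>.\<close>

lemma shift_continuation:
  assumes z0: "norm z0 + norm \<gamma> < 2 ^ k * r" and e: "e > 0"
    and eq: "\<And>z. z \<in> ball z0 e \<Longrightarrow> norm z + norm \<gamma> < 2 ^ k * r \<Longrightarrow> A k (z + \<gamma>) * B k z = A k z * B k (z + \<gamma>)"
    and z: "norm z + norm \<gamma> < 2 ^ k * r"
  shows "A k (z + \<gamma>) * B k z = A k z * B k (z + \<gamma>)"
proof -
  define X where "X = ball (0::complex) (2 ^ k * r - norm \<gamma>)"
  have sub: "X \<subseteq> ball 0 (2 ^ k * r)" unfolding X_def by (intro subset_ball) auto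
  have sub2: "(\<lambda>z. z + \<gamma>) ` X \<subseteq> ball 0 (2 ^ k * r)"
  proof clarify
    fix z assume "z \<in> X"
    then show "z + \<gamma> \<in> ball 0 (2 ^ k * r)" using norm_triangle_ineq[of z \<gamma>] by (simp add: X_def)
  qed
  have id: "(\<lambda>z. z + \<gamma>) holomorphic_on X" by (intro holomorphic_intros)
  note c = holomorphic_on_compose_gen[OF id AB_hol(1) sub2] holomorphic_on_compose_gen[OF id AB_hol(2) sub2]
  have hol: "A k holomorphic_on X" "B k holomorphic_on X" using AB_hol sub holomorphic_on_subset by blast+
  show ?thesis
  proof (rule analytic_continuation_open[of "ball z0 e \<inter> X" X "\<lambda>z. A k (z + \<gamma>) * B k z" "\<lambda>z. A k z * B k (z + \<gamma>)"])
    have "z0 \<in> ball z0 e \<inter> X" using z0 e by (simp add: X_def)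
    then show "ball z0 e \<inter> X \<noteq> {}" by blast
    show "(\<lambda>z. A k (z + \<gamma>) * B k z) holomorphic_on X" "(\<lambda>z. A k z * B k (z + \<gamma>)) holomorphic_on X"
      using c hol by (auto simp: o_def intro!: holomorphic_intros)
  qed (use eq z in \<open>auto simp: X_def\<close>)
qed

text \<open>Near a pole l the function 1/u(z + l) = B/A satisfies the second-order equation of w,
  with value 0 and, by \<open>W_sq\<close>, derivative 0 at z = 0. So it is w, and the pole l is a
  period.\<close>

lemma pole_period_AB:
  assumes l: "l \<in> \<Lambda>" and z: "norm z + norm l < 2 ^ k * r"
  shows "A k (z + l) * B k z = A k z * B k (z + l)"
proof -
  have lk: "norm l < 2 ^ k * r" using z norm_ge_zero[of z] by linarith
  have Bl: "B k l = 0" using l pole_iff[OF lk] by simp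
  then have Al: "A k l \<noteq> 0" using AB_nz by blast
  obtain e where e: "e > 0" "\<And>x. x \<in> ball l e \<Longrightarrow> x \<in> ball 0 (2 ^ k * r) \<and> A k x \<noteq> 0"
    using holomorphic_ball_nonzero[OF AB_hol(1) open_ball, of l k] lk Al by auto
  define v where "v = (\<lambda>z. B k (z + l) / A k (z + l))"
  define v1 where "v1 = (\<lambda>z. - W k (z + l) / (A k (z + l))\<^sup>2)"
  have in_ball: "z + l \<in> ball l e" if "z \<in> ball 0 e" for z using that by (simp add: dist_norm)
  have shift: "((\<lambda>z. f (z + l)) has_field_derivative D) (at z)" if "(f has_field_derivative D) (at (z + l))" for f :: "complex \<Rightarrow> complex" and D z
    using that by (simp add: DERIV_shift)
  have "eventually (\<lambda>z. v z = w z) (nhds 0)"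
  proof (rule germ_unique[OF e(1), of v v1])
    fix z :: complex assume z: "z \<in> ball 0 e"
    define y where "y = z + l"
    have y: "y \<in> ball 0 (2 ^ k * r)" "A k y \<noteq> 0" using e(2)[OF in_ball[OF z]] by (auto simp: y_def)
    note D = D_AB[OF y(1)]
    have "((\<lambda>y. B k y / A k y) has_field_derivative - W k y / (A k y)\<^sup>2) (at y)"
      by (rule DERIV_cong[OF DERIV_divide[OF D(2,1) y(2)]]) (simp add: W_def power2_eq_square algebra_simps)
    then show "(v has_field_derivative v1 z) (at z)"
      unfolding v_def v1_def y_def by (rule shift)
    define W' A' a b where "W' = deriv (W k) y" and "A' = deriv (A k) y" and "a = A k y" and "b = B k y"
    have id: "W' * a - 2 * W k y * A' = - 2 * a ^ 3 + 3 / 2 * g2 * a * b\<^sup>2 + 2 * g3 * b ^ 3"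
      unfolding W'_def A'_def a_def b_def by (rule W_deriv_A[OF y(1)])
    have nz: "a \<noteq> 0" using y by (simp add: a_def)
    have "((\<lambda>y. - W k y / (A k y * A k y)) has_field_derivative (- W' * (a * a) - - W k y * (A' * a + A' * a)) / ((a * a) * (a * a))) (at y)"
      using DERIV_divide[OF DERIV_minus[OF D(3)] DERIV_mult[OF D(1) D(1)]] y(2) by (simp add: W'_def A'_def a_def)
    also have "(- W' * (a * a) - - W k y * (A' * a + A' * a)) / ((a * a) * (a * a)) = - (W' * a - 2 * W k y * A') / a ^ 3"
      using nz by (simp add: field_simps power3_eq_cube)
    also have "\<dots> = 2 + (- 3 / 2 * g2) * (b / a) ^ 2 + (- 2 * g3) * (b / a) ^ 3"
      unfolding id using nz by (simp add: field_simps power2_eq_square power3_eq_cube)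
    finally have "((\<lambda>y. - W k y / (A k y)\<^sup>2) has_field_derivative 2 + (- 3 / 2 * g2) * (b / a) ^ 2 + (- 2 * g3) * (b / a) ^ 3) (at y)"
      by (simp add: power2_eq_square)
    then show "(v1 has_field_derivative 2 + (- 3 / 2 * g2) * v z ^ 2 + (- 2 * g3) * v z ^ 3) (at z)"
      unfolding v_def v1_def y_def a_def b_def by (rule shift)
  next
    show "v 0 = 0" by (simp add: v_def Bl)
    have "(W k l)\<^sup>2 = 0" using W_sq[of l k] lk Bl by simp
    then show "v1 0 = 0" by (simp add: v1_def)
  qed
  then obtain d where d: "d > 0" "\<And>z. norm z < d \<Longrightarrow> v z = w z"
    unfolding eventually_nhds_metric by (auto simp: dist_norm)
  show ?thesis
  proof (rule shift_continuation[of 0 l k "min d (min e r)"])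
    fix z :: complex assume "z \<in> ball 0 (min d (min e r))"
    then have z: "norm z < d" "z \<in> ball 0 e" "z \<in> ball 0 r" by auto
    have "B k (z + l) = A k (z + l) * w z"
      using d(2)[OF z(1)] e(2)[OF in_ball[OF z(2)]] by (simp add: v_def field_simps)
    then show "A k (z + l) * B k z = A k z * B k (z + l)"
      unfolding B_eq_Aw(1)[OF z(3), of k] by simp
  qed (use d e r z lk in auto)
qed

lemma AB_eq_imp_u_eq:
  assumes "A k x * B k y = A k y * B k x" "norm x < 2 ^ k * r" "norm y < 2 ^ k * r"
  shows "x \<in> \<Lambda> \<longleftrightarrow> y \<in> \<Lambda>" "u x = u y"
proof -
  have Z: "B k x = 0 \<longleftrightarrow> B k y = 0" using assms(1) AB_nz[of k x] AB_nz[of k y] by auto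
  then show "x \<in> \<Lambda> \<longleftrightarrow> y \<in> \<Lambda>" using pole_iff assms by simp
  show "u x = u y" using assms Z by (cases "B k x = 0") (simp_all add: u_eq[of _ k] field_simps)
qed

lemma pole_period:
  assumes "l \<in> \<Lambda>" shows "z + l \<in> \<Lambda> \<longleftrightarrow> z \<in> \<Lambda>" "u (z + l) = u z"
proof -
  obtain k where k: "norm z + norm l < 2 ^ k * r" using ex_ball .
  have "norm (z + l) < 2 ^ k * r" "norm z < 2 ^ k * r"
    using k norm_triangle_ineq[of z l] norm_ge_zero[of l] by linarith+
  then show "z + l \<in> \<Lambda> \<longleftrightarrow> z \<in> \<Lambda>" "u (z + l) = u z"
    using AB_eq_imp_u_eq[OF pole_period_AB[OF assms k]] by blast+
qed

text \<open>Equal values of u and u' give equal germs by uniqueness for u'', so \<gamma> is a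
  period; evaluating the continued identity at 0, where B vanishes and A does not, makes \<gamma> a
  pole.\<close>

lemma period_pole:
  assumes z0: "z0 \<notin> \<Lambda>" "z0 + \<gamma> \<notin> \<Lambda>" and eq: "u (z0 + \<gamma>) = u z0" "deriv u (z0 + \<gamma>) = deriv u z0"
  shows "\<gamma> \<in> \<Lambda>"
proof -
  define X where "X = (\<lambda>z. z + z0) -` (- \<Lambda>) \<inter> (\<lambda>z. z + (z0 + \<gamma>)) -` (- \<Lambda>)"
  have X: "open X" "0 \<in> X" unfolding X_def using z0
    by (auto intro!: open_Int open_vimage open_compl_poles continuous_intros)
  have shift: "((\<lambda>z. f (z + l)) has_field_derivative D) (at z)" if "(f has_field_derivative D) (at (z + l))" for f :: "complex \<Rightarrow> complex" and D z l
    using that by (simp add: DERIV_shift)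
  have "eventually (\<lambda>z. u (z + (z0 + \<gamma>)) = u (z + z0)) (nhds 0)"
  proof (rule ode2_unique[OF X, of _ "\<lambda>z. deriv u (z + (z0 + \<gamma>))" "- g2 / 2" 6 0 _ "\<lambda>z. deriv u (z + z0)"])
    fix z assume "z \<in> X"
    then have z: "z + z0 \<notin> \<Lambda>" "z + (z0 + \<gamma>) \<notin> \<Lambda>" by (auto simp: X_def)
    show "((\<lambda>z. u (z + z0)) has_field_derivative deriv u (z + z0)) (at z)"
      "((\<lambda>z. u (z + (z0 + \<gamma>))) has_field_derivative deriv u (z + (z0 + \<gamma>))) (at z)"
      by (rule shift[OF D_u[OF z(1)]], rule shift[OF D_u[OF z(2)]])
    show "((\<lambda>z. deriv u (z + z0)) has_field_derivative - g2 / 2 + 6 * (u (z + z0))\<^sup>2 + 0 * u (z + z0) ^ 3) (at z)"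
      "((\<lambda>z. deriv u (z + (z0 + \<gamma>))) has_field_derivative - g2 / 2 + 6 * (u (z + (z0 + \<gamma>)))\<^sup>2 + 0 * u (z + (z0 + \<gamma>)) ^ 3) (at z)"
      using shift[OF D_u1[OF z(1)]] shift[OF D_u1[OF z(2)]] by simp_all
  qed (use eq in simp_all)
  then obtain d where d: "d > 0" "\<And>z. norm z < d \<Longrightarrow> u (z + (z0 + \<gamma>)) = u (z + z0)"
    unfolding eventually_nhds_metric by (auto simp: dist_norm)
  obtain e where e: "e > 0" "ball 0 e \<subseteq> X" using X open_contains_ball by blast
  obtain k where k: "norm z0 + norm \<gamma> < 2 ^ k * r" using ex_ball .
  have g: "norm \<gamma> < 2 ^ k * r" using k norm_ge_zero[of z0] by linarith
  have "A k (0 + \<gamma>) * B k 0 = A k 0 * B k (0 + \<gamma>)"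
  proof (rule shift_continuation[OF k, of "min d e"])
    fix z assume z: "z \<in> ball z0 (min d e)" "norm z + norm \<gamma> < 2 ^ k * r"
    have n: "norm z < 2 ^ k * r" "norm (z + \<gamma>) < 2 ^ k * r"
      using z(2) norm_triangle_ineq[of z \<gamma>] norm_ge_zero[of \<gamma>] by linarith+
    have "norm (z - z0) < min d e" using z(1) by (simp add: dist_norm norm_minus_commute)
    then have "z - z0 \<in> X" "norm (z - z0) < d" using e by auto
    then have "z \<notin> \<Lambda>" "z + \<gamma> \<notin> \<Lambda>" "u (z + \<gamma>) = u z" using d(2)[of "z - z0"] by (auto simp: X_def algebra_simps)
    then show "A k (z + \<gamma>) * B k z = A k z * B k (z + \<gamma>)"
      using u_eq[OF n(1)] u_eq[OF n(2)] pole_iff[OF n(1)] pole_iff[OF n(2)] by (simp add: field_simps)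
  qed (use d e g in auto)
  moreover have "B k 0 = 0" "A k 0 \<noteq> 0" using B_eq_Aw[of 0 k] r w0 by auto
  ultimately have "B k \<gamma> = 0" by simp
  then show ?thesis using pole_iff[OF g] by simp
qed

end

section \<open>Lifting paths to the universal covering\<close>

lemma holomorphic_local_inverse:
  fixes f :: "complex \<Rightarrow> complex"
  assumes f: "f holomorphic_on S" "open S" "a \<in> S" "deriv f a \<noteq> 0"
  obtains e h where "e > 0" "h (f a) = a"
    "\<And>x. x \<in> ball (f a) e \<Longrightarrow> h x \<in> S \<and> f (h x) = x \<and> deriv f (h x) \<noteq> 0 \<and> (h has_field_derivative 1 / deriv f (h x)) (at x)"
proof -
  obtain \<rho> where \<rho>: "\<rho> > 0" "ball a \<rho> \<subseteq> S" "open (f ` ball a \<rho>)" "inj_on f (ball a \<rho>)"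
    by (rule has_complex_derivative_locally_invertible[OF f(1,3,2,4)])
  have fh: "f holomorphic_on ball a \<rho>" using f(1) \<rho>(2) holomorphic_on_subset by blast
  have "\<exists>h. h holomorphic_on (f ` ball a \<rho>) \<and> (\<forall>s\<in>ball a \<rho>. deriv f s * deriv h (f s) = 1) \<and> (\<forall>s\<in>ball a \<rho>. h (f s) = s)"
    by (rule holomorphic_has_inverse[OF fh open_ball \<rho>(4)]) blast
  then obtain h where h: "h holomorphic_on (f ` ball a \<rho>)" "\<And>s. s \<in> ball a \<rho> \<Longrightarrow> deriv f s * deriv h (f s) = 1"
      "\<And>s. s \<in> ball a \<rho> \<Longrightarrow> h (f s) = s"
    by blast
  have "f a \<in> f ` ball a \<rho>" using \<rho>(1) by simp
  then obtain e where e: "e > 0" "ball (f a) e \<subseteq> f ` ball a \<rho>" using \<rho>(3) open_contains_ball by blast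
  show ?thesis
  proof (rule that[OF e(1)])
    show "h (f a) = a" using h(3) \<rho>(1) by simp
    fix x assume "x \<in> ball (f a) e"
    then have x: "x \<in> f ` ball a \<rho>" using e(2) by blast
    then obtain y where y: "y \<in> ball a \<rho>" "x = f y" by blast
    have hx: "h x = y" using h(3)[OF y(1)] y(2) by simp
    have d: "deriv f y * deriv h x = 1" using h(2)[OF y(1)] y(2) by simp
    then have nz: "deriv f y \<noteq> 0" by auto
    have "(h has_field_derivative deriv h x) (at x)" by (rule holomorphic_derivI[OF h(1) \<rho>(3) x])
    moreover have "deriv h x = 1 / deriv f y" using d nz by (simp add: field_simps)
    ultimately show "h x \<in> S \<and> f (h x) = x \<and> deriv f (h x) \<noteq> 0 \<and> (h has_field_derivative 1 / deriv f (h x)) (at x)"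
      using hx y nz \<rho>(2) by auto
  qed
qed

lemma vector_derivative_eq_imp_eq:
  fixes m Z :: "real \<Rightarrow> complex"
  assumes J: "convex J" "t1 \<in> J" and fin: "finite S"
    and cont: "continuous_on J m" "continuous_on J Z"
    and dm: "\<And>t. t \<in> J - S \<Longrightarrow> (m has_vector_derivative p t) (at t)"
    and dZ: "\<And>t. t \<in> J - S \<Longrightarrow> (Z has_vector_derivative p t) (at t)"
    and eq: "m t1 = Z t1" and t: "t \<in> J"
  shows "m t = Z t"
proof -
  have "m t - Z t = 0"
  proof (rule has_derivative_zero_unique_strong_convex[OF J(1) fin _ J(2), of "\<lambda>t. m t - Z t"])
    show "continuous_on J (\<lambda>t. m t - Z t)" by (intro continuous_intros cont)
    fix x assume x: "x \<in> J - S"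
    have "((\<lambda>t. m t - Z t) has_vector_derivative p x - p x) (at x)"
      by (rule has_vector_derivative_diff[OF dm[OF x] dZ[OF x]])
    then have "((\<lambda>t. m t - Z t) has_derivative (\<lambda>h. 0)) (at x)"
      by (simp add: has_vector_derivative_def)
    then show "((\<lambda>t. m t - Z t) has_derivative (\<lambda>h. 0)) (at x within J)"
      by (rule has_derivative_at_withinI)
  qed (use eq t in auto)
  then show ?thesis by simp
qed

context weierstrass_germ
begin

lemma u_hol: "u holomorphic_on - \<Lambda>"
  by (rule holomorphic_on_openI[OF open_compl_poles]) (use D_u in auto)

lemma u1_hol: "deriv u holomorphic_on - \<Lambda>"
  by (rule holomorphic_deriv[OF u_hol open_compl_poles])

lemma deriv_deriv_u: "z \<notin> \<Lambda> \<Longrightarrow> deriv (deriv u) z = 6 * (u z)\<^sup>2 - g2 / 2"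
  using D_u1 DERIV_imp_deriv by blast

text \<open>\<xi> is a local inverse of z -> (u, u') on the curve. The last clause describes \<xi>
  along arbitrary paths, so that \<open>path_lift\<close> need not know whether u or u' serves as
  local coordinate; p plays the role of dX/Y.\<close>

definition is_chart :: "complex \<Rightarrow> real \<Rightarrow> (complex \<Rightarrow> complex \<Rightarrow> complex) \<Rightarrow> bool" where
  "is_chart z1 e \<xi> \<longleftrightarrow> e > 0 \<and> \<xi> (u z1) (deriv u z1) = z1 \<and>
    (\<forall>x\<in>ball (u z1) e. \<forall>y\<in>ball (deriv u z1) e. y\<^sup>2 = 4 * x ^ 3 - g2 * x - g3 \<longrightarrow>
        \<xi> x y \<notin> \<Lambda> \<and> u (\<xi> x y) = x \<and> deriv u (\<xi> x y) = y) \<and>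
    (\<forall>(X :: real \<Rightarrow> complex) (Y :: real \<Rightarrow> complex) J p. continuous_on J X \<longrightarrow> continuous_on J Y \<longrightarrow>
       (\<forall>t\<in>J. X t \<in> ball (u z1) e \<and> Y t \<in> ball (deriv u z1) e \<and> (Y t)\<^sup>2 = 4 * X t ^ 3 - g2 * X t - g3) \<longrightarrow>
       continuous_on J (\<lambda>t. \<xi> (X t) (Y t)) \<and>
       (\<forall>t\<in>J. (X has_vector_derivative Y t * p t) (at t) \<longrightarrow> (Y has_vector_derivative (6 * (X t)\<^sup>2 - g2 / 2) * p t) (at t) \<longrightarrow>
          ((\<lambda>t. \<xi> (X t) (Y t)) has_vector_derivative p t) (at t)))"

text \<open>Where u' is nonzero, u is a local coordinate and only the sign of y has to be settled.
  Where u' = 0, the discriminant forces u'' \<noteq> 0, so u' is the coordinate and x has to be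
  recovered from y.\<close>

lemma local_chart:
  assumes z1: "z1 \<notin> \<Lambda>"
  shows "\<exists>e \<xi>. is_chart z1 e \<xi>"
proof (cases "deriv u z1 = 0")
  case False
  define y1 where "y1 = deriv u z1"
  \<comment> \<open>Values y and -y cannot both be within distance |y1| of y1, which fixes the
    sign.\<close>
  define S where "S = - \<Lambda> \<inter> deriv u -` ball y1 (norm y1)"
  have "open S" unfolding S_def
    using u1_hol open_compl_poles by (intro continuous_open_preimage holomorphic_on_imp_continuous_on) auto
  moreover have "z1 \<in> S" using z1 False by (simp add: S_def y1_def)
  moreover have "u holomorphic_on S" using u_hol by (rule holomorphic_on_subset) (auto simp: S_def)
  ultimately obtain e h where e: "e > 0" "h (u z1) = z1"
    and h: "\<And>x. x \<in> ball (u z1) e \<Longrightarrow> h x \<in> S \<and> u (h x) = x \<and> deriv u (h x) \<noteq> 0 \<and> (h has_field_derivative 1 / deriv u (h x)) (at x)"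
    using holomorphic_local_inverse[of u S z1] False by metis
  define \<epsilon> where "\<epsilon> = min e (norm y1)"
  have \<epsilon>: "\<epsilon> > 0" using e(1) False by (simp add: \<epsilon>_def y1_def)
  have main: "h x \<notin> \<Lambda> \<and> u (h x) = x \<and> deriv u (h x) = y"
    if x: "x \<in> ball (u z1) \<epsilon>" and y: "y \<in> ball (deriv u z1) \<epsilon>" and c: "y\<^sup>2 = 4 * x ^ 3 - g2 * x - g3" for x y
  proof -
    have hx: "h x \<in> S" "u (h x) = x" using h[of x] x by (auto simp: \<epsilon>_def)
    then have nl: "h x \<notin> \<Lambda>" and near: "norm (deriv u (h x) - y1) < norm y1" by (auto simp: S_def dist_norm norm_minus_commute)
    have "(deriv u (h x))\<^sup>2 = y\<^sup>2" using u_ode[OF nl] hx(2) c by simp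
    then consider "deriv u (h x) = y" | "deriv u (h x) = - y" using power2_eq_iff by blast
    then show ?thesis
    proof cases
      case 2
      have "norm (y - y1) < norm y1" using y by (simp add: \<epsilon>_def y1_def dist_norm norm_minus_commute)
      moreover have "norm (- y - y1) < norm y1" using near 2 by simp
      moreover have "norm ((y - y1) + (- y - y1)) \<le> norm (y - y1) + norm (- y - y1)" by (rule norm_triangle_ineq)
      moreover have "(y - y1) + (- y - y1) = - (2 * y1)" by simp
      then have "norm ((y - y1) + (- y - y1)) = 2 * norm y1" by (simp only: norm_minus_cancel norm_mult) simp
      ultimately show ?thesis by linarith
    qed (use hx nl in auto)
  qed
  have "continuous_on J (\<lambda>t. h (X t)) \<and>
       (\<forall>t\<in>J. (X has_vector_derivative Y t * p t) (at t) \<longrightarrow> (Y has_vector_derivative (6 * (X t)\<^sup>2 - g2 / 2) * p t) (at t) \<longrightarrow>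
          ((\<lambda>t. h (X t)) has_vector_derivative p t) (at t))"
    if contX: "continuous_on J X" "continuous_on J Y"
      and all: "\<forall>t\<in>J. X t \<in> ball (u z1) \<epsilon> \<and> Y t \<in> ball (deriv u z1) \<epsilon> \<and> (Y t)\<^sup>2 = 4 * X t ^ 3 - g2 * X t - g3"
    for X Y :: "real \<Rightarrow> complex" and J p
  proof -
    have X: "continuous_on J X" "\<And>t. t \<in> J \<Longrightarrow> X t \<in> ball (u z1) \<epsilon>" "\<And>t. t \<in> J \<Longrightarrow> Y t \<in> ball (deriv u z1) \<epsilon>"
      and c: "\<And>t. t \<in> J \<Longrightarrow> (Y t)\<^sup>2 = 4 * X t ^ 3 - g2 * X t - g3"
      using contX all by blast+
    have Xe: "X t \<in> ball (u z1) e" if "t \<in> J" for t using X(2)[OF that] by (simp add: \<epsilon>_def)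
    have "continuous_on (ball (u z1) e) h"
      using h by (intro DERIV_continuous_on[of "ball (u z1) e" h "\<lambda>x. 1 / deriv u (h x)"]) (auto intro: has_field_derivative_at_within)
    then have "continuous_on J (\<lambda>t. h (X t))"
      by (rule continuous_on_compose2[OF _ X(1)]) (use Xe in blast)
    moreover have "((\<lambda>t. h (X t)) has_vector_derivative p t) (at t)"
      if t: "t \<in> J" and d: "(X has_vector_derivative Y t * p t) (at t)" for t
    proof -
      have Yt: "deriv u (h (X t)) = Y t" using main[OF X(2)[OF t] X(3)[OF t] c[OF t]] by simp
      have "deriv u (h (X t)) \<noteq> 0" and dh: "(h has_field_derivative 1 / deriv u (h (X t))) (at (X t))" using h[OF Xe[OF t]] by auto
      then have "Y t \<noteq> 0" using Yt by simp
      then have "Y t * p t * (1 / deriv u (h (X t))) = p t" by (simp add: Yt)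
      then show ?thesis using field_vector_diff_chain_at[OF d dh] by (simp only: o_def)
    qed
    ultimately show ?thesis by blast
  qed
  then have "is_chart z1 \<epsilon> (\<lambda>x y. h x)" unfolding is_chart_def using main \<epsilon> e(2) by blast
  then show ?thesis by blast
next
  case True
  define x1 where "x1 = u z1"
  define f where "f = (\<lambda>x. 4 * x ^ 3 - g2 * x - g3)"
  have Df: "(f has_field_derivative 12 * x\<^sup>2 - g2) (at x)" for x
    unfolding f_def by (auto intro!: derivative_eq_intros)
  have fx1: "f x1 = 0" using u_ode[OF z1] True by (simp add: f_def x1_def)
  have nz: "12 * x1\<^sup>2 - g2 \<noteq> 0" using cubic_no_common_root[of x1 g2 g3] fx1 disc by (auto simp: f_def)
  have "f holomorphic_on UNIV" unfolding f_def by (intro holomorphic_intros)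
  moreover have "deriv f x1 \<noteq> 0" using DERIV_imp_deriv[OF Df] nz by simp
  \<comment> \<open>Injectivity of the cubic near its simple root x1 singles out x among the
    solutions of the curve equation.\<close>
  ultimately obtain \<eta> where \<eta>: "\<eta> > 0" "inj_on f (ball x1 \<eta>)"
    using has_complex_derivative_locally_invertible[of f UNIV x1] by (metis UNIV_I open_UNIV)
  define S where "S = - \<Lambda> \<inter> u -` ball x1 \<eta>"
  have "open S" unfolding S_def
    using u_hol open_compl_poles by (intro continuous_open_preimage holomorphic_on_imp_continuous_on) auto
  moreover have "z1 \<in> S" using z1 \<eta>(1) by (simp add: S_def x1_def)
  moreover have "deriv u holomorphic_on S" using u1_hol by (rule holomorphic_on_subset) (auto simp: S_def)
  moreover have "deriv (deriv u) z1 \<noteq> 0"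
  proof -
    have "12 * x1\<^sup>2 - g2 = 2 * deriv (deriv u) z1" unfolding deriv_deriv_u[OF z1] x1_def by simp
    then show ?thesis using nz by auto
  qed
  ultimately obtain e h where e: "e > 0" "h (deriv u z1) = z1"
    and h: "\<And>x. x \<in> ball (deriv u z1) e \<Longrightarrow> h x \<in> S \<and> deriv u (h x) = x \<and> deriv (deriv u) (h x) \<noteq> 0 \<and> (h has_field_derivative 1 / deriv (deriv u) (h x)) (at x)"
    using holomorphic_local_inverse[of "deriv u" S z1] by metis
  define \<epsilon> where "\<epsilon> = min e \<eta>"
  have \<epsilon>: "\<epsilon> > 0" using e(1) \<eta>(1) by (simp add: \<epsilon>_def)
  have main: "h y \<notin> \<Lambda> \<and> u (h y) = x \<and> deriv u (h y) = y"
    if x: "x \<in> ball (u z1) \<epsilon>" and y: "y \<in> ball (deriv u z1) \<epsilon>" and c: "y\<^sup>2 = 4 * x ^ 3 - g2 * x - g3" for x y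
  proof -
    have hy: "h y \<in> S" "deriv u (h y) = y" using h[of y] y by (auto simp: \<epsilon>_def)
    then have nl: "h y \<notin> \<Lambda>" and near: "u (h y) \<in> ball x1 \<eta>" by (auto simp: S_def)
    have "f (u (h y)) = f x" using u_ode[OF nl] hy(2) c by (simp add: f_def)
    moreover have "x \<in> ball x1 \<eta>" using x by (simp add: \<epsilon>_def x1_def)
    ultimately show ?thesis using \<eta>(2) near hy nl by (meson inj_onD)
  qed
  have "continuous_on J (\<lambda>t. h (Y t)) \<and>
       (\<forall>t\<in>J. (X has_vector_derivative Y t * p t) (at t) \<longrightarrow> (Y has_vector_derivative (6 * (X t)\<^sup>2 - g2 / 2) * p t) (at t) \<longrightarrow>
          ((\<lambda>t. h (Y t)) has_vector_derivative p t) (at t))"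
    if contX: "continuous_on J X" "continuous_on J Y"
      and all: "\<forall>t\<in>J. X t \<in> ball (u z1) \<epsilon> \<and> Y t \<in> ball (deriv u z1) \<epsilon> \<and> (Y t)\<^sup>2 = 4 * X t ^ 3 - g2 * X t - g3"
    for X Y :: "real \<Rightarrow> complex" and J p
  proof -
    have X: "continuous_on J Y" "\<And>t. t \<in> J \<Longrightarrow> X t \<in> ball (u z1) \<epsilon>" "\<And>t. t \<in> J \<Longrightarrow> Y t \<in> ball (deriv u z1) \<epsilon>"
      and c: "\<And>t. t \<in> J \<Longrightarrow> (Y t)\<^sup>2 = 4 * X t ^ 3 - g2 * X t - g3"
      using contX all by blast+
    have Ye: "Y t \<in> ball (deriv u z1) e" if "t \<in> J" for t using X(3)[OF that] by (simp add: \<epsilon>_def)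
    have "continuous_on (ball (deriv u z1) e) h"
      using h by (intro DERIV_continuous_on[of "ball (deriv u z1) e" h "\<lambda>x. 1 / deriv (deriv u) (h x)"]) (auto intro: has_field_derivative_at_within)
    then have "continuous_on J (\<lambda>t. h (Y t))"
      by (rule continuous_on_compose2[OF _ X(1)]) (use Ye in blast)
    moreover have "((\<lambda>t. h (Y t)) has_vector_derivative p t) (at t)"
      if t: "t \<in> J" and d: "(Y has_vector_derivative (6 * (X t)\<^sup>2 - g2 / 2) * p t) (at t)" for t
    proof -
      have m: "h (Y t) \<notin> \<Lambda>" "u (h (Y t)) = X t" using main[OF X(2)[OF t] X(3)[OF t] c[OF t]] by auto
      have "deriv (deriv u) (h (Y t)) = 6 * (X t)\<^sup>2 - g2 / 2" using deriv_deriv_u[OF m(1)] m(2) by simp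
      moreover have "deriv (deriv u) (h (Y t)) \<noteq> 0" and dh: "(h has_field_derivative 1 / deriv (deriv u) (h (Y t))) (at (Y t))" using h[OF Ye[OF t]] by auto
      ultimately have "(6 * (X t)\<^sup>2 - g2 / 2) * p t * (1 / deriv (deriv u) (h (Y t))) = p t" by simp
      then show ?thesis using field_vector_diff_chain_at[OF d dh] by (simp only: o_def)
    qed
    ultimately show ?thesis by blast
  qed
  then have "is_chart z1 \<epsilon> (\<lambda>x y. h y)" unfolding is_chart_def using main \<epsilon> e(2) by blast
  then show ?thesis by blast
qed

text \<open>The set of t with (X, Y) = (u, u') at Z is open and closed in the unit interval.
  Openness: the lift through a chart and Z have the same derivative p and a common value.\<close>

lemma path_lift:
  fixes X Y Z p :: "real \<Rightarrow> complex"
  assumes cont: "continuous_on {0..1} X" "continuous_on {0..1} Y" "continuous_on {0..1} Z"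
    and fin: "finite S"
    and dX: "\<And>t. t \<in> {0<..<1} - S \<Longrightarrow> (X has_vector_derivative Y t * p t) (at t)"
    and dY: "\<And>t. t \<in> {0<..<1} - S \<Longrightarrow> (Y has_vector_derivative (6 * (X t)\<^sup>2 - g2 / 2) * p t) (at t)"
    and dZ: "\<And>t. t \<in> {0<..<1} - S \<Longrightarrow> (Z has_vector_derivative p t) (at t)"
    and curve: "\<And>t. t \<in> {0..1} \<Longrightarrow> (Y t)\<^sup>2 = 4 * X t ^ 3 - g2 * X t - g3"
    and t0: "t0 \<in> {0..1}" "Z t0 \<notin> \<Lambda>" "X t0 = u (Z t0)" "Y t0 = deriv u (Z t0)"
    and t: "t \<in> {0..1}"
  shows "Z t \<notin> \<Lambda> \<and> X t = u (Z t) \<and> Y t = deriv u (Z t)"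
proof -
  have "compact (Z ` {0..1})" by (intro compact_continuous_image cont compact_Icc)
  then have "bounded (Z ` {0..1})" by (rule compact_imp_bounded)
  then obtain M where "\<forall>x\<in>Z ` {0..1}. norm x \<le> M" unfolding bounded_iff ..
  then have M: "\<And>t. t \<in> {0..1} \<Longrightarrow> norm (Z t) \<le> M" by simp
  obtain k where k: "M < 2 ^ k * r" using ex_ball .
  have Zk: "norm (Z t) < 2 ^ k * r" if "t \<in> {0..1}" for t using M[OF that] k by linarith
  \<comment> \<open>Cross-multiplied, the conditions make sense at poles and exclude them, as B = 0
    would force A = 0. Hence Z cannot run into a pole.\<close>
  define T where "T = {t\<in>{0..1}. A k (Z t) - X t * B k (Z t) = 0} \<inter> {t\<in>{0..1}. W k (Z t) - Y t * (B k (Z t))\<^sup>2 = 0}"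
  have T_iff: "t \<in> T \<longleftrightarrow> Z t \<notin> \<Lambda> \<and> X t = u (Z t) \<and> Y t = deriv u (Z t)" if "t \<in> {0..1}" for t
  proof (cases "B k (Z t) = 0")
    case True
    then have "A k (Z t) \<noteq> 0" using AB_nz by blast
    then show ?thesis using True pole_iff[OF Zk[OF that]] by (auto simp: T_def)
  next
    case False
    then have nl: "Z t \<notin> \<Lambda>" using pole_iff[OF Zk[OF that]] by simp
    show ?thesis using that nl u_eq[OF Zk[OF that]] deriv_u_k[OF nl Zk[OF that]] False
      by (auto simp: T_def field_simps)
  qed
  have im: "Z ` {0..1} \<subseteq> ball 0 (2 ^ k * r)" using Zk by auto
  have comp: "continuous_on {0..1} (\<lambda>t. f (Z t))" if "f holomorphic_on ball 0 (2 ^ k * r)" for f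
    using continuous_on_compose2[OF holomorphic_on_imp_continuous_on[OF that] cont(3) im] .
  have "closedin (top_of_set {0..1}) T"
    unfolding T_def
    by (intro closedin_Int continuous_closedin_preimage_constant continuous_intros comp AB_hol W_hol cont)
  moreover have "openin (top_of_set {0..1}) T"
    unfolding openin_euclidean_subtopology_iff
  proof (intro conjI ballI)
    show "T \<subseteq> {0..1}" by (auto simp: T_def)
    fix t1 assume t1T: "t1 \<in> T"
    then have t1: "t1 \<in> {0..1}" by (auto simp: T_def)
    have g: "Z t1 \<notin> \<Lambda>" "X t1 = u (Z t1)" "Y t1 = deriv u (Z t1)" using T_iff[OF t1] t1T by auto
    obtain e \<xi> where chart: "is_chart (Z t1) e \<xi>" using local_chart[OF g(1)] by blast
    then have e: "e > 0" "\<xi> (u (Z t1)) (deriv u (Z t1)) = Z t1"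
      and \<xi>: "\<And>x y. x \<in> ball (u (Z t1)) e \<Longrightarrow> y \<in> ball (deriv u (Z t1)) e \<Longrightarrow> y\<^sup>2 = 4 * x ^ 3 - g2 * x - g3 \<Longrightarrow>
        \<xi> x y \<notin> \<Lambda> \<and> u (\<xi> x y) = x \<and> deriv u (\<xi> x y) = y"
      unfolding is_chart_def by simp_all
    obtain d1 where d1: "d1 > 0" "\<And>t. t \<in> {0..1} \<Longrightarrow> dist t t1 < d1 \<Longrightarrow> dist (X t) (X t1) < e"
      using cont(1) t1 e(1) unfolding continuous_on_iff by blast
    obtain d2 where d2: "d2 > 0" "\<And>t. t \<in> {0..1} \<Longrightarrow> dist t t1 < d2 \<Longrightarrow> dist (Y t) (Y t1) < e"
      using cont(2) t1 e(1) unfolding continuous_on_iff by blast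
    define J where "J = {0..1} \<inter> ball t1 (min d1 d2)"
    have J: "convex J" "t1 \<in> J" "J \<subseteq> {0..1}" using t1 d1 d2 by (auto simp: J_def intro!: convex_Int)
    have XJ: "X t \<in> ball (u (Z t1)) e" and YJ: "Y t \<in> ball (deriv u (Z t1)) e" if "t \<in> J" for t
      using that d1(2)[of t] d2(2)[of t] g by (auto simp: J_def dist_commute)
    have cJ: "(Y t)\<^sup>2 = 4 * X t ^ 3 - g2 * X t - g3" if "t \<in> J" for t using curve that J(3) by blast
    have contJ: "continuous_on J X" "continuous_on J Y" "continuous_on J Z" using cont J(3) continuous_on_subset by blast+
    have D: "continuous_on J (\<lambda>t. \<xi> (X t) (Y t)) \<and>
       (\<forall>t\<in>J. (X has_vector_derivative Y t * p t) (at t) \<longrightarrow> (Y has_vector_derivative (6 * (X t)\<^sup>2 - g2 / 2) * p t) (at t) \<longrightarrow>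
          ((\<lambda>t. \<xi> (X t) (Y t)) has_vector_derivative p t) (at t))"
      using chart contJ(1,2) XJ YJ cJ unfolding is_chart_def by blast
    have eq: "\<xi> (X t) (Y t) = Z t" if t: "t \<in> J" for t
    proof (rule vector_derivative_eq_imp_eq[OF J(1,2), of "S \<union> {0, 1}" "\<lambda>t. \<xi> (X t) (Y t)" Z p])
      show "finite (S \<union> {0, 1})" using fin by simp
      show "continuous_on J (\<lambda>t. \<xi> (X t) (Y t))" using D by blast
      fix t assume "t \<in> J - (S \<union> {0, 1})"
      then have tt: "t \<in> J" "t \<in> {0<..<1} - S" using J(3) by (auto simp: less_le)
      show "((\<lambda>t. \<xi> (X t) (Y t)) has_vector_derivative p t) (at t)"
        using D tt(1) dX[OF tt(2)] dY[OF tt(2)] by blast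
      show "(Z has_vector_derivative p t) (at t)" by (rule dZ[OF tt(2)])
    qed (use e g t contJ in auto)
    have "t' \<in> T" if "t' \<in> {0..1}" "dist t' t1 < min d1 d2" for t'
    proof -
      have tJ: "t' \<in> J" using that by (simp add: J_def dist_commute)
      show ?thesis using T_iff[OF that(1)] \<xi>[OF XJ[OF tJ] YJ[OF tJ] cJ[OF tJ]] eq[OF tJ] by simp
    qed
    then show "\<exists>e>0. \<forall>x'\<in>{0..1}. dist x' t1 < e \<longrightarrow> x' \<in> T" using d1(1) d2(1) by (intro exI[of _ "min d1 d2"]) auto
  qed
  moreover have "t0 \<in> T" using T_iff[OF t0(1)] t0 by simp
  ultimately have "T = {0..1}"
    using connected_Icc[of 0 "1::real"] unfolding connected_clopen by blast
  then show ?thesis using T_iff[OF t] t by blast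
qed

end

section \<open>Surjectivity of the uniformization and periods of closed paths\<close>

context weierstrass_germ
begin

abbreviation cubic :: "complex \<Rightarrow> complex" where "cubic x \<equiv> 4 * x ^ 3 - g2 * x - g3"

lemma cubic_smooth: "cubic x = 0 \<Longrightarrow> 6 * x\<^sup>2 - g2 / 2 \<noteq> 0"
proof
  assume "cubic x = 0" "6 * x\<^sup>2 - g2 / 2 = 0"
  moreover from this have "12 * x\<^sup>2 - g2 = 2 * (6 * x\<^sup>2 - g2 / 2)" by simp
  ultimately show False using cubic_no_common_root[of x g2 g3] disc by simp
qed

lemma finite_cubic_roots: "finite {x. cubic x = 0}"
proof -
  have "{x. cubic x = 0} = {x. poly [:- g3, - g2, 0, 4:] x = 0}"
    by (simp add: algebra_simps power3_eq_cube)
  also have "finite \<dots>" by (rule poly_roots_finite) simp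
  finally show ?thesis .
qed

lemma ex_regular_point: obtains b where "b \<notin> \<Lambda>" "cubic (u b) \<noteq> 0"
proof -
  have "of_real (r / 2) \<in> ball (0::complex) r" "(of_real (r / 2) :: complex) \<noteq> 0" using r by auto
  then obtain b where b: "b \<in> ball 0 r" "deriv w b \<noteq> 0"
    using ex_deriv_nonzero[OF w_hol, of "of_real (r / 2)"] w_nz w0 by metis
  then have "b \<noteq> 0" using w1_0 by auto
  then have wb: "w b \<noteq> 0" "b \<notin> \<Lambda>" using w_nz pole_local b by auto
  have "(deriv w b)\<^sup>2 = w b ^ 4 * cubic (1 / w b)"
    unfolding w_ode[OF b(1)] using wb by (simp add: field_simps power3_eq_cube power4_eq_xxxx)
  then have "cubic (1 / w b) \<noteq> 0" using b(2) by auto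
  then show ?thesis using that[of b] wb u_local[OF b(1)] by simp
qed

text \<open>A path from a known value u(z1) to x0 avoiding the branch points is lifted, using a
  square root Y of the cubic along it and Z as the integral of dX/Y. Evenness of u corrects the sign
  of u' at the end.\<close>

lemma uniformization_surj:
  assumes x0: "cubic x0 \<noteq> 0" and y0: "y0\<^sup>2 = cubic x0"
  obtains z where "z \<notin> \<Lambda>" "u z = x0" "deriv u z = y0"
proof -
  obtain z1 where z1: "z1 \<notin> \<Lambda>" "cubic (u z1) \<noteq> 0" by (rule ex_regular_point)
  define S where "S = - {x. cubic x = 0}"
  have S: "open S" "connected S"
  proof -
    show "open S" unfolding S_def using finite_cubic_roots by (simp add: finite_imp_closed open_Compl)
    have "path_connected (UNIV - {x. cubic x = 0})"
      using finite_cubic_roots by (intro path_connected_open_diff_countable) (auto intro: countable_finite)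
    then show "connected S" unfolding S_def Compl_eq_Diff_UNIV by (rule path_connected_imp_connected)
  qed
  have "u z1 \<in> S" "x0 \<in> S" using z1 x0 by (auto simp: S_def)
  then obtain g where g: "polynomial_function g" "path_image g \<subseteq> S" "pathstart g = u z1" "pathfinish g = x0"
    using connected_open_polynomial_connected[OF S] by metis
  obtain g' where g': "polynomial_function g'" "\<And>t. (g has_vector_derivative g' t) (at t)"
    using has_vector_derivative_polynomial_function[OF g(1)] by metis
  have contg: "continuous_on {0..1} g" "continuous_on {0..1} g'"
    using g(1) g'(1) continuous_on_polymonial_function by auto
  have gS: "cubic (g t) \<noteq> 0" if "t \<in> {0..1}" for t
  proof -
    have "g t \<in> S" using g(2) that unfolding path_image_def by blast
    then show ?thesis unfolding S_def by blast
  qed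
  \<comment> \<open>Half the logarithmic derivative of the cubic along g; the exponential of its
    integral gives the continuous square root.\<close>
  define q where "q = (\<lambda>t. (6 * (g t)\<^sup>2 - g2 / 2) * g' t / cubic (g t))"
  have contq: "continuous_on {0..1} q" unfolding q_def by (intro continuous_intros contg ballI gS)
  define G where "G = (\<lambda>t. integral {0..t} q)"
  have contG: "continuous_on {0..1} G"
    unfolding G_def by (rule indefinite_integral_continuous_1[OF integrable_continuous_real[OF contq]])
  have interior: "((\<lambda>t. integral {0..t} f) has_vector_derivative f t) (at t)"
    if "continuous_on {0..1} f" "t \<in> {0<..<1}" for f :: "real \<Rightarrow> complex" and t
  proof -
    have "((\<lambda>t. integral {0..t} f) has_vector_derivative f t) (at t within {0..1})"
      using that by (intro integral_has_vector_derivative) auto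
    then show ?thesis using that(2) at_within_interior[of t "{0..1}"] by simp
  qed
  have DG: "(G has_vector_derivative q t) (at t)" if "t \<in> {0<..<1}" for t
    unfolding G_def by (rule interior[OF contq that])
  define y1 where "y1 = deriv u z1"
  have y1: "y1\<^sup>2 = cubic (u z1)" using u_ode[OF z1(1)] by (simp add: y1_def)
  then have y1nz: "y1 \<noteq> 0" using z1(2) by auto
  define Y where "Y = (\<lambda>t. y1 * exp (G t))"
  have contY: "continuous_on {0..1} Y" unfolding Y_def by (intro continuous_intros contG)
  have Ynz: "Y t \<noteq> 0" for t using y1nz by (simp add: Y_def)
  have DY: "(Y has_vector_derivative q t * Y t) (at t)" if "t \<in> {0<..<1}" for t
  proof -
    have "((\<lambda>x. y1 * exp x) has_field_derivative y1 * exp (G t)) (at (G t))" by (auto intro!: derivative_eq_intros)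
    from field_vector_diff_chain_at[OF DG[OF that] this] show ?thesis by (simp add: o_def Y_def)
  qed
  have curve: "(Y t)\<^sup>2 = cubic (g t)" if t: "t \<in> {0..1}" for t
  proof -
    define R where "R = (\<lambda>t. cubic (g t) * inverse (Y t * Y t))"
    have "R t = 1"
    proof (rule vector_derivative_eq_imp_eq[of "{0..1}" 0 "{0, 1}" R "\<lambda>_. 1" "\<lambda>_. 0"])
      show "continuous_on {0..1} R" unfolding R_def by (intro continuous_intros contg contY) (use Ynz in auto)
      have "cubic (g 0) = y1 * y1" using g(3) y1 by (simp add: pathstart_def power2_eq_square)
      moreover have "Y 0 = y1" by (simp add: Y_def G_def)
      ultimately have "R 0 = (y1 * y1) * inverse (y1 * y1)" unfolding R_def by metis
      moreover have "y1 * y1 \<noteq> 0" using y1nz by simp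
      ultimately show "R 0 = 1" by (simp only: right_inverse not_False_eq_True)
      fix t :: real assume "t \<in> {0..1} - {0, 1}"
      then have t: "t \<in> {0<..<1}" "t \<in> {0..1}" by auto
      have "((\<lambda>x. cubic x) has_field_derivative 12 * (g t)\<^sup>2 - g2) (at (g t))"
        by (rule derivative_eq_intros refl | simp)+
      from field_vector_diff_chain_at[OF g'(2)[of t] this]
      have d1: "((\<lambda>t. cubic (g t)) has_vector_derivative g' t * (12 * (g t)\<^sup>2 - g2)) (at t)" by (simp add: o_def)
      have "((\<lambda>x. inverse (x * x)) has_field_derivative - (inverse (Y t * Y t) * (Y t + Y t) * inverse (Y t * Y t))) (at (Y t))"
        using Ynz[of t] by (auto intro!: derivative_eq_intros)
      from field_vector_diff_chain_at[OF DY[OF t(1)] this]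
      have d2: "((\<lambda>t. inverse (Y t * Y t)) has_vector_derivative q t * Y t * - (inverse (Y t * Y t) * (Y t + Y t) * inverse (Y t * Y t))) (at t)"
        by (simp add: o_def)
      have "cubic (g t) * (q t * Y t * - (inverse (Y t * Y t) * (Y t + Y t) * inverse (Y t * Y t))) + g' t * (12 * (g t)\<^sup>2 - g2) * inverse (Y t * Y t) = 0"
      proof -
        have "cubic (g t) * q t = (6 * (g t)\<^sup>2 - g2 / 2) * g' t" using gS[OF t(2)] by (simp add: q_def)
        moreover have "Y t * - (inverse (Y t * Y t) * (Y t + Y t) * inverse (Y t * Y t)) = - 2 * inverse (Y t * Y t)"
          using Ynz[of t] by (simp add: divide_simps)
        ultimately have "cubic (g t) * (q t * Y t * - (inverse (Y t * Y t) * (Y t + Y t) * inverse (Y t * Y t)))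
            = ((6 * (g t)\<^sup>2 - g2 / 2) * g' t) * (- 2 * inverse (Y t * Y t))"
          by (metis mult.assoc)
        then show ?thesis by (simp add: algebra_simps)
      qed
      then show "(R has_vector_derivative 0) (at t)"
        unfolding R_def using has_vector_derivative_mult[OF d1 d2] by (simp only:)
    qed (use t in auto)
    then have "cubic (g t) * inverse (Y t * Y t) * (Y t * Y t) = Y t * Y t" by (simp add: R_def)
    moreover have "inverse (Y t * Y t) * (Y t * Y t) = 1" using Ynz[of t] by (intro left_inverse) simp
    ultimately show ?thesis by (metis mult.assoc mult_1_right power2_eq_square)
  qed
  define p where "p = (\<lambda>t. g' t / Y t)"
  have contp: "continuous_on {0..1} p" unfolding p_def by (intro continuous_intros contg contY) (use Ynz in auto)
  define Z where "Z = (\<lambda>t. z1 + integral {0..t} p)"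
  have "Z 1 \<notin> \<Lambda> \<and> g 1 = u (Z 1) \<and> Y 1 = deriv u (Z 1)"
  proof (rule path_lift[of g Y Z "{}" p 0])
    show "continuous_on {0..1} Z" unfolding Z_def
      by (intro continuous_intros indefinite_integral_continuous_1 integrable_continuous_real contp)
    fix t :: real assume "t \<in> {0<..<1} - {}"
    then have t: "t \<in> {0<..<1}" "t \<in> {0..1}" by auto
    show "(g has_vector_derivative Y t * p t) (at t)" using g'(2)[of t] Ynz[of t] by (simp add: p_def)
    have "q t * Y t = (6 * (g t)\<^sup>2 - g2 / 2) * p t"
    proof -
      have "q t = (6 * (g t)\<^sup>2 - g2 / 2) * g' t / (Y t * Y t)"
        unfolding q_def curve[OF t(2), symmetric] power2_eq_square ..
      then show ?thesis using Ynz[of t] by (simp add: p_def)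
    qed
    then show "(Y has_vector_derivative (6 * (g t)\<^sup>2 - g2 / 2) * p t) (at t)" using DY[OF t(1)] by simp
    show "(Z has_vector_derivative p t) (at t)"
      unfolding Z_def using has_vector_derivative_add[OF has_vector_derivative_const interior[OF contp t(1)]] by simp
  next
    show "g 0 = u (Z 0)" "Y 0 = deriv u (Z 0)" "Z 0 \<notin> \<Lambda>"
      using g(3) z1(1) by (simp_all add: Z_def Y_def G_def y1_def pathstart_def)
  qed (use contg contY curve in simp_all)
  then have Z1: "Z 1 \<notin> \<Lambda>" "u (Z 1) = x0" "deriv u (Z 1) = Y 1" using g(4) by (auto simp: pathfinish_def)
  have "(deriv u (Z 1))\<^sup>2 = y0\<^sup>2" using u_ode[OF Z1(1)] Z1(2) y0 by simp
  then consider "deriv u (Z 1) = y0" | "deriv u (Z 1) = - y0" using power2_eq_iff by blast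
  then show ?thesis
  proof cases
    case 1
    then show ?thesis using that Z1 by blast
  next
    case 2
    then show ?thesis using that[of "- Z 1"] Z1 pole_minus u_even deriv_u_odd by simp
  qed
qed

text \<open>The endpoints of a lift Z have the same (u, u'), so their difference, which is the
  integral, is a pole by \<open>period_pole\<close>.\<close>

lemma closed_path_period:
  fixes X Y p :: "real \<Rightarrow> complex"
  assumes cont: "continuous_on {0..1} X" "continuous_on {0..1} Y"
    and fin: "finite S"
    and dX: "\<And>t. t \<in> {0<..<1} - S \<Longrightarrow> (X has_vector_derivative Y t * p t) (at t)"
    and dY: "\<And>t. t \<in> {0<..<1} - S \<Longrightarrow> (Y has_vector_derivative (6 * (X t)\<^sup>2 - g2 / 2) * p t) (at t)"
    and contp: "continuous_on ({0<..<1} - S) p"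
    and curve: "\<And>t. t \<in> {0..1} \<Longrightarrow> (Y t)\<^sup>2 = cubic (X t)"
    and closed: "X 0 = X 1" "Y 0 = Y 1"
  shows "integral {0..1} p \<in> \<Lambda>"
proof (cases "p integrable_on {0..1}")
  \<comment> \<open>The integral of a nonintegrable function is 0 by convention, and 0 is a
    pole.\<close>
  case False
  then show ?thesis using zero_pole by (simp add: not_integrable_integral)
next
  case int: True
  have op: "open ({0<..<1} - S)" using fin by (simp add: open_Diff finite_imp_closed)
  show ?thesis
  proof (cases "\<exists>t0\<in>{0..1}. Y t0 \<noteq> 0")
    case True
    then obtain t0 where t0: "t0 \<in> {0..1}" "Y t0 \<noteq> 0" by blast
    obtain z1 where z1: "z1 \<notin> \<Lambda>" "u z1 = X t0" "deriv u z1 = Y t0"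
      using uniformization_surj[of "X t0" "Y t0"] curve[OF t0(1)] t0(2) by (metis power2_eq_square mult_eq_0_iff)
    \<comment> \<open>The constant makes Z(t0) = z1. The lift is anchored at t0 rather than at 0
      because \<open>uniformization_surj\<close> asks for Y \<noteq> 0.\<close>
    define Z where "Z = (\<lambda>t. (z1 - integral {0..t0} p) + integral {0..t} p)"
    have all: "Z t \<notin> \<Lambda> \<and> X t = u (Z t) \<and> Y t = deriv u (Z t)" if t: "t \<in> {0..1}" for t
    proof (rule path_lift[OF cont _ fin dX dY _ curve t0(1) _ _ _ t])
      show "continuous_on {0..1} Z" unfolding Z_def
        by (intro continuous_intros indefinite_integral_continuous_1 int)
      fix t assume t: "t \<in> {0<..<1} - S"
      have "continuous (at t) p" using contp op t by (simp add: continuous_on_eq_continuous_at)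
      then have "((\<lambda>u. integral {0..u} p) has_vector_derivative p t) (at t within {0..1} - {})"
        using int t by (intro integral_has_vector_derivative_continuous_at) (auto intro: continuous_at_imp_continuous_at_within)
      then have "((\<lambda>u. integral {0..u} p) has_vector_derivative p t) (at t)"
        using t at_within_interior[of t "{0..1}"] by simp
      then show "(Z has_vector_derivative p t) (at t)"
        unfolding Z_def using has_vector_derivative_add[OF has_vector_derivative_const] by fastforce
    qed (use z1 in \<open>auto simp: Z_def\<close>)
    have Z1: "Z 1 = Z 0 + integral {0..1} p" by (simp add: Z_def)
    show ?thesis
      by (rule period_pole[of "Z 0"]) (use all[of 0] all[of 1] closed Z1 in auto)
  next
    \<comment> \<open>If Y vanishes identically, X stays at simple roots of the cubic and Y' = (6
      X^2 - g2/2) p forces p = 0.\<close>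
    case False
    then have Y0: "Y t = 0" if "t \<in> {0..1}" for t using that by blast
    have p0: "p t = 0" if t: "t \<in> {0<..<1} - S" for t
    proof -
      have "(Y has_vector_derivative 0) (at t)"
      proof -
        have "((\<lambda>_. 0) has_vector_derivative (0::complex)) (at t)" by simp
        then show ?thesis
          by (rule has_vector_derivative_transform_within_open[OF _ open_greaterThanLessThan[of 0 1]]) (use t Y0 in auto)
      qed
      then have "(6 * (X t)\<^sup>2 - g2 / 2) * p t = 0" using dY[OF t] vector_derivative_unique_at by blast
      moreover have "cubic (X t) = 0" using curve[of t] Y0[of t] t by simp
      ultimately show ?thesis using cubic_smooth by simp
    qed
    have "(p has_integral 0) {0..1}"
      by (rule has_integral_spike_finite[of "S \<union> {0, 1}" _ _ "\<lambda>_. 0"]) (use p0 fin in \<open>auto simp: less_le\<close>)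
    then show ?thesis using zero_pole by (simp add: integral_unique)
  qed
qed

end

section \<open>The period lattice of a Weierstrass curve\<close>

definition curve_b4 :: "weierstrass_curve \<Rightarrow> complex" where
  "curve_b4 E = 2 * coeff_a4 E + coeff_a1 E * coeff_a3 E"
definition curve_b6 :: "weierstrass_curve \<Rightarrow> complex" where
  "curve_b6 E = (coeff_a3 E)\<^sup>2 + 4 * coeff_a6 E"
definition curve_shift :: "weierstrass_curve \<Rightarrow> complex" where
  "curve_shift E = ((coeff_a1 E)\<^sup>2 + 4 * coeff_a2 E) / 12"
text \<open>\<open>curve_h2\<close> and \<open>curve_h3\<close> are g2 and g3 of the normal form for
  c = 1, in the coordinates x + b2/12 and 2 y + a1 x + a3.\<close>

definition curve_h2 :: "weierstrass_curve \<Rightarrow> complex" where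
  "curve_h2 E = 12 * (curve_shift E)\<^sup>2 - 2 * curve_b4 E"
definition curve_h3 :: "weierstrass_curve \<Rightarrow> complex" where
  "curve_h3 E = 2 * curve_b4 E * curve_shift E - 8 * curve_shift E ^ 3 - curve_b6 E"

text \<open>The substitution \<open>X = (x + b\<^sub>2/12)/c\<^sup>2\<close>, \<open>Y = (2 y + a\<^sub>1 x + a\<^sub>3)/c\<^sup>3\<close> turns \<open>c dx/(2 y + a\<^sub>1 x + a\<^sub>3)\<close> into \<open>dX/Y\<close>.\<close>

definition curve_g2 :: "weierstrass_curve \<Rightarrow> complex \<Rightarrow> complex" where "curve_g2 E c = curve_h2 E / c ^ 4"
definition curve_g3 :: "weierstrass_curve \<Rightarrow> complex \<Rightarrow> complex" where "curve_g3 E c = curve_h3 E / c ^ 6"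
definition curve_X :: "weierstrass_curve \<Rightarrow> complex \<Rightarrow> complex \<Rightarrow> complex" where
  "curve_X E c x = (x + curve_shift E) / c\<^sup>2"
definition curve_Y :: "weierstrass_curve \<Rightarrow> complex \<Rightarrow> complex \<Rightarrow> complex \<Rightarrow> complex" where
  "curve_Y E c x y = (2 * y + coeff_a1 E * x + coeff_a3 E) / c ^ 3"

text \<open>Eliminating a2, a4, a6 in favour of b2/12, b4, b6 turns the claims below into polynomial
  identities in independent quantities.\<close>

lemma curve_coeffs:
  "coeff_a2 E = 3 * curve_shift E - (coeff_a1 E)\<^sup>2 / 4"
  "coeff_a4 E = (curve_b4 E - coeff_a1 E * coeff_a3 E) / 2"
  "coeff_a6 E = (curve_b6 E - (coeff_a3 E)\<^sup>2) / 4"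
  by (simp_all add: curve_shift_def curve_b4_def curve_b6_def field_simps)

lemma curve_eqn_normal:
  "4 * curve_eqn E x y = (2 * y + coeff_a1 E * x + coeff_a3 E)\<^sup>2
     - (4 * (x + curve_shift E) ^ 3 - curve_h2 E * (x + curve_shift E) - curve_h3 E)"
  unfolding curve_eqn_def curve_h2_def curve_h3_def curve_coeffs
  by (simp add: field_simps power2_eq_square power3_eq_cube)

lemma curve_eqn_dx_normal:
  "4 * curve_eqn_dx E x y = 2 * coeff_a1 E * (2 * y + coeff_a1 E * x + coeff_a3 E)
     - (12 * (x + curve_shift E)\<^sup>2 - curve_h2 E)"
  unfolding curve_eqn_dx_def curve_h2_def curve_coeffs
  by (simp add: field_simps power2_eq_square)

lemma discriminant_normal: "discriminant E = curve_h2 E ^ 3 - 27 * (curve_h3 E)\<^sup>2"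
proof -
  define s b4 b6 where "s = curve_shift E" and "b4 = curve_b4 E" and "b6 = curve_b6 E"
  define b8 where "b8 = (coeff_a1 E)\<^sup>2 * coeff_a6 E + 4 * coeff_a2 E * coeff_a6 E - coeff_a1 E * coeff_a3 E * coeff_a4 E + coeff_a2 E * (coeff_a3 E)\<^sup>2 - (coeff_a4 E)\<^sup>2"
  \<comment> \<open>The classical relation 4 b8 = b2 b6 - b4^2.\<close>
  have b8: "b8 = (12 * s * b6 - b4\<^sup>2) / 4"
    unfolding b8_def curve_coeffs s_def b4_def b6_def by (simp add: field_simps power2_eq_square)
  have b2: "(coeff_a1 E)\<^sup>2 + 4 * coeff_a2 E = 12 * s" by (simp add: s_def curve_shift_def)
  have "discriminant E = - ((12 * s)\<^sup>2 * b8) - 8 * b4 ^ 3 - 27 * b6\<^sup>2 + 9 * (12 * s) * b4 * b6"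
    by (simp only: discriminant_def Let_def b2 b8_def b4_def b6_def curve_b4_def curve_b6_def)
  also have "\<dots> = curve_h2 E ^ 3 - 27 * (curve_h3 E)\<^sup>2"
    unfolding b8 curve_h2_def curve_h3_def s_def[symmetric] b4_def[symmetric] b6_def[symmetric]
    by (simp add: field_simps power2_eq_square power3_eq_cube)
  finally show ?thesis .
qed

lemma curve_g_disc:
  assumes "discriminant E \<noteq> 0" "c \<noteq> 0"
  shows "curve_g2 E c ^ 3 \<noteq> 27 * (curve_g3 E c)\<^sup>2"
proof
  assume "curve_g2 E c ^ 3 = 27 * (curve_g3 E c)\<^sup>2"
  then have "curve_h2 E ^ 3 / c ^ 12 = 27 * (curve_h3 E)\<^sup>2 / c ^ 12"
    by (simp add: curve_g2_def curve_g3_def power_divide flip: power_mult)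
  then show False using assms discriminant_normal[of E] by (simp add: field_simps)
qed

lemma curve_normal_form:
  assumes "c \<noteq> 0"
  shows "curve_eqn E x y = 0 \<longleftrightarrow> (curve_Y E c x y)\<^sup>2 = 4 * curve_X E c x ^ 3 - curve_g2 E c * curve_X E c x - curve_g3 E c"
proof -
  define Y0 x0 where "Y0 = 2 * y + coeff_a1 E * x + coeff_a3 E" and "x0 = x + curve_shift E"
  have "curve_eqn E x y = 0 \<longleftrightarrow> 4 * curve_eqn E x y = 0" by simp
  also have "\<dots> \<longleftrightarrow> Y0\<^sup>2 = 4 * x0 ^ 3 - curve_h2 E * x0 - curve_h3 E"
    unfolding curve_eqn_normal Y0_def x0_def by simp
  also have "\<dots> \<longleftrightarrow> Y0\<^sup>2 / c ^ 6 = (4 * x0 ^ 3 - curve_h2 E * x0 - curve_h3 E) / c ^ 6"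
    using assms by simp
  also have "Y0\<^sup>2 / c ^ 6 = (curve_Y E c x y)\<^sup>2" by (simp add: curve_Y_def Y0_def power_divide flip: power_mult)
  also have "(4 * x0 ^ 3 - curve_h2 E * x0 - curve_h3 E) / c ^ 6 = 4 * curve_X E c x ^ 3 - curve_g2 E c * curve_X E c x - curve_g3 E c"
    unfolding curve_X_def x0_def[symmetric] curve_g2_def curve_g3_def
    by (simp add: diff_divide_distrib power_divide flip: power_mult power_add)
  finally show ?thesis .
qed

text \<open>The differential is dX/Y and also dY/(6 X^2 - g2/2). Where Y = 0, the differentiated
  curve equation 2 Y Y' = (12 X^2 - g2) X' forces X' = 0, and the second branch of
  \<open>differential_pullback\<close> takes over.\<close>

lemma pullback_normal:
  assumes c: "c \<noteq> 0" and disc: "discriminant E \<noteq> 0"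
    and dx: "(x has_vector_derivative x') (at t)" and dy: "(y has_vector_derivative y') (at t)"
    and T: "open T" "t \<in> T" and curve: "\<And>s. s \<in> T \<Longrightarrow> curve_eqn E (x s) (y s) = 0"
  defines "p \<equiv> differential_pullback E c x y t"
    and "X \<equiv> \<lambda>s. curve_X E c (x s)" and "Y \<equiv> \<lambda>s. curve_Y E c (x s) (y s)"
  shows "(X has_vector_derivative Y t * p) (at t)"
    "(Y has_vector_derivative (6 * (X t)\<^sup>2 - curve_g2 E c / 2) * p) (at t)"
proof -
  define X' Y' where "X' = x' / c\<^sup>2" and "Y' = (2 * y' + coeff_a1 E * x') / c ^ 3"
  have dX: "(X has_vector_derivative X') (at t)"
    unfolding X_def X'_def curve_X_def
    by (auto intro!: derivative_eq_intros dx simp: divide_inverse)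
  have dY: "(Y has_vector_derivative Y') (at t)"
    unfolding Y_def Y'_def curve_Y_def
    by (auto intro!: derivative_eq_intros dx dy simp: divide_inverse)
  have curveXY: "(Y s)\<^sup>2 = 4 * X s ^ 3 - curve_g2 E c * X s - curve_g3 E c" if "s \<in> T" for s
    using curve[OF that] curve_normal_form[OF c] by (simp add: X_def Y_def)
  have "((\<lambda>y. y\<^sup>2) has_field_derivative 2 * Y t) (at (Y t))" by (auto intro!: derivative_eq_intros)
  from field_vector_diff_chain_at[OF dY this]
  have "((\<lambda>s. (Y s)\<^sup>2) has_vector_derivative Y' * (2 * Y t)) (at t)" by (simp add: o_def)
  then have l: "((\<lambda>s. 4 * X s ^ 3 - curve_g2 E c * X s - curve_g3 E c) has_vector_derivative Y' * (2 * Y t)) (at t)"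
    by (rule has_vector_derivative_transform_within_open[OF _ T]) (use curveXY in simp)
  have "((\<lambda>x. 4 * x ^ 3 - curve_g2 E c * x - curve_g3 E c) has_field_derivative 12 * (X t)\<^sup>2 - curve_g2 E c) (at (X t))"
    by (auto intro!: derivative_eq_intros)
  from field_vector_diff_chain_at[OF dX this]
  have "((\<lambda>s. 4 * X s ^ 3 - curve_g2 E c * X s - curve_g3 E c) has_vector_derivative X' * (12 * (X t)\<^sup>2 - curve_g2 E c)) (at t)"
    by (simp add: o_def)
  with l have rel: "Y' * (2 * Y t) = X' * (12 * (X t)\<^sup>2 - curve_g2 E c)" by (rule vector_derivative_unique_at)
  have Fy: "curve_eqn_dy E (x t) (y t) = c ^ 3 * Y t" using c by (simp add: Y_def curve_Y_def curve_eqn_dy_def)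
  have vd: "vector_derivative x (at t) = x'" "vector_derivative y (at t) = y'"
    using dx dy vector_derivative_at by blast+
  have "X' = Y t * p \<and> Y' = (6 * (X t)\<^sup>2 - curve_g2 E c / 2) * p"
  proof (cases "Y t = 0")
    case False
    then have p: "p = x' / (c\<^sup>2 * Y t)"
      using c by (simp add: p_def differential_pullback_def Fy vd power2_eq_square power3_eq_cube)
    have X: "X' = Y t * p" using False c by (simp add: p X'_def)
    have "Y t * (2 * Y') = Y t * (2 * ((6 * (X t)\<^sup>2 - curve_g2 E c / 2) * p))"
      using rel unfolding X by (simp add: algebra_simps)
    then show ?thesis using False X by simp
  next
    case True
    have nz: "12 * (X t)\<^sup>2 - curve_g2 E c \<noteq> 0"
      using cubic_no_common_root[of "X t" "curve_g2 E c" "curve_g3 E c"] curveXY[OF T(2)] True curve_g_disc[OF disc c] by auto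
    then have "X' = 0" using rel True by simp
    then have x': "x' = 0" using c by (simp add: X'_def)
    have Y': "Y' = 2 * y' / c ^ 3" by (simp add: Y'_def x')
    have "2 * y t + coeff_a1 E * x t + coeff_a3 E = 0" using Fy True by (simp add: curve_eqn_dy_def)
    then have "4 * curve_eqn_dx E (x t) (y t) = - (12 * (x t + curve_shift E)\<^sup>2 - curve_h2 E)"
      using curve_eqn_dx_normal[of E "x t" "y t"] by simp
    also have "\<dots> = - (c ^ 4 * (12 * (X t)\<^sup>2 - curve_g2 E c))"
      using c by (simp add: X_def curve_X_def curve_g2_def power_divide right_diff_distrib flip: power_mult)
    finally have "4 * curve_eqn_dx E (x t) (y t) / 4 = - (c ^ 4 * (12 * (X t)\<^sup>2 - curve_g2 E c)) / 4" by (simp only:)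
    then have Fx: "curve_eqn_dx E (x t) (y t) = - (c ^ 4 * (12 * (X t)\<^sup>2 - curve_g2 E c)) / 4"
      by (simp only: nonzero_mult_div_cancel_left zero_neq_numeral[symmetric] not_False_eq_True)
    define D where "D = 12 * (X t)\<^sup>2 - curve_g2 E c"
    have "p = - (c * y' / (- (c ^ 4 * D) / 4))"
      using True by (simp add: p_def differential_pullback_def Fy vd Fx D_def)
    then have p: "p = 4 * y' / (c ^ 3 * D)" using c nz by (simp add: D_def[symmetric] field_simps power3_eq_cube power4_eq_xxxx)
    have half: "6 * (X t)\<^sup>2 - curve_g2 E c / 2 = D / 2" by (simp add: D_def)
    have "Y' = (6 * (X t)\<^sup>2 - curve_g2 E c / 2) * p" unfolding half Y' p using c nz by (simp add: D_def[symmetric])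
    then show ?thesis using True \<open>X' = 0\<close> by simp
  qed
  then show "(X has_vector_derivative Y t * p) (at t)"
    "(Y has_vector_derivative (6 * (X t)\<^sup>2 - curve_g2 E c / 2) * p) (at t)"
    using dX dY by simp_all
qed

lemma fsigma_open:
  fixes S :: "'a::euclidean_space set"
  assumes "open S" shows "fsigma S"
  by (rule open_Union_compact_subsets[OF assms]) (metis fsigma_Union_compact image_subset_iff mem_Collect_eq)

section \<open>Periods of the differential as poles of the continued function\<close>

locale weierstrass_uniformization = weierstrass_germ "curve_g2 E c" "curve_g3 E c" r w for E c r w +
  assumes c: "c \<noteq> 0" and discE: "discriminant E \<noteq> 0"
begin

lemma period_imp_pole:
  assumes path: "closed_path_on E x y"
  shows "integral {0..1} (differential_pullback E c x y) \<in> \<Lambda>"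
proof -
  define p where "p = differential_pullback E c x y"
  define X where "X = (\<lambda>s. curve_X E c (x s))"
  define Y where "Y = (\<lambda>s. curve_Y E c (x s) (y s))"
  have vx: "valid_path x" "valid_path y" and cl: "x 1 = x 0" "y 1 = y 0"
    and cv: "\<And>t. t \<in> {0..1} \<Longrightarrow> curve_eqn E (x t) (y t) = 0"
    using path by (auto simp: closed_path_on_def pathstart_def pathfinish_def)
  obtain S1 D1 where S1: "finite S1" "\<And>t. t \<in> {0..1} - S1 \<Longrightarrow> (x has_vector_derivative D1 t) (at t)" "continuous_on ({0..1} - S1) D1" "continuous_on {0..1} x"
    using vx(1) unfolding valid_path_def piecewise_C1_differentiable_on_def C1_differentiable_on_def by blast
  obtain S2 D2 where S2: "finite S2" "\<And>t. t \<in> {0..1} - S2 \<Longrightarrow> (y has_vector_derivative D2 t) (at t)" "continuous_on ({0..1} - S2) D2" "continuous_on {0..1} y"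
    using vx(2) unfolding valid_path_def piecewise_C1_differentiable_on_def C1_differentiable_on_def by blast
  define S where "S = S1 \<union> S2"
  define T where "T = {0<..<1} - S"
  have fin: "finite S" using S1 S2 by (simp add: S_def)
  have opT: "open T" unfolding T_def using fin by (simp add: open_Diff finite_imp_closed)
  have dx: "(x has_vector_derivative D1 t) (at t)" "(y has_vector_derivative D2 t) (at t)" if "t \<in> T" for t
    using that S1(2) S2(2) by (auto simp: T_def S_def)
  have contD: "continuous_on T D1" "continuous_on T D2"
    by (rule continuous_on_subset[OF S1(3)], force simp: T_def S_def, rule continuous_on_subset[OF S2(3)], force simp: T_def S_def)
  have contx: "continuous_on T x" "continuous_on T y"
    by (rule continuous_on_subset[OF S1(4)], force simp: T_def S_def, rule continuous_on_subset[OF S2(4)], force simp: T_def S_def)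
  have dXY: "(X has_vector_derivative Y t * p t) (at t)" "(Y has_vector_derivative (6 * (X t)\<^sup>2 - curve_g2 E c / 2) * p t) (at t)"
    if t: "t \<in> T" for t
    unfolding X_def Y_def p_def
    by (rule pullback_normal[OF c discE dx[OF t] opT t]; use cv in \<open>auto simp: T_def\<close>)+
  have curve: "(Y t)\<^sup>2 = 4 * X t ^ 3 - curve_g2 E c * X t - curve_g3 E c" if "t \<in> {0..1}" for t
    using cv[OF that] curve_normal_form[OF c] by (simp add: X_def Y_def)
  have "integral {0..1} p \<in> \<Lambda>"
  proof (rule closed_path_period[of X Y S p])
    show "continuous_on {0..1} X" "continuous_on {0..1} Y"
      unfolding X_def Y_def curve_X_def curve_Y_def using c by (intro continuous_intros S1(4) S2(4); simp)+
    define d where "d = (\<lambda>t. 6 * (X t)\<^sup>2 - curve_g2 E c / 2)"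
    \<comment> \<open>p is defined by cases, so its continuity is not apparent where Y = 0. From X'
      = Y p and Y' = d p follows p = (X' cnj Y + Y' cnj d)/(|Y|^2 + |d|^2), without cases;
      smoothness of the cubic keeps the denominator nonzero.\<close>
    define N where "N = (\<lambda>t. Y t * cnj (Y t) + d t * cnj (d t))"
    have Nnz: "N t \<noteq> 0" if "t \<in> T" for t
    proof
      assume "N t = 0"
      then have "of_real ((norm (Y t))\<^sup>2 + (norm (d t))\<^sup>2) = (0::complex)"
        unfolding N_def complex_norm_square[symmetric] by (simp only: of_real_add)
      then have "(norm (Y t))\<^sup>2 + (norm (d t))\<^sup>2 = 0" by (simp only: of_real_eq_0_iff)
      then have "Y t = 0" "d t = 0" by (auto simp: add_nonneg_eq_0_iff)
      then show False using curve[of t] that cubic_smooth[of "X t"] by (auto simp: d_def T_def)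
    qed
    have contXY: "continuous_on T X" "continuous_on T Y"
      unfolding X_def Y_def curve_X_def curve_Y_def using c by (intro continuous_intros contx; simp)+
    have "continuous_on T N" unfolding N_def d_def by (intro continuous_intros contXY) simp_all
    then have "continuous_on T (\<lambda>t. (D1 t / c\<^sup>2 * cnj (Y t) + (2 * D2 t + coeff_a1 E * D1 t) / c ^ 3 * cnj (d t)) / N t)"
      unfolding d_def using c Nnz by (intro continuous_intros contD contXY) simp_all
    moreover have "p t = (D1 t / c\<^sup>2 * cnj (Y t) + (2 * D2 t + coeff_a1 E * D1 t) / c ^ 3 * cnj (d t)) / N t" if t: "t \<in> T" for t
    proof -
      have "(X has_vector_derivative D1 t / c\<^sup>2) (at t)"
        unfolding X_def curve_X_def by (auto intro!: derivative_eq_intros dx[OF t] simp: divide_inverse)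
      then have 1: "D1 t / c\<^sup>2 = Y t * p t" using dXY(1)[OF t] by (rule vector_derivative_unique_at)
      have "(Y has_vector_derivative (2 * D2 t + coeff_a1 E * D1 t) / c ^ 3) (at t)"
        unfolding Y_def curve_Y_def by (auto intro!: derivative_eq_intros dx[OF t] simp: divide_inverse)
      then have 2: "(2 * D2 t + coeff_a1 E * D1 t) / c ^ 3 = d t * p t" unfolding d_def using dXY(2)[OF t] by (rule vector_derivative_unique_at)
      have "D1 t / c\<^sup>2 * cnj (Y t) + (2 * D2 t + coeff_a1 E * D1 t) / c ^ 3 * cnj (d t) = p t * N t"
        unfolding 1 2 by (simp add: N_def algebra_simps)
      then show ?thesis using Nnz[OF t] by simp
    qed
    ultimately show "continuous_on ({0<..<1} - S) p" unfolding T_def[symmetric] using continuous_on_cong by force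
    show "X 0 = X 1" "Y 0 = Y 1" by (simp_all add: X_def Y_def cl)
  qed (use fin dXY curve in \<open>auto simp: T_def\<close>)
  then show ?thesis by (simp add: p_def)
qed

text \<open>Each \<open>B k\<close> is a nonconstant holomorphic function. Countability allows a
  segment to be routed around all poles.\<close>

lemma countable_poles: "countable \<Lambda>"
proof -
  have "countable {z \<in> ball 0 (2 ^ k * r). B k z = 0}" for k
  proof (rule holomorphic_countable_zeros[OF AB_hol(2)])
    show "\<not> B k constant_on ball 0 (2 ^ k * r)"
    proof
      assume "B k constant_on ball 0 (2 ^ k * r)"
      moreover have "of_real (r / 2) \<in> ball (0::complex) r" "(of_real (r / 2) :: complex) \<noteq> 0" "0 \<in> ball (0::complex) r" using r by auto
      ultimately have "B k (of_real (r / 2)) = B k 0" using big_ball[of k] unfolding constant_on_def by (metis subsetD)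
      moreover have "B k (of_real (r / 2)) \<noteq> 0" using B_eq_Aw[of "of_real (r / 2)" k] w_nz[of "of_real (r / 2)"] r by simp
      moreover have "B k 0 = 0" using B_eq_Aw[of 0 k] r w0 by simp
      ultimately show False by simp
    qed
  qed (auto intro: fsigma_open)
  then have "countable (\<Union>k. {z \<in> ball 0 (2 ^ k * r). B k z = 0})" by (intro countable_UN) auto
  moreover have "\<Lambda> \<subseteq> (\<Union>k. {z \<in> ball 0 (2 ^ k * r). B k z = 0})" by (auto simp: \<Lambda>_def)
  ultimately show ?thesis using countable_subset by blast
qed

text \<open>A segment from z0 to z0 + l that avoids the poles is mapped by (u, u') to a closed path
  on E, and the differential pulls back to the constant l.\<close>

lemma pole_imp_period:
  assumes l: "l \<in> \<Lambda>"
  shows "l \<in> period_lattice E c"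
proof -
  have "countable ((\<lambda>m. Im (m / l)) ` \<Lambda>)" using countable_poles by (rule countable_image)
  then obtain s where s: "s \<notin> (\<lambda>m. Im (m / l)) ` \<Lambda>"
    using uncountable_UNIV_real by (metis UNIV_eq_I)
  \<comment> \<open>For l \<noteq> 0 the quotient z/l has constant imaginary part s, and s was
    chosen outside a countable set to stay off the poles. For l = 0 the path is constant at
    r/2.\<close>
  define z where "z = (\<lambda>t::real. (if l = 0 then of_real r / 2 else \<i> * of_real s * l) + of_real t * l)"
  have z: "z t \<notin> \<Lambda>" for t
  proof (cases "l = 0")
    case True
    then show ?thesis using pole_local[of "of_real r / 2"] r by (simp add: z_def norm_divide)
  next
    case False
    then have "Im (z t / l) = s" by (simp add: z_def add_divide_distrib)
    then show ?thesis using s by force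
  qed
  have dz: "(z has_vector_derivative l) (at t)" for t
    unfolding z_def by (auto intro!: derivative_eq_intros simp: has_vector_derivative_def scaleR_conv_of_real)
  define X where "X = (\<lambda>t. u (z t))"
  define Y where "Y = (\<lambda>t. deriv u (z t))"
  define x where "x = (\<lambda>t. c\<^sup>2 * X t - curve_shift E)"
  define y where "y = (\<lambda>t. (c ^ 3 * Y t - coeff_a1 E * x t - coeff_a3 E) / 2)"
  have dX: "(X has_vector_derivative Y t * l) (at t)" for t
    using field_vector_diff_chain_at[OF dz D_u[OF z]] by (simp add: X_def Y_def o_def mult.commute)
  have dY: "(Y has_vector_derivative (6 * (X t)\<^sup>2 - curve_g2 E c / 2) * l) (at t)" for t
    using field_vector_diff_chain_at[OF dz D_u1[OF z]] by (simp add: X_def Y_def o_def mult.commute)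
  have y2: "2 * y t = c ^ 3 * Y t - coeff_a1 E * x t - coeff_a3 E" for t by (simp add: y_def)
  have cX: "curve_X E c (x t) = X t" and cY: "curve_Y E c (x t) (y t) = Y t" for t
    using c by (simp add: curve_X_def x_def) (use c in \<open>simp add: curve_Y_def y2\<close>)
  have curve: "curve_eqn E (x t) (y t) = 0" for t
    unfolding curve_normal_form[OF c] cX cY X_def Y_def by (rule u_ode[OF z])
  define x' where "x' = (\<lambda>t. c\<^sup>2 * (Y t * l))"
  define y' where "y' = (\<lambda>t. (c ^ 3 * ((6 * (X t)\<^sup>2 - curve_g2 E c / 2) * l) - coeff_a1 E * x' t) / 2)"
  have dx: "(x has_vector_derivative x' t) (at t)" for t
    using has_vector_derivative_diff[OF has_vector_derivative_mult_right[OF dX, of "c\<^sup>2"] has_vector_derivative_const]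
    by (simp add: x_def x'_def)
  have dy: "(y has_vector_derivative y' t) (at t)" for t
  proof -
    have "((\<lambda>t. c ^ 3 * Y t - coeff_a1 E * x t - coeff_a3 E) has_vector_derivative
        c ^ 3 * ((6 * (X t)\<^sup>2 - curve_g2 E c / 2) * l) - coeff_a1 E * x' t - 0) (at t)"
      by (intro has_vector_derivative_diff has_vector_derivative_mult_right has_vector_derivative_const dx dY)
    then show ?thesis
      using has_vector_derivative_divide[of _ _ "at t" 2] unfolding y_def y'_def diff_0_right by blast
  qed
  have contX: "continuous_on {0..1} X"
    by (rule continuous_on_vector_derivative[where f' = "\<lambda>t. Y t * l"]) (rule has_vector_derivative_at_within[OF dX])
  have contY: "continuous_on {0..1} Y"
    by (rule continuous_on_vector_derivative[where f' = "\<lambda>t. (6 * (X t)\<^sup>2 - curve_g2 E c / 2) * l"])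
       (rule has_vector_derivative_at_within[OF dY])
  have contx': "continuous_on {0..1} x'" unfolding x'_def by (intro continuous_intros contY)
  have conty': "continuous_on {0..1} y'" unfolding y'_def by (intro continuous_intros contX contY contx') simp
  have vp: "valid_path x"
    unfolding valid_path_def
    by (rule C1_differentiable_imp_piecewise, unfold C1_differentiable_on_def)
       (use dx contx' in blast)
  have vp2: "valid_path y"
    unfolding valid_path_def
    by (rule C1_differentiable_imp_piecewise, unfold C1_differentiable_on_def)
       (use dy conty' in blast)
  have z1: "z 1 = z 0 + l" by (simp add: z_def)
  have "X 1 = X 0" unfolding X_def z1 using pole_period(2)[OF l] .
  moreover have "Y 1 = Y 0"
  proof -
    have "((\<lambda>\<zeta>. u (\<zeta> + l)) has_field_derivative deriv u (z 0 + l)) (at (z 0))"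
      using D_u[OF z[of 1]] unfolding z1 by (simp add: DERIV_shift)
    then have "(u has_field_derivative deriv u (z 0 + l)) (at (z 0))" using pole_period(2)[OF l] by simp
    then show ?thesis unfolding Y_def z1 using D_u[OF z[of 0]] DERIV_unique by blast
  qed
  ultimately have "x 1 = x 0" "y 1 = y 0" by (simp_all add: x_def y_def)
  then have path: "closed_path_on E x y"
    using vp vp2 curve by (simp add: closed_path_on_def pathstart_def pathfinish_def)
  \<comment> \<open>Both p and l solve X' = Y p and Y' = (6 X^2 - g2/2) p, and the two coefficients
    never vanish together.\<close>
  have "differential_pullback E c x y t = l" for t
  proof -
    define p where "p = differential_pullback E c x y t"
    have "(X has_vector_derivative Y t * p) (at t)" "(Y has_vector_derivative (6 * (X t)\<^sup>2 - curve_g2 E c / 2) * p) (at t)"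
      using pullback_normal[OF c discE dx dy open_UNIV UNIV_I, of t] curve by (simp_all add: cX cY p_def)
    then have "Y t * p = Y t * l" "(6 * (X t)\<^sup>2 - curve_g2 E c / 2) * p = (6 * (X t)\<^sup>2 - curve_g2 E c / 2) * l"
      using dX dY vector_derivative_unique_at by blast+
    moreover have "Y t \<noteq> 0 \<or> 6 * (X t)\<^sup>2 - curve_g2 E c / 2 \<noteq> 0"
      using u_ode[OF z[of t]] cubic_smooth[of "X t"] by (auto simp: X_def Y_def)
    ultimately show ?thesis unfolding p_def by auto
  qed
  then have "differential_pullback E c x y = (\<lambda>t. l)" by auto
  then have "integral {0..1} (differential_pullback E c x y) = l" by simp
  then show ?thesis unfolding period_lattice_def using path by blast
qed

lemma period_lattice_eq_poles: "period_lattice E c = \<Lambda>"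
  using period_imp_pole pole_imp_period unfolding period_lattice_def by blast

end

section \<open>Algebraicity of torsion values\<close>

definition polys_over :: "complex set \<Rightarrow> complex poly set" where
  "polys_over K = {p. \<forall>i. coeff p i \<in> K}"

context complex_subfield_closure
begin

lemma polys_over_intros:
  "1 \<in> polys_over L" "[:0, 1:] \<in> polys_over L"
  "p \<in> polys_over L \<Longrightarrow> q \<in> polys_over L \<Longrightarrow> p + q \<in> polys_over L"
  "p \<in> polys_over L \<Longrightarrow> q \<in> polys_over L \<Longrightarrow> p - q \<in> polys_over L"
  "p \<in> polys_over L \<Longrightarrow> q \<in> polys_over L \<Longrightarrow> p * q \<in> polys_over L"
  "c \<in> L \<Longrightarrow> p \<in> polys_over L \<Longrightarrow> smult c p \<in> polys_over L"
  by (auto simp: polys_over_def coeff_mult coeff_pCons coeff_1 split: nat.splits intro!: L_intros)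

lemma polys_over_power: "p \<in> polys_over L \<Longrightarrow> p ^ n \<in> polys_over L"
  by (induction n) (auto intro: polys_over_intros)

end

text \<open>The \<open>k\<close>-fold iterate of duplication at \<open>(1, x)\<close> is \<open>(a\<^sub>k(x), x c\<^sub>k(x))\<close>.\<close>

primrec dup_poly :: "complex \<Rightarrow> complex \<Rightarrow> nat \<Rightarrow> complex poly \<times> complex poly" where
  "dup_poly g2 g3 0 = (1, 1)"
| "dup_poly g2 g3 (Suc k) = (let a = fst (dup_poly g2 g3 k); c = snd (dup_poly g2 g3 k); b = [:0, 1:] * c in
     (a ^ 4 + smult (g2 / 2) (a\<^sup>2 * b\<^sup>2) + smult (2 * g3) (a * b ^ 3) + smult (g2\<^sup>2 / 16) (b ^ 4),
      c * (smult 4 (a ^ 3) - smult g2 (a * b\<^sup>2) - smult g3 (b ^ 3))))"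

lemma poly_dup_poly:
  "(dup g2 g3 ^^ k) (1, x) = (poly (fst (dup_poly g2 g3 k)) x, x * poly (snd (dup_poly g2 g3 k)) x)"
  by (induction k) (simp_all add: dup_def Let_def power_mult_distrib algebra_simps)

text \<open>The factor 4 per step reflects w(2z) ~ 4 w(z) at 0. Its dependence on k makes the
  polynomial in \<open>u_torsion_algebraic\<close> nonzero.\<close>

lemma dup_poly_0: "poly (fst (dup_poly g2 g3 k)) 0 = 1" "poly (snd (dup_poly g2 g3 k)) 0 = 4 ^ k"
  by (induction k) (simp_all add: Let_def)

lemma (in complex_subfield_closure) dup_poly_over:
  assumes "g2 \<in> L" "g3 \<in> L"
  shows "fst (dup_poly g2 g3 k) \<in> polys_over L \<and> snd (dup_poly g2 g3 k) \<in> polys_over L"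
proof (induction k)
  case (Suc k)
  show ?case unfolding dup_poly.simps Let_def fst_conv snd_conv
    by (intro conjI polys_over_intros polys_over_power L_intros assms Suc[THEN conjunct1] Suc[THEN conjunct2])
qed (auto intro: polys_over_intros)

text \<open>Pigeonhole principle; a collision suffices, so n may be even.\<close>

lemma power2_mod_collision:
  assumes "n > 0"
  obtains i j :: nat where "i < j" "(2::nat) ^ j mod n = 2 ^ i mod n"
proof -
  have "(\<lambda>i. (2::nat) ^ i mod n) ` UNIV \<subseteq> {..<n}" using assms by auto
  then have "finite (range (\<lambda>i. (2::nat) ^ i mod n))" using finite_subset by blast
  then have "\<not> inj (\<lambda>i. (2::nat) ^ i mod n)" using finite_imageD infinite_UNIV_nat by blast
  then obtain i j where "i \<noteq> j" "(2::nat) ^ i mod n = 2 ^ j mod n" by (auto simp: inj_def)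
  then show ?thesis using that[of i j] that[of j i] by (cases "i < j") auto
qed

context weierstrass_germ
begin

lemma pole_add: "x \<in> \<Lambda> \<Longrightarrow> y \<in> \<Lambda> \<Longrightarrow> x + y \<in> \<Lambda>"
  using pole_period(1) by blast

lemma pole_of_nat: "x \<in> \<Lambda> \<Longrightarrow> of_nat q * x \<in> \<Lambda>"
  by (induction q) (auto intro: zero_pole pole_add simp: distrib_right)

lemma HH_add: "HH (k + j) (2 ^ j * z) = (dup g2 g3 ^^ j) (HH k z)"
  by (simp add: HH_def add.commute[of k] funpow_add power_add)

lemma funpow_dup_proj_eq:
  assumes "proj_eq p q" "p \<noteq> (0, 0)" "q \<noteq> (0, 0)"
  shows "proj_eq ((dup g2 g3 ^^ j) p) ((dup g2 g3 ^^ j) q) \<and> (dup g2 g3 ^^ j) p \<noteq> (0, 0) \<and> (dup g2 g3 ^^ j) q \<noteq> (0, 0)"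
  using assms by (induction j) (auto intro: dup_proj_eq dest: dup_nonzero[OF disc, rotated])

text \<open>2^i t and 2^j t differ by a pole, hence by a period, so the i-th and j-th iterates of
  duplication at (1, 1/u(t)) are the same projective point. This is a polynomial equation over K for
  x = 1/u(t).\<close>

lemma u_torsion_algebraic:
  assumes K: "complex_subfield K" "g2 \<in> K" "g3 \<in> K"
    and t: "t \<notin> \<Lambda>" "n > 0" "of_nat n * t \<in> \<Lambda>"
  shows "u t \<in> algebraic_closure_in_complex K"
proof (cases "u t = 0")
  case True
  then show ?thesis using subset_algebraic_closure[OF K(1)] K(1) by (auto simp: complex_subfield_def)
next
  case False
  interpret Kc: complex_subfield_closure K by standard (rule K(1))
  interpret Lc: complex_subfield_closure "algebraic_closure_in_complex K"
    by standard (rule complex_subfield_algebraic_closure[OF K(1)])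
  obtain i j where ij: "i < j" "(2::nat) ^ j mod n = 2 ^ i mod n" using power2_mod_collision[OF t(2)] .
  then have "n dvd 2 ^ j - 2 ^ i" by (simp add: mod_eq_dvd_iff_nat)
  then obtain q where q: "2 ^ j - 2 ^ i = n * q" by blast
  moreover have "(2::nat) ^ i \<le> 2 ^ j" using ij(1) by simp
  ultimately have q': "(2::nat) ^ j = 2 ^ i + n * q" by linarith
  define l where "l = of_nat q * (of_nat n * t)"
  have l: "l \<in> \<Lambda>" unfolding l_def by (rule pole_of_nat[OF t(3)])
  have "(2::complex) ^ j = 2 ^ i + of_nat n * of_nat q"
    using arg_cong[OF q', of "of_nat :: nat \<Rightarrow> complex"] by simp
  then have tj: "2 ^ j * t = 2 ^ i * t + l" by (simp add: l_def algebra_simps)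
  obtain k where k: "norm (2 ^ i * t) + norm l + norm t < 2 ^ k * r" using ex_ball .
  have kk: "2 ^ k * r \<le> 2 ^ (k + m) * r" for m using r by (simp add: power_add)
  have kt: "norm t < 2 ^ k * r" "norm (2 ^ i * t) < 2 ^ (k + i) * r" "norm (2 ^ j * t) < 2 ^ (k + j) * r"
    "norm (2 ^ i * t) < 2 ^ (k + j) * r" "norm (2 ^ i * t) + norm l < 2 ^ (k + j) * r"
    using k kk[of i] kk[of j] norm_triangle_ineq[of "2 ^ i * t" l] norm_ge_zero[of l] norm_ge_zero[of t]
      norm_ge_zero[of "2 ^ i * t"] unfolding tj by linarith+
  define x where "x = 1 / u t"
  have x: "x \<noteq> 0" using False by (simp add: x_def)
  have B: "B k t \<noteq> 0" using pole_iff[OF kt(1)] t(1) by simp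
  have A: "A k t \<noteq> 0" using False unfolding u_eq[OF kt(1)] by auto
  have p: "proj_eq (1, x) (HH k t)"
    using A B unfolding x_def u_eq[OF kt(1)] proj_eq_def by (simp add: A_def B_def)
  have p1: "proj_eq ((dup g2 g3 ^^ m) (1, x)) (HH (k + m) (2 ^ m * t))" and nz: "(dup g2 g3 ^^ m) (1, x) \<noteq> (0, 0)" for m
    using funpow_dup_proj_eq[OF p _ HH_nz, of m] unfolding HH_add by auto
  have "proj_eq (HH (k + i) (2 ^ i * t)) (HH (k + j) (2 ^ i * t))" by (rule HH_proj'[OF kt(2,4)])
  moreover have "proj_eq (HH (k + j) (2 ^ i * t)) (HH (k + j) (2 ^ j * t))"
    using pole_period_AB[OF l kt(5)] unfolding tj proj_eq_def by (simp add: A_def B_def)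
  ultimately have "proj_eq ((dup g2 g3 ^^ i) (1, x)) ((dup g2 g3 ^^ j) (1, x))"
    using p1[of i] p1[of j] HH_nz proj_eq_trans proj_eq_sym by metis
  define p where "p = fst (dup_poly g2 g3 i) * snd (dup_poly g2 g3 j) - fst (dup_poly g2 g3 j) * snd (dup_poly g2 g3 i)"
  have "x * poly p x = 0"
    using \<open>proj_eq ((dup g2 g3 ^^ i) (1, x)) ((dup g2 g3 ^^ j) (1, x))\<close>
    unfolding proj_eq_def poly_dup_poly p_def by (simp add: algebra_simps)
  then have "poly p x = 0" using x by simp
  \<comment> \<open>After cancelling the common factor x, the constant term shows that p is not the
    zero polynomial.\<close>
  moreover have "poly p 0 = 4 ^ j - 4 ^ i" by (simp add: p_def dup_poly_0)
  moreover have "(4::complex) ^ j \<noteq> 4 ^ i"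
  proof
    assume "(4::complex) ^ j = 4 ^ i"
    then have "of_nat (4 ^ j) = (of_nat (4 ^ i) :: complex)" by simp
    then have "(4::nat) ^ j = 4 ^ i" by (simp only: of_nat_eq_iff)
    then show False using ij(1) by simp
  qed
  ultimately have "p \<noteq> 0" "poly p x = 0" by auto
  moreover have "p \<in> polys_over K"
    unfolding p_def using Kc.dup_poly_over[OF K(2,3)] by (intro Kc.polys_over_intros) auto
  ultimately have "x \<in> algebraic_closure_in_complex K"
    unfolding algebraic_closure_in_complex_def polys_over_def by blast
  then show ?thesis using Lc.L_basic(6)[of x] by (simp add: x_def)
qed

end

section \<open>Comparison of the two elliptic functions\<close>

text \<open>z is divided out twice: the first quotient vanishes at 0 because f'(0) = 0 for even
  f.\<close>

lemma even_holomorphic_factor: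
  assumes f: "f holomorphic_on ball 0 r" and even: "\<And>z. z \<in> ball 0 r \<Longrightarrow> f (- z) = f z" and r: "r > 0"
  obtains g where "g holomorphic_on ball 0 r" "\<And>z. z \<in> ball 0 r \<Longrightarrow> f z = f 0 + z\<^sup>2 * g z"
    "\<And>z. z \<in> ball 0 r \<Longrightarrow> g (- z) = g z"
proof -
  define f1 where "f1 = (\<lambda>z. if z = 0 then deriv f 0 else (f z - f 0) / (z - 0))"
  have f1: "f1 holomorphic_on ball 0 r" unfolding f1_def by (rule pole_lemma_open[OF f open_ball])
  define g where "g = (\<lambda>z. if z = 0 then deriv f1 0 else (f1 z - f1 0) / (z - 0))"
  have g: "g holomorphic_on ball 0 r" unfolding g_def by (rule pole_lemma_open[OF f1 open_ball])
  have z0: "(0::complex) \<in> ball 0 r" using r by simp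
  have D: "(f has_field_derivative deriv f 0) (at 0)" using holomorphic_derivI[OF f open_ball z0] .
  have "((\<lambda>z. f (- z)) has_field_derivative - deriv f 0) (at 0)"
    using DERIV_chain2[OF _ DERIV_minus[OF DERIV_ident], of f "deriv f 0" 0 UNIV] D by simp
  then have "(f has_field_derivative - deriv f 0) (at 0)"
    by (rule has_field_derivative_transform_within_open[OF _ open_ball z0]) (rule even)
  then have "deriv f 0 = - deriv f 0" using D DERIV_unique by blast
  then have f10: "f1 0 = 0" by (simp add: f1_def)
  show ?thesis
  proof (rule that[OF g])
    fix z :: complex assume z: "z \<in> ball 0 r"
    show "f z = f 0 + z\<^sup>2 * g z"
      by (cases "z = 0") (simp_all add: g_def f10, simp add: f1_def power2_eq_square)
    show "g (- z) = g z" using even[OF z] by (cases "z = 0") (simp_all add: g_def f10, simp add: f1_def)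
  qed
qed

lemma (in weierstrass_germ) w_factor:
  obtains b where "b holomorphic_on ball 0 r" "\<And>z. z \<in> ball 0 r \<Longrightarrow> w z = z\<^sup>2 * b z" "b 0 = 1"
    "\<And>z. z \<in> ball 0 r \<Longrightarrow> b (- z) = b z"
proof -
  obtain b where b: "b holomorphic_on ball 0 r" "\<And>z. z \<in> ball 0 r \<Longrightarrow> w z = w 0 + z\<^sup>2 * b z"
     "\<And>z. z \<in> ball 0 r \<Longrightarrow> b (- z) = b z"
    using even_holomorphic_factor[OF w_hol w_even r] by blast
  have z0: "(0::complex) \<in> ball 0 r" using r by simp
  have Db: "(b has_field_derivative deriv b z) (at z)" if "z \<in> ball 0 r" for z
    using holomorphic_derivI[OF b(1) open_ball that] .
  have b1: "deriv b holomorphic_on ball 0 r" by (rule holomorphic_deriv[OF b(1) open_ball])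
  have Db1: "(deriv b has_field_derivative deriv (deriv b) 0) (at 0)"
    using holomorphic_derivI[OF b1 open_ball z0] .
  have dw: "deriv w z = 2 * z * b z + z\<^sup>2 * deriv b z" if z: "z \<in> ball 0 r" for z
  proof -
    have "((\<lambda>z. z\<^sup>2 * b z) has_field_derivative 2 * z * b z + z\<^sup>2 * deriv b z) (at z)"
      by (auto intro!: derivative_eq_intros Db[OF z])
    then have "(w has_field_derivative 2 * z * b z + z\<^sup>2 * deriv b z) (at z)"
      by (rule has_field_derivative_transform_within_open[OF _ open_ball z]) (use b(2) w0 in auto)
    then show ?thesis by (rule DERIV_imp_deriv)
  qed
  have "((\<lambda>z. 2 * z * b z + z\<^sup>2 * deriv b z) has_field_derivative 2 * b 0) (at 0)"
    by (auto intro!: derivative_eq_intros Db[OF z0] Db1)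
  then have "(deriv w has_field_derivative 2 * b 0) (at 0)"
    by (rule has_field_derivative_transform_within_open[OF _ open_ball z0]) (use dw in auto)
  then have "2 * b 0 = 2" using Dw1[OF z0] w0 DERIV_unique by fastforce
  then show ?thesis using that[of b] b w0 by auto
qed

locale theta_uniformization = theta_lattice \<Gamma> w1 w2 \<theta> B s + U: weierstrass_germ g2 g3 r w
  for \<Gamma> w1 w2 \<theta> B s g2 g3 r w +
  assumes poles: "U.\<Lambda> = \<Gamma>"
begin

text \<open>With \<theta> = z a and w = z^2 b the difference is (Q b - a^2)/(z^2 a^2 b). Its
  numerator is even and vanishes at 0, hence is divisible by z^2.\<close>

lemma P_minus_u_local:
  obtains G where "G holomorphic_on ball 0 r" "\<And>z. z \<in> ball 0 r \<Longrightarrow> z \<noteq> 0 \<Longrightarrow> P z - U.u z = G z"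
proof -
  obtain b where b: "b holomorphic_on ball 0 r" "\<And>z. z \<in> ball 0 r \<Longrightarrow> w z = z\<^sup>2 * b z" "b 0 = 1"
    "\<And>z. z \<in> ball 0 r \<Longrightarrow> b (- z) = b z" using U.w_factor by blast
  define a where "a = (\<lambda>z. if z = 0 then deriv \<theta> 0 else (\<theta> z - \<theta> 0) / (z - 0))"
  have hol: "\<theta> holomorphic_on ball 0 r" "Q holomorphic_on ball 0 r"
    using theta_hol Q_hol holomorphic_on_subset by blast+
  have a: "a holomorphic_on ball 0 r" unfolding a_def by (rule pole_lemma_open[OF hol(1) open_ball])
  have \<theta>a: "\<theta> z = z * a z" for z by (simp add: a_def)
  have a0: "a 0 = 1" by (simp add: a_def deriv_theta_0)
  have a_even: "a (- z) = a z" for z by (simp add: a_def theta_odd)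
  have Q_even: "Q (- z) = Q z" for z by (simp add: Q_def theta_odd theta1_even theta2_odd)
  have Q0: "Q 0 = 1" by (simp add: Q_def)
  define M where "M = (\<lambda>z. Q z * b z - (a z)\<^sup>2)"
  have M: "M holomorphic_on ball 0 r" unfolding M_def by (intro holomorphic_intros hol b a)
  have "M (- z) = M z" if "z \<in> ball 0 r" for z using that by (simp add: M_def Q_even a_even b(4))
  then obtain m where m: "m holomorphic_on ball 0 r" "\<And>z. z \<in> ball 0 r \<Longrightarrow> M z = M 0 + z\<^sup>2 * m z"
    using even_holomorphic_factor[OF M _ U.r] by blast
  have M0: "M 0 = 0" by (simp add: M_def Q0 b(3) a0)
  have nz: "a z \<noteq> 0" "b z \<noteq> 0" if z: "z \<in> ball 0 r" for z
    using a0 b(3) theta_nz[of z] U.pole_local[OF z] poles U.w_nz[OF z] b(2)[OF z] \<theta>a[of z] by (cases "z = 0"; auto)+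
  show ?thesis
  proof (rule that)
    show "(\<lambda>z. m z / ((a z)\<^sup>2 * b z)) holomorphic_on ball 0 r"
      using nz by (intro holomorphic_intros m a b) auto
  next
    fix z :: complex assume z: "z \<in> ball 0 r" "z \<noteq> 0"
    have "P z - U.u z = Q z / (z * a z)\<^sup>2 - 1 / (z\<^sup>2 * b z)"
      unfolding P_def \<theta>a U.u_local[OF z(1)] b(2)[OF z(1)] ..
    also have "\<dots> = M z / (z\<^sup>2 * ((a z)\<^sup>2 * b z))"
      using z(2) nz[OF z(1)] unfolding M_def power_mult_distrib by (simp add: divide_simps)
    also have "\<dots> = m z / ((a z)\<^sup>2 * b z)" using m(2)[OF z(1)] M0 z(2) by simp
    finally show "P z - U.u z = m z / ((a z)\<^sup>2 * b z)" .
  qed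
qed

lemma P_eq_u:
  obtains p0 where "\<And>z. z \<notin> \<Gamma> \<Longrightarrow> P z = U.u z + p0"
proof -
  obtain G where G: "G holomorphic_on ball 0 r" "\<And>z. z \<in> ball 0 r \<Longrightarrow> z \<noteq> 0 \<Longrightarrow> P z - U.u z = G z"
    using P_minus_u_local by blast
  \<comment> \<open>G(0) fills the removable singularity at 0, and periodicity carries it to the
    other lattice points.\<close>
  define h where "h = (\<lambda>z. if z \<in> \<Gamma> then G 0 else P z - U.u z)"
  have per: "h (z + \<gamma>) = h z" if "\<gamma> \<in> \<Gamma>" for z \<gamma>
    using that U.pole_period[of \<gamma> z] by (simp add: h_def poles lattice_add_iff P_periodic)
  have z0: "(0::complex) \<in> ball 0 r" using U.r by simp
  have local: "h z = G z" if "z \<in> ball 0 r" for z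
    using that G(2)[of z] U.pole_local[of z] by (cases "z = 0") (auto simp: h_def poles)
  have D0: "(h has_field_derivative deriv G 0) (at 0)"
    by (rule has_field_derivative_transform_within_open[OF holomorphic_derivI[OF G(1) open_ball z0] open_ball z0])
       (simp add: local)
  have "h field_differentiable at z" for z
  proof (cases "z \<in> \<Gamma>")
    case True
    have "((\<lambda>x. h (x + - z)) has_field_derivative deriv G 0) (at z)"
      using D0 DERIV_shift[of h "deriv G 0" z "- z"] by simp
    moreover have "(\<lambda>x. h (x + - z)) = h" using per[of "- z"] True by auto
    ultimately show ?thesis unfolding field_differentiable_def by auto
  next
    case False
    have "((\<lambda>z. P z - U.u z) has_field_derivative deriv P z - deriv U.u z) (at z)"
      using D_P[OF False] U.D_u[of z] False poles by (intro DERIV_diff) auto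
    then have "(h has_field_derivative deriv P z - deriv U.u z) (at z)"
      by (rule has_field_derivative_transform_within_open[OF _ open_compl_lattice]) (use False in \<open>auto simp: h_def\<close>)
    then show ?thesis unfolding field_differentiable_def by blast
  qed
  then have "h holomorphic_on UNIV" by (simp add: holomorphic_on_def)
  then obtain p0 where "\<And>z. h z = p0" using periodic_entire_constant per by blast
  then show ?thesis using that[of p0] by (metis h_def diff_add_cancel add.commute)
qed

lemma P_ode:
  assumes p0: "\<And>z. z \<notin> \<Gamma> \<Longrightarrow> P z = U.u z + p0" and z: "z \<notin> \<Gamma>"
  shows "(deriv P z)\<^sup>2 = 4 * (P z - p0) ^ 3 - g2 * (P z - p0) - g3"
    and "deriv (deriv P) z = 6 * (P z - p0)\<^sup>2 - g2 / 2"
proof -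
  have D: "deriv P x = deriv U.u x" if "x \<notin> \<Gamma>" for x
  proof -
    have "((\<lambda>z. U.u z + p0) has_field_derivative deriv U.u x) (at x)"
      using U.D_u[of x] that poles by (auto intro!: derivative_eq_intros)
    then have "(P has_field_derivative deriv U.u x) (at x)"
      by (rule has_field_derivative_transform_within_open[OF _ open_compl_lattice]) (use that p0 in auto)
    then show ?thesis by (rule DERIV_imp_deriv)
  qed
  show "(deriv P z)\<^sup>2 = 4 * (P z - p0) ^ 3 - g2 * (P z - p0) - g3"
    using U.u_ode[of z] z poles by (simp add: D p0)
  have "(deriv P has_field_derivative 6 * (U.u z)\<^sup>2 - g2 / 2) (at z)"
    by (rule has_field_derivative_transform_within_open[OF U.D_u1 open_compl_lattice]) (use z D poles in auto)
  then show "deriv (deriv P) z = 6 * (P z - p0)\<^sup>2 - g2 / 2"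
    using p0[OF z] by (simp add: DERIV_imp_deriv)
qed

end

section \<open>Lattices with complex multiplication\<close>

text \<open>w1 is a shortest nonzero vector, and w2 has least |Im (x / w1)| among the x with nonreal
  x/w1 and |Re (x / w1)| \<le> 1/2. Reducing any element by both leaves a vector shorter than w1,
  hence 0.\<close>

lemma complex_lattice_exists:
  fixes \<Gamma> :: "complex set"
  assumes add: "\<And>x y. x \<in> \<Gamma> \<Longrightarrow> y \<in> \<Gamma> \<Longrightarrow> x + y \<in> \<Gamma>"
    and minus: "\<And>x. x \<in> \<Gamma> \<Longrightarrow> - x \<in> \<Gamma>"
    and fin: "\<And>R. finite (\<Gamma> \<inter> cball 0 R)"
    and ab: "a \<in> \<Gamma>" "b \<in> \<Gamma>" "Im (b / a) \<noteq> 0"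
  obtains w1 w2 where "complex_lattice \<Gamma> w1 w2"
proof -
  have zero: "0 \<in> \<Gamma>" using add[OF ab(1) minus[OF ab(1)]] by simp
  have nat: "of_nat k * x \<in> \<Gamma>" if "x \<in> \<Gamma>" for k x
    using that by (induction k) (auto intro: zero add simp: distrib_right)
  have int: "of_int k * x \<in> \<Gamma>" if "x \<in> \<Gamma>" for k x
    using nat[OF that, of "nat k"] minus[OF nat[OF that, of "nat (- k)"]] by (cases "k \<ge> 0") auto
  have diff: "x - y \<in> \<Gamma>" if "x \<in> \<Gamma>" "y \<in> \<Gamma>" for x y using add[OF that(1) minus[OF that(2)]] by simp
  have a0: "a \<noteq> 0" using ab(3) by auto
  define S1 where "S1 = (\<Gamma> \<inter> cball 0 (norm a)) - {0}"
  have S1: "finite S1" "S1 \<noteq> {}" using fin[of "norm a"] ab(1) a0 by (auto simp: S1_def)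
  define w1 where "w1 = arg_min_on norm S1"
  have "w1 \<in> S1" unfolding w1_def by (rule arg_min_if_finite(1)[OF S1])
  then have w1: "w1 \<in> \<Gamma>" "w1 \<noteq> 0" "norm w1 \<le> norm a" by (auto simp: S1_def)
  have w1_min: "norm w1 \<le> norm x" if "x \<in> \<Gamma>" "x \<noteq> 0" for x
  proof (cases "norm x \<le> norm a")
    case True
    then have "x \<in> S1" using that by (auto simp: S1_def)
    then show ?thesis unfolding w1_def by (rule arg_min_least[OF S1])
  qed (use w1(3) in simp)
  have shift: "Im ((x - of_int m * w1) / w1) = Im (x / w1)" "Re ((x - of_int m * w1) / w1) = Re (x / w1) - of_int m" for x m
    using w1(2) by (simp_all add: diff_divide_distrib)
  have reduce: "\<exists>m. \<bar>Re ((x - of_int m * w1) / w1)\<bar> \<le> 1 / 2" for x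
    unfolding shift using of_int_round_abs_le[of "Re (x / w1)"] by (metis abs_minus_commute)
  have "\<exists>c\<in>\<Gamma>. Im (c / w1) \<noteq> 0"
  proof (rule ccontr)
    assume *: "\<not> ?thesis"
    have "a / w1 \<in> \<real>" "b / w1 \<in> \<real>" using * ab(1,2) by (auto simp: complex_is_Real_iff)
    then have "(b / w1) / (a / w1) \<in> \<real>" by (rule Reals_divide[rotated])
    then show False using ab(3) w1(2) by (simp add: complex_is_Real_iff)
  qed
  then obtain c0 where c0: "c0 \<in> \<Gamma>" "Im (c0 / w1) \<noteq> 0" by blast
  obtain m0 where m0: "\<bar>Re ((c0 - of_int m0 * w1) / w1)\<bar> \<le> 1 / 2" using reduce by blast
  define c where "c = c0 - of_int m0 * w1"
  have c: "c \<in> \<Gamma>" "Im (c / w1) \<noteq> 0" "\<bar>Re (c / w1)\<bar> \<le> 1 / 2"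
    unfolding c_def using m0 c0 by (auto intro: diff int w1 simp only: shift)
  define S2 where "S2 = {x \<in> \<Gamma>. Im (x / w1) \<noteq> 0 \<and> \<bar>Re (x / w1)\<bar> \<le> 1 / 2 \<and> \<bar>Im (x / w1)\<bar> \<le> \<bar>Im (c / w1)\<bar>}"
  have "S2 \<subseteq> \<Gamma> \<inter> cball 0 (norm w1 * (1 / 2 + \<bar>Im (c / w1)\<bar>))"
  proof
    fix x assume x: "x \<in> S2"
    have "norm x = norm w1 * norm (x / w1)" using w1(2) by (simp add: norm_divide)
    also have "\<dots> \<le> norm w1 * (\<bar>Re (x / w1)\<bar> + \<bar>Im (x / w1)\<bar>)"
      by (intro mult_left_mono cmod_le) simp
    also have "\<dots> \<le> norm w1 * (1 / 2 + \<bar>Im (c / w1)\<bar>)"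
      using x by (intro mult_left_mono) (auto simp: S2_def)
    finally show "x \<in> \<Gamma> \<inter> cball 0 (norm w1 * (1 / 2 + \<bar>Im (c / w1)\<bar>))" using x by (simp add: S2_def)
  qed
  then have "finite S2" using fin finite_subset by blast
  moreover have "c \<in> S2" using c by (simp add: S2_def)
  ultimately have S2: "finite S2" "S2 \<noteq> {}" by auto
  define w2 where "w2 = arg_min_on (\<lambda>x. \<bar>Im (x / w1)\<bar>) S2"
  have "w2 \<in> S2" unfolding w2_def by (rule arg_min_if_finite(1)[OF S2])
  then have w2: "w2 \<in> \<Gamma>" "Im (w2 / w1) \<noteq> 0" "\<bar>Im (w2 / w1)\<bar> \<le> \<bar>Im (c / w1)\<bar>" by (auto simp: S2_def)
  have w2_min: "\<bar>Im (w2 / w1)\<bar> \<le> \<bar>Im (x / w1)\<bar>" if "x \<in> \<Gamma>" "Im (x / w1) \<noteq> 0" "\<bar>Re (x / w1)\<bar> \<le> 1 / 2" for x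
  proof (cases "\<bar>Im (x / w1)\<bar> \<le> \<bar>Im (c / w1)\<bar>")
    case True
    then have "x \<in> S2" using that by (auto simp: S2_def)
    then show ?thesis unfolding w2_def using arg_min_least[OF S2, of x "\<lambda>x. \<bar>Im (x / w1)\<bar>"] by simp
  qed (use w2(3) in simp)
  have span: "\<exists>m n. x = of_int m * w1 + of_int n * w2" if x: "x \<in> \<Gamma>" for x
  proof -
    \<comment> \<open>Subtracting floor(t) w2 leaves the fractional part of t, which is less than 1;
      minimality of w2 then forces the imaginary part to be 0.\<close>
    define t where "t = Im (x / w1) / Im (w2 / w1)"
    define x1 where "x1 = x - of_int \<lfloor>t\<rfloor> * w2"
    have x1: "x1 \<in> \<Gamma>" unfolding x1_def by (intro diff int x w2)
    have "x1 / w1 = x / w1 - of_int \<lfloor>t\<rfloor> * (w2 / w1)" by (simp add: x1_def diff_divide_distrib)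
    moreover have "Im (of_int \<lfloor>t\<rfloor> * z) = of_int \<lfloor>t\<rfloor> * Im z" for z by simp
    ultimately have "Im (x1 / w1) = Im (x / w1) - of_int \<lfloor>t\<rfloor> * Im (w2 / w1)" by (simp only: minus_complex.simps)
    also have "\<dots> = frac t * Im (w2 / w1)" using w2(2) by (simp add: frac_def t_def left_diff_distrib)
    finally have Im1: "Im (x1 / w1) = frac t * Im (w2 / w1)" .
    obtain m where m: "\<bar>Re ((x1 - of_int m * w1) / w1)\<bar> \<le> 1 / 2" using reduce by blast
    define x2 where "x2 = x1 - of_int m * w1"
    have x2: "x2 \<in> \<Gamma>" unfolding x2_def by (intro diff int x1 w1)
    have Im2: "Im (x2 / w1) = frac t * Im (w2 / w1)" unfolding x2_def shift by (rule Im1)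
    have "Im (x2 / w1) = 0"
    proof (rule ccontr)
      assume "Im (x2 / w1) \<noteq> 0"
      then have "\<bar>Im (w2 / w1)\<bar> \<le> \<bar>Im (x2 / w1)\<bar>" using w2_min[OF x2] m by (simp add: x2_def)
      also have "\<dots> = frac t * \<bar>Im (w2 / w1)\<bar>" unfolding Im2 abs_mult by simp
      finally show False using w2(2) frac_lt_1[of t] by simp
    qed
    then have "norm (x2 / w1) \<le> 1 / 2" using m cmod_le[of "x2 / w1"] by (simp add: x2_def)
    then have "norm x2 < norm w1" using w1(2) by (simp add: norm_divide field_simps) (smt (verit) zero_less_norm_iff w1(2))
    then have "x2 = 0" using w1_min[OF x2] by force
    then have "x = of_int m * w1 + of_int \<lfloor>t\<rfloor> * w2" by (simp add: x2_def x1_def diff_eq_eq)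
    then show ?thesis by blast
  qed
  have "complex_lattice \<Gamma> w1 w2"
    by standard (use w2(2) span in \<open>auto intro: add int w1 w2\<close>)
  then show ?thesis by (rule that)
qed

text \<open>If \<beta>^2 = a + b \<beta> with rational a, b and d is a common denominator, then d
  \<beta> is a root of X^2 - (d b) X - d (d a), which has integer coefficients.\<close>

lemma imaginary_quadratic_field_nonreal_integer:
  assumes K: "imaginary_quadratic_field K"
  obtains \<alpha> where "\<alpha> \<in> ring_of_integers K" "Im \<alpha> \<noteq> 0"
proof -
  obtain \<beta> where \<beta>: "K = {of_rat a + of_rat b * \<beta> | a b. True}" and nr: "\<not> K \<subseteq> \<real>" and sub: "complex_subfield K"
    using K by (auto simp: imaginary_quadratic_field_def)
  interpret Kc: complex_subfield_closure K by standard (rule sub)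
  have Im: "Im \<beta> \<noteq> 0"
  proof
    assume "Im \<beta> = 0"
    then have "\<beta> \<in> \<real>" by (simp add: complex_is_Real_iff)
    moreover have "of_rat q \<in> (\<real> :: complex set)" for q by (cases q) (simp add: of_rat_rat)
    ultimately have "K \<subseteq> \<real>" unfolding \<beta> by (auto intro!: Reals_add Reals_mult)
    then show False using nr by simp
  qed
  have "of_rat 0 + of_rat 1 * \<beta> \<in> K" unfolding \<beta> by blast
  then have \<beta>K: "\<beta> \<in> K" by simp
  then have "\<beta> * \<beta> \<in> K" by (rule Kc.L_basic(4)[OF \<beta>K])
  then obtain a b where ab: "\<beta> * \<beta> = of_rat a + of_rat b * \<beta>" unfolding \<beta> by blast
  obtain a1 a2 where a: "quotient_of a = (a1, a2)" by fastforce
  obtain b1 b2 where b: "quotient_of b = (b1, b2)" by fastforce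
  have nz: "a2 \<noteq> 0" "b2 \<noteq> 0" using quotient_of_denom_pos[OF a] quotient_of_denom_pos[OF b] by auto
  define d where "d = (of_int (a2 * b2) :: complex)"
  have da: "d * of_rat a = of_int (a1 * b2)" and db: "d * of_rat b = of_int (a2 * b1)"
    using nz by (simp_all add: d_def quotient_of_div[OF a] quotient_of_div[OF b] of_rat_divide)
  define \<alpha> where "\<alpha> = d * \<beta>"
  have "\<alpha> * \<alpha> = d * (d * (\<beta> * \<beta>))" by (simp add: \<alpha>_def)
  also have "\<dots> = d * (d * of_rat a) + (d * of_rat b) * \<alpha>" unfolding ab by (simp add: \<alpha>_def algebra_simps)
  also have "\<dots> = of_int (a2 * b2 * (a1 * b2)) + of_int (a2 * b1) * \<alpha>" unfolding da db by (simp add: d_def)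
  finally have \<alpha>2: "\<alpha> * \<alpha> = of_int (a2 * b2 * (a1 * b2)) + of_int (a2 * b1) * \<alpha>" .
  define p where "p = [:- of_int (a2 * b2 * (a1 * b2)), - of_int (a2 * b1), 1 :: complex:]"
  have "algebraic_int \<alpha>"
  proof (rule algebraic_int.intros[of p])
    show "\<forall>i. coeff p i \<in> \<int>"
      unfolding p_def coeff_pCons by (auto split: nat.split simp del: of_int_mult)
    show "poly p \<alpha> = 0" using \<alpha>2 by (simp add: p_def algebra_simps)
  qed (simp add: p_def)
  moreover have "d \<in> K"
  proof -
    have "of_rat (of_int (a2 * b2)) + of_rat 0 * \<beta> \<in> K" unfolding \<beta> by blast
    then show ?thesis by (simp add: d_def of_rat_mult)
  qed
  then have "\<alpha> \<in> K" unfolding \<alpha>_def by (intro Kc.L_basic(4) \<beta>K)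
  ultimately have "\<alpha> \<in> ring_of_integers K" by (simp add: ring_of_integers_def)
  moreover have "Im \<alpha> \<noteq> 0" using Im nz by (simp add: \<alpha>_def d_def del: of_int_mult)
  ultimately show ?thesis by (rule that)
qed

lemma (in complex_lattice) lattice_tensor_rat_torsion:
  assumes "z \<in> lattice_tensor_rat \<Gamma>"
  shows "torsion z"
proof -
  obtain q \<gamma> where z: "z = of_rat q * \<gamma>" and \<gamma>: "\<gamma> \<in> \<Gamma>" using assms by (auto simp: lattice_tensor_rat_def)
  obtain m n where q: "quotient_of q = (m, n)" by fastforce
  have n: "n > 0" by (rule quotient_of_denom_pos[OF q])
  have "of_nat (nat n) * z = of_int m * \<gamma>"
    using n by (simp add: z quotient_of_div[OF q] of_rat_divide)
  then show ?thesis unfolding torsion_def using n lattice_of_int[OF \<gamma>, of m] by (intro exI[of _ "nat n"]) simp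
qed

theorem theorem3p4:
  fixes K \<ff> \<Gamma> :: "complex set"
    and E :: weierstrass_curve
    and \<omega> \<Omega> z0 w0 :: complex
    and \<theta> :: "complex \<Rightarrow> complex"
  assumes "imaginary_quadratic_field K"
    and "class_number K = 1"
    and "nonzero_ideal (ring_of_integers K) \<ff>"
    and "elliptic_curve_over K E"
    and "invariant_differential_over K \<omega>"
    and "\<Omega> \<noteq> 0"
    and "\<Gamma> = (\<lambda>x. \<Omega> * x) ` \<ff>"
    and "period_lattice E \<omega> = \<Gamma>"
    and "is_theta \<Gamma> \<theta>"
    and "z0 \<in> lattice_tensor_rat \<Gamma>"
    and "w0 \<in> lattice_tensor_rat \<Gamma>"
  shows "\<exists>c. has_laurent_expansion_at_origin (kronecker_theta_translate \<Gamma> \<theta> z0 w0) c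
             \<and> (\<forall>m n. c m n \<in> algebraic_closure_in_complex K)"
proof -
  note K = assms(1) and \<ff> = assms(3) and \<Gamma> = assms(7) and \<theta> = assms(9)[unfolded is_theta_def]
  let ?L = "algebraic_closure_in_complex K"
  have sub: "complex_subfield K" using K by (simp add: imaginary_quadratic_field_def)
  interpret Kc: complex_subfield_closure K by standard (rule sub)
  interpret Lc: complex_subfield_closure ?L by standard (rule complex_subfield_algebraic_closure[OF sub])
  obtain \<alpha> where \<alpha>: "\<alpha> \<in> ring_of_integers K" "Im \<alpha> \<noteq> 0"
    using imaginary_quadratic_field_nonreal_integer[OF K] by blast
  have "- 1 \<in> ring_of_integers K" using Kc.L_basic(2,5) by (simp add: ring_of_integers_def)
  then have minus: "- x \<in> \<Gamma>" if "x \<in> \<Gamma>" for x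
    using that \<ff> unfolding \<Gamma> nonzero_ideal_def by (force simp: image_iff)
  have add: "x + y \<in> \<Gamma>" if "x \<in> \<Gamma>" "y \<in> \<Gamma>" for x y
    using that \<ff> unfolding \<Gamma> nonzero_ideal_def by (auto simp: image_iff simp flip: distrib_left)
  have CM: "\<alpha> * x \<in> \<Gamma>" if "x \<in> \<Gamma>" for x
    using that \<ff> \<alpha>(1) unfolding \<Gamma> nonzero_ideal_def by (force simp: image_iff)
  obtain f0 where "f0 \<in> \<ff>" "f0 \<noteq> 0" using \<ff> unfolding nonzero_ideal_def by blast
  then have f0: "\<Omega> * f0 \<in> \<Gamma>" "\<Omega> * f0 \<noteq> 0" using \<open>\<Omega> \<noteq> 0\<close> by (auto simp: \<Gamma>)
  \<comment> \<open>Discreteness of \<Gamma> is read off from \<theta>: \<Gamma> is the zero set of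
    a nonconstant entire function.\<close>
  have fin: "finite (\<Gamma> \<inter> cball 0 R)" for R
  proof -
    have "\<not> \<theta> constant_on UNIV"
    proof
      assume "\<theta> constant_on UNIV"
      then obtain c where "\<theta> = (\<lambda>z. c)" unfolding constant_on_def by auto
      then show False using \<theta> by simp
    qed
    then have "finite {z \<in> cball 0 R. \<theta> z = 0}"
      using \<theta> by (intro holomorphic_compact_finite_zeros[of \<theta> UNIV]) auto
    moreover have "{z \<in> cball 0 R. \<theta> z = 0} = \<Gamma> \<inter> cball 0 R" using \<theta> by auto
    ultimately show ?thesis by simp
  qed
  \<comment> \<open>\<Omega> f0 and its multiple by the nonreal \<alpha> are independent over the
    reals.\<close>
  obtain w1 w2 where "complex_lattice \<Gamma> w1 w2"
    using complex_lattice_exists[of \<Gamma> "\<Omega> * f0" "\<alpha> * (\<Omega> * f0)"] add minus fin f0 CM \<alpha>(2) by force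
  then interpret lat: complex_lattice \<Gamma> w1 w2 .
  have sign: "theta_sign \<Gamma> (- \<gamma>) = theta_sign \<Gamma> \<gamma>" for \<gamma>
  proof -
    have "- \<gamma> \<in> (\<lambda>x. 2 * x) ` \<Gamma> \<longleftrightarrow> \<gamma> \<in> (\<lambda>x. 2 * x) ` \<Gamma>"
      by (metis (no_types, lifting) imageE imageI minus minus_minus mult_minus_right)
    then show ?thesis by (simp add: theta_sign_def)
  qed
  interpret th: theta_lattice \<Gamma> w1 w2 \<theta> "inverse (lattice_A \<Gamma>)" "theta_sign \<Gamma>"
  proof unfold_locales
    fix \<gamma> z assume "\<gamma> \<in> \<Gamma>"
    then have "\<theta> (z + \<gamma>) = theta_sign \<Gamma> \<gamma> * exp (z * cnj \<gamma> / lattice_A \<Gamma> + \<gamma> * cnj \<gamma> / (2 * lattice_A \<Gamma>)) * \<theta> z"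
      using \<theta> by blast
    \<comment> \<open>For A = 0 both sides are 0 by the convention for division, so the rewriting is
      unconditional.\<close>
    also have "z * cnj \<gamma> / lattice_A \<Gamma> + \<gamma> * cnj \<gamma> / (2 * lattice_A \<Gamma>) = inverse (lattice_A \<Gamma>) * (z * cnj \<gamma> + \<gamma> * cnj \<gamma> / 2)"
      by (cases "lattice_A \<Gamma> = 0") (simp_all add: field_simps)
    finally show "\<theta> (z + \<gamma>) = theta_sign \<Gamma> \<gamma> * exp (inverse (lattice_A \<Gamma>) * (z * cnj \<gamma> + \<gamma> * cnj \<gamma> / 2)) * \<theta> z" .
  next
    show "\<theta> holomorphic_on UNIV" "\<And>z. \<theta> z = 0 \<longleftrightarrow> z \<in> \<Gamma>" "\<And>\<gamma>. \<gamma> \<in> \<Gamma> \<Longrightarrow> deriv \<theta> \<gamma> \<noteq> 0" "deriv \<theta> 0 = 1"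
      using \<theta> by blast+
    show "theta_sign \<Gamma> \<gamma> * theta_sign \<Gamma> \<gamma> = 1" for \<gamma> by (simp add: theta_sign_def)
  qed (rule sign)
  define g2 g3 where "g2 = curve_g2 E \<omega>" and "g3 = curve_g3 E \<omega>"
  have \<omega>: "\<omega> \<in> K" "\<omega> \<noteq> 0" using assms(5) by (auto simp: invariant_differential_over_def)
  have E: "coeff_a1 E \<in> K" "coeff_a2 E \<in> K" "coeff_a3 E \<in> K" "coeff_a4 E \<in> K" "coeff_a6 E \<in> K" "discriminant E \<noteq> 0"
    using assms(4) by (auto simp: elliptic_curve_over_def)
  have gK: "g2 \<in> K" "g3 \<in> K"
    unfolding g2_def g3_def curve_g2_def curve_g3_def curve_h2_def curve_h3_def curve_shift_def curve_b4_def curve_b6_def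
    by (intro Kc.L_intros E \<omega>)+
  obtain r w where rw: "r > 0" "w holomorphic_on ball 0 r" "w 0 = 0"
    "\<And>z. z \<in> ball 0 r \<Longrightarrow> (deriv w z)\<^sup>2 = 4 * w z - g2 * w z ^ 3 - g3 * w z ^ 4"
    "\<And>z. z \<in> ball 0 r \<Longrightarrow> z \<noteq> 0 \<Longrightarrow> w z \<noteq> 0"
    using weierstrass_local_solution[of g2 g3] by blast
  interpret W: weierstrass_uniformization E \<omega> r w
    by unfold_locales (use rw curve_g_disc[OF E(6) \<omega>(2)] E(6) \<omega>(2) in \<open>auto simp: g2_def g3_def\<close>)
  interpret T: theta_uniformization \<Gamma> w1 w2 \<theta> "inverse (lattice_A \<Gamma>)" "theta_sign \<Gamma>" "curve_g2 E \<omega>" "curve_g3 E \<omega>" r w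
    by unfold_locales (use W.period_lattice_eq_poles assms(8) in simp)
  obtain p0 where p0: "\<And>z. z \<notin> \<Gamma> \<Longrightarrow> th.P z = W.u z + p0" using T.P_eq_u by blast
  obtain a I where I: "lat.sublattice_index (\<alpha> - of_int a) I"
    using lat.sublattice_index_CM[OF \<alpha>(2) CM] by blast
  interpret theta_algebraic \<Gamma> w1 w2 \<theta> "inverse (lattice_A \<Gamma>)" "theta_sign \<Gamma>" ?L g2 g3 p0 "\<alpha> - of_int a" I
  proof unfold_locales
    fix x n assume "x ^ n \<in> ?L" "n > (0::nat)"
    then show "x \<in> ?L" by (rule algebraic_closure_root[OF sub])
  next
    show "g2 \<in> ?L" "g3 \<in> ?L" using gK subset_algebraic_closure[OF sub] by auto
  next
    fix z assume "z \<notin> \<Gamma>"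
    then show "(deriv th.P z)\<^sup>2 = 4 * (th.P z - p0) ^ 3 - g2 * (th.P z - p0) - g3"
      "deriv (deriv th.P) z = 6 * (th.P z - p0)\<^sup>2 - g2 / 2"
      unfolding g2_def g3_def using T.P_ode[OF p0] by blast+
  next
    fix t assume t: "lat.torsion t" "t \<notin> \<Gamma>"
    then obtain n where "n > 0" "of_nat n * t \<in> \<Gamma>" by (auto simp: lat.torsion_def)
    then show "th.P t - p0 \<in> ?L"
      using W.u_torsion_algebraic[OF sub gK[unfolded g2_def g3_def], of t n] t(2) p0[OF t(2)] T.poles by simp
  next
    have "\<alpha> \<in> K" using \<alpha>(1) by (simp add: ring_of_integers_def)
    then have "\<alpha> - of_int a \<in> K"
      using Kc.L_of_nat[of "nat a"] Kc.L_of_nat[of "nat (- a)"] Kc.L_diff[of \<alpha> "of_nat (nat a)"] Kc.L_basic(3)[of \<alpha> "of_nat (nat (- a))"]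
      by (cases "a \<ge> 0") auto
    then show "\<alpha> - of_int a \<in> ?L" using subset_algebraic_closure[OF sub] by blast
  qed (use I \<alpha>(2) in auto)
  have "kronecker_theta_translate \<Gamma> \<theta> z0 w0 = (\<lambda>z w. exp (- (inverse (lattice_A \<Gamma>) * (z0 * cnj w0)))
      * exp (- (inverse (lattice_A \<Gamma>) * (z * cnj w0 + w * cnj z0))) * (\<theta> (z + z0 + (w + w0)) / (\<theta> (z + z0) * \<theta> (w + w0))))"
    unfolding kronecker_theta_translate_def kronecker_theta_def divide_inverse by (simp only: mult.commute)
  then show ?thesis
    using kronecker_theta_translate_algebraic[OF lat.lattice_tensor_rat_torsion[OF assms(10)] lat.lattice_tensor_rat_torsion[OF assms(11)]]
    by simp
qed

end
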